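(* Let $\mathbb{F}$ be a field, $G$ a finite group and $m\ge 1$. The assignment $$g\mapsto g,\quad s_k\mapsto s_k,\quad u_l\mapsto x_l,\quad \varepsilon_l\mapsto 0\qquad (g\in G^m,\ 1\le k\le m-1,\ 1\le l\le m)$$ defines an algebra epimorphism $\overline{\Phi}:\overline{\mathcal{H}}_m(G)\to\mathcal{H}_m(G)$.
   Context: For $n\ge 1$, $\overline{G}_n$ is the semigroup of $n\times n$ matrices with entries in $G\cup\{0\}$ having at most one nonzero entry in each row and column, under matrix multiplication with $g0=0g=0$, $g+0=0+g=g$ (0 an extra symbol); $\overline{G}_0=\{1\}$. $\mathbb{F}\overline{G}_n$ is the semigroup algebra with basis $\overline{G}_n$ (the zero matrix is one of the basis elements). A permutation $\sigma\in S_n$ is identified with the matrix having $1$ in position $(i,j)$ iff $\sigma(j)=i$, and $g=(g_1,\dots,g_n)\in G^n$ with the diagonal matrix with entries $g_i$; $s_i=(i,i+1)$; ${}^{w}g=(g_{w^{-1}(1)},\ldots,g_{w^{-1}(n)})$; $h^{(i)}\in G^n$ has $h$ in position $i$ and $1$ elsewhere; $\varepsilon_i$ is the diagonal matrix with $(i,i)$ entry $0$ and other diagonal entries $1$; $t_{kl}=\sum_{h\in G}h^{(k)}(h^{-1})^{(l)}$. For $m\le n$, $\overline{G}_m$ is embedded in $\overline{G}_n$ by $\gamma\mapsto \mathrm{diag}(\gamma,1,\dots,1)$. $\overline{G}'_{n-m}\subseteq\overline{G}_n$ is the subsemigroup of matrices whose first $m$ diagonal entries equal $1$; $\overline{\mathcal{Z}}_{m,n}$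 is the centralizer of $\overline{G}'_{n-m}$ in $\mathbb{F}\overline{G}_n$. For $\gamma\in\overline{G}_n$, $\deg(\gamma)=|\{k:\gamma_{kk}\ne 1\}|$, extended to linear combinations as the maximum over elements with nonzero coefficient. $\theta_n:\mathbb{F}\overline{G}_n\to\mathbb{F}\overline{G}_{n-1}$ is the linear map sending $\gamma\in\overline{G}_n$ to its upper left corner of order $n-1$. $\overline{\mathcal{Z}}_m$ is the algebra of sequences $(\alpha_n)_{n\ge m}$ with $\alpha_n\in\overline{\mathcal{Z}}_{m,n}$, $\theta_n(\alpha_n)=\alpha_{n-1}$ for $n>m$, $\sup_n\deg(\alpha_n)<\infty$, with componentwise operations; $\mathbb{F}\overline{G}_m$ embeds in it as constant sequences. Put $u_{k|n}=\sum_{i=k+1}^n t_{ki}(k\,i)(1-\varepsilon_k)(1-\varepsilon_i)\in\overline{\mathcal{Z}}_{m,n}$, where $(k\,i)$ is the transposition, and $u_k=(u_{k|n})_{n\ge m}\in\overline{\mathcal{Z}}_m$ for $1\le k\le m$. $\overline{\mathcal{H}}_m(G)$ is the subalgebra of $\overline{\mathcal{Z}}_m$ generated by $\mathbb{F}\overline{G}_m$ (itself generated by $G^m$, the $s_k$ and the $\varepsilon_l$) and $u_1,\dots,u_m$. $\mathcal{H}_m(G)$ (wreath Hecke algebra) is the algebra generated by $g\in G^m$, $s_1,\ldots,s_{m-1}$, $x_1,\ldots,x_m$ subject to the multiplication relations of $G^m$, $s_i^2=1$, $s_is_j=s_js_i$ ($|i-j|>1$), $s_is_{i+1}s_i=s_{i+1}s_is_{i+1}$,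 $s_ig={}^{s_i}g\,s_i$, $gx_k=x_kg$, $s_kx_k=x_{k+1}s_k+t_{k,k+1}$, $s_kx_l=x_ls_k$ ($l\ne k,k+1$), $x_kx_l=x_lx_k$. *)

theory Defs
  imports "HOL-Algebra.QuotRing" "HOL-Algebra.Module" "HOL-Algebra.Product_Groups"
    "HOL-Combinatorics.Transposition"
begin

text \<open>
  An algebra over the field \<^typ>\<open>'f::field\<close> is a \<^typ>\<open>('f, 'a) module\<close> record: a (not
  necessarily commutative) ring together with a scalar multiplication. The locale \<open>algebra\<close> of
  HOL-Algebra requires a commutative ring and is therefore not used.
\<close>

definition alg_hom :: "('f::field, 'a) module \<Rightarrow> ('f, 'c) module \<Rightarrow> ('a \<Rightarrow> 'c) set" where
  "alg_hom A B = {\<Phi> \<in> ring_hom A B.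
     \<forall>c. \<forall>a \<in> carrier A. \<Phi> (c \<odot>\<^bsub>A\<^esub> a) = c \<odot>\<^bsub>B\<^esub> \<Phi> a}"

definition alg_epi :: "('f::field, 'a) module \<Rightarrow> ('f, 'c) module \<Rightarrow> ('a \<Rightarrow> 'c) set" where
  "alg_epi A B = {\<Phi> \<in> alg_hom A B. \<Phi> ` carrier A = carrier B}"

inductive_set gen_subalg :: "('f::field, 'a) module \<Rightarrow> 'a set \<Rightarrow> 'a set"
  for A :: "('f::field, 'a) module" and T :: "'a set" where
  gen: "x \<in> T \<Longrightarrow> x \<in> gen_subalg A T"
| one: "\<one>\<^bsub>A\<^esub> \<in> gen_subalg A T"
| add: "x \<in> gen_subalg A T \<Longrightarrow> y \<in> gen_subalg A T \<Longrightarrow> x \<oplus>\<^bsub>A\<^esub> y \<in> gen_subalg A T"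
| mult: "x \<in> gen_subalg A T \<Longrightarrow> y \<in> gen_subalg A T \<Longrightarrow> x \<otimes>\<^bsub>A\<^esub> y \<in> gen_subalg A T"
| smult: "x \<in> gen_subalg A T \<Longrightarrow> c \<odot>\<^bsub>A\<^esub> x \<in> gen_subalg A T"

text \<open>
  Quotient by a two-sided ideal. In a unital algebra every ring ideal is stable under scalars,
  and the union below is the single coset of \<open>c \<odot> a\<close> for any \<open>a \<in> C\<close>.
\<close>

definition quot_alg :: "('f::field, 'a) module \<Rightarrow> 'a set \<Rightarrow> ('f, 'a set) module" where
  "quot_alg A I = \<lparr>
     carrier = carrier (A Quot I),
     mult = mult (A Quot I),
     one = \<one>\<^bsub>A Quot I\<^esub>,
     zero = \<zero>\<^bsub>A Quot I\<^esub>,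
     add = add (A Quot I),
     smult = (\<lambda>c C. \<Union>a\<in>C. I +>\<^bsub>A\<^esub> (c \<odot>\<^bsub>A\<^esub> a))\<rparr>"

text \<open>
  The algebra with basis a monoid \<open>M\<close>: finitely supported functions on \<open>carrier M\<close>, with
  convolution as product. If \<open>M\<close> has a zero element, it is one of the basis elements.
\<close>

definition supp :: "('a \<Rightarrow> 'f::zero) \<Rightarrow> 'a set" where
  "supp \<alpha> = {x. \<alpha> x \<noteq> 0}"

definition basis_elt :: "'a \<Rightarrow> 'a \<Rightarrow> 'f::field" where
  "basis_elt x = (\<lambda>y. if y = x then 1 else 0)"

definition monoid_algebra :: "('a, 'b) monoid_scheme \<Rightarrow> ('f::field, 'a \<Rightarrow> 'f) module" where
  "monoid_algebra M = \<lparr>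
     carrier = {\<alpha>. finite (supp \<alpha>) \<and> supp \<alpha> \<subseteq> carrier M},
     mult = (\<lambda>\<alpha> \<beta> x. \<Sum>(y, z) \<in> {(y, z). y \<in> supp \<alpha> \<and> z \<in> supp \<beta> \<and> y \<otimes>\<^bsub>M\<^esub> z = x}. \<alpha> y * \<beta> z),
     one = basis_elt \<one>\<^bsub>M\<^esub>,
     zero = (\<lambda>x. 0),
     add = (\<lambda>\<alpha> \<beta> x. \<alpha> x + \<beta> x),
     smult = (\<lambda>c \<alpha> x. c * \<alpha> x)\<rparr>"

definition lin_ext :: "('a \<Rightarrow> 'b) \<Rightarrow> ('a \<Rightarrow> 'f::field) \<Rightarrow> ('b \<Rightarrow> 'f)" where
  "lin_ext \<phi> \<alpha> = (\<lambda>y. \<Sum>x \<in> {x \<in> supp \<alpha>. \<phi> x = y}. \<alpha> x)"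

definition Gpow :: "('g, 'b) monoid_scheme \<Rightarrow> nat \<Rightarrow> (nat \<Rightarrow> 'g) monoid" where
  "Gpow G n = product_group {1..n} (\<lambda>_. G)"

definition at_pos :: "('g, 'b) monoid_scheme \<Rightarrow> nat \<Rightarrow> nat \<Rightarrow> 'g \<Rightarrow> (nat \<Rightarrow> 'g)" where
  "at_pos G n i h = (\<lambda>j\<in>{1..n}. if j = i then h else \<one>\<^bsub>G\<^esub>)"

definition perm_act :: "nat \<Rightarrow> (nat \<Rightarrow> nat) \<Rightarrow> (nat \<Rightarrow> 'g) \<Rightarrow> (nat \<Rightarrow> 'g)" where
  "perm_act n w g = (\<lambda>i\<in>{1..n}. g (inv_into UNIV w i))"

definition t_elt ::
  "('f::field, 'a) module \<Rightarrow> ((nat \<Rightarrow> 'g) \<Rightarrow> 'a) \<Rightarrow> ('g, 'b) monoid_scheme \<Rightarrow> nat \<Rightarrow> nat \<Rightarrow> nat \<Rightarrow> 'a"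
where
  "t_elt A \<iota> G n k l =
     (\<Oplus>\<^bsub>A\<^esub>h\<in>carrier G. \<iota> (at_pos G n k h) \<otimes>\<^bsub>A\<^esub> \<iota> (at_pos G n l (inv\<^bsub>G\<^esub> h)))"

text \<open>
  \<open>G \<union> {0}\<close> is \<^typ>\<open>'g option\<close>, with \<^const>\<open>None\<close> as the extra symbol \<open>0\<close>. The sum of two
  nonzero entries is undefined in the mathematics and never arises when multiplying elements
  of \<open>Gbar_set G n\<close>.
\<close>

fun zmult :: "('g, 'b) monoid_scheme \<Rightarrow> 'g option \<Rightarrow> 'g option \<Rightarrow> 'g option" where
  "zmult G (Some a) (Some b) = Some (a \<otimes>\<^bsub>G\<^esub> b)"
| "zmult G None y = None"
| "zmult G x None = None"

fun zadd :: "'g option \<Rightarrow> 'g option \<Rightarrow> 'g option" where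
  "zadd None y = y"
| "zadd x None = x"
| "zadd (Some a) (Some b) = undefined"

text \<open>Matrices are indexed by \<open>{1..n} \<times> {1..n}\<close> and have value \<^const>\<open>None\<close> outside.\<close>

type_synonym 'g gmat = "nat \<Rightarrow> nat \<Rightarrow> 'g option"

definition gmat_mult :: "('g, 'b) monoid_scheme \<Rightarrow> nat \<Rightarrow> 'g gmat \<Rightarrow> 'g gmat \<Rightarrow> 'g gmat" where
  "gmat_mult G n \<gamma> \<delta> =
     (\<lambda>i j. foldr zadd (map (\<lambda>k. zmult G (\<gamma> i k) (\<delta> k j)) [1..<Suc n]) None)"

definition Gbar_set :: "('g, 'b) monoid_scheme \<Rightarrow> nat \<Rightarrow> 'g gmat set" where
  "Gbar_set G n = {\<gamma>.
     (\<forall>i j a. \<gamma> i j = Some a \<longrightarrow> i \<in> {1..n} \<and> j \<in> {1..n} \<and> a \<in> carrier G) \<and>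
     (\<forall>i j j'. \<gamma> i j \<noteq> None \<and> \<gamma> i j' \<noteq> None \<longrightarrow> j = j') \<and>
     (\<forall>i i' j. \<gamma> i j \<noteq> None \<and> \<gamma> i' j \<noteq> None \<longrightarrow> i = i')}"

definition diag_mat :: "nat \<Rightarrow> (nat \<Rightarrow> 'g) \<Rightarrow> 'g gmat" where
  "diag_mat n g = (\<lambda>i j. if i \<in> {1..n} \<and> i = j then Some (g i) else None)"

definition perm_mat :: "('g, 'b) monoid_scheme \<Rightarrow> nat \<Rightarrow> (nat \<Rightarrow> nat) \<Rightarrow> 'g gmat" where
  "perm_mat G n \<sigma> =
     (\<lambda>i j. if i \<in> {1..n} \<and> j \<in> {1..n} \<and> \<sigma> j = i then Some \<one>\<^bsub>G\<^esub> else None)"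

definition eps_mat :: "('g, 'b) monoid_scheme \<Rightarrow> nat \<Rightarrow> nat \<Rightarrow> 'g gmat" where
  "eps_mat G n l = (\<lambda>i j. if i \<in> {1..n} \<and> i = j \<and> i \<noteq> l then Some \<one>\<^bsub>G\<^esub> else None)"

definition Gbar :: "('g, 'b) monoid_scheme \<Rightarrow> nat \<Rightarrow> 'g gmat monoid" where
  "Gbar G n = \<lparr>carrier = Gbar_set G n, mult = gmat_mult G n,
               one = diag_mat n (\<lambda>_. \<one>\<^bsub>G\<^esub>)\<rparr>"

definition emb_mat :: "('g, 'b) monoid_scheme \<Rightarrow> nat \<Rightarrow> nat \<Rightarrow> 'g gmat \<Rightarrow> 'g gmat" where
  "emb_mat G m n \<gamma> = (\<lambda>i j.
     if i \<in> {1..m} \<and> j \<in> {1..m} then \<gamma> i j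
     else if i \<in> {m<..n} \<and> i = j then Some \<one>\<^bsub>G\<^esub> else None)"

definition corner_mat :: "nat \<Rightarrow> 'g gmat \<Rightarrow> 'g gmat" where
  "corner_mat n \<gamma> = (\<lambda>i j. if i \<in> {1..n} \<and> j \<in> {1..n} then \<gamma> i j else None)"

definition deg_mat :: "('g, 'b) monoid_scheme \<Rightarrow> nat \<Rightarrow> 'g gmat \<Rightarrow> nat" where
  "deg_mat G n \<gamma> = card {k \<in> {1..n}. \<gamma> k k \<noteq> Some \<one>\<^bsub>G\<^esub>}"

type_synonym ('g, 'f) gseq = "nat \<Rightarrow> 'g gmat \<Rightarrow> 'f"

abbreviation FGbar ::
  "('g, 'b) monoid_scheme \<Rightarrow> nat \<Rightarrow> ('f::field, 'g gmat \<Rightarrow> 'f) module" where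
  "FGbar G n \<equiv> monoid_algebra (Gbar G n)"

definition Gbar' :: "('g, 'b) monoid_scheme \<Rightarrow> nat \<Rightarrow> nat \<Rightarrow> 'g gmat set" where
  "Gbar' G m n = {\<gamma> \<in> Gbar_set G n. \<forall>i \<in> {1..m}. \<gamma> i i = Some \<one>\<^bsub>G\<^esub>}"

definition Zcent ::
  "('g, 'b) monoid_scheme \<Rightarrow> nat \<Rightarrow> nat \<Rightarrow> ('g gmat \<Rightarrow> 'f::field) set" where
  "Zcent G m n = {\<alpha> \<in> carrier (FGbar G n). \<forall>\<gamma> \<in> Gbar' G m n.
     \<alpha> \<otimes>\<^bsub>FGbar G n\<^esub> basis_elt \<gamma> = basis_elt \<gamma> \<otimes>\<^bsub>FGbar G n\<^esub> \<alpha>}"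

text \<open>
  The value at \<open>0\<close>, irrelevant for boundedness of degrees, is set to \<open>0\<close>.
\<close>

definition deg :: "('g, 'b) monoid_scheme \<Rightarrow> nat \<Rightarrow> ('g gmat \<Rightarrow> 'f::field) \<Rightarrow> nat" where
  "deg G n \<alpha> = Max (insert 0 (deg_mat G n ` supp \<alpha>))"

definition theta :: "nat \<Rightarrow> ('g gmat \<Rightarrow> 'f::field) \<Rightarrow> ('g gmat \<Rightarrow> 'f)" where
  "theta n = lin_ext (corner_mat (n - 1))"

text \<open>Sequences \<open>(\<alpha>\<^sub>n)\<close> with \<open>n \<ge> m\<close> are functions with value \<^const>\<open>undefined\<close> below \<open>m\<close>.\<close>

definition Zbar :: "('g, 'b) monoid_scheme \<Rightarrow> nat \<Rightarrow> ('f::field, ('g, 'f) gseq) module" where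
  "Zbar G m = \<lparr>
     carrier = {\<alpha> \<in> (\<Pi>\<^sub>E n\<in>{m..}. Zcent G m n).
        (\<forall>n>m. theta n (\<alpha> n) = \<alpha> (n - 1)) \<and> (\<exists>D. \<forall>n\<ge>m. deg G n (\<alpha> n) \<le> D)},
     mult = (\<lambda>\<alpha> \<beta>. \<lambda>n\<in>{m..}. \<alpha> n \<otimes>\<^bsub>FGbar G n\<^esub> \<beta> n),
     one = (\<lambda>n\<in>{m..}. \<one>\<^bsub>FGbar G n\<^esub>),
     zero = (\<lambda>n\<in>{m..}. \<zero>\<^bsub>FGbar G n\<^esub>),
     add = (\<lambda>\<alpha> \<beta>. \<lambda>n\<in>{m..}. \<alpha> n \<oplus>\<^bsub>FGbar G n\<^esub> \<beta> n),
     smult = (\<lambda>c \<alpha>. \<lambda>n\<in>{m..}. c \<odot>\<^bsub>FGbar G n\<^esub> \<alpha> n)\<rparr>"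

definition const_seq ::
  "('g, 'b) monoid_scheme \<Rightarrow> nat \<Rightarrow> ('g gmat \<Rightarrow> 'f::field) \<Rightarrow> ('g, 'f) gseq" where
  "const_seq G m \<alpha> = (\<lambda>n\<in>{m..}. lin_ext (emb_mat G m n) \<alpha>)"

definition u_elt ::
  "('g, 'b) monoid_scheme \<Rightarrow> nat \<Rightarrow> nat \<Rightarrow> ('g gmat \<Rightarrow> 'f::field)" where
  "u_elt G n k = (let A = FGbar G n in
     \<Oplus>\<^bsub>A\<^esub>i\<in>{k+1..n}.
       t_elt A (\<lambda>g. basis_elt (diag_mat n g)) G n k i
       \<otimes>\<^bsub>A\<^esub> basis_elt (perm_mat G n (transpose k i))
       \<otimes>\<^bsub>A\<^esub> (\<one>\<^bsub>A\<^esub> \<ominus>\<^bsub>A\<^esub> basis_elt (eps_mat G n k))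
       \<otimes>\<^bsub>A\<^esub> (\<one>\<^bsub>A\<^esub> \<ominus>\<^bsub>A\<^esub> basis_elt (eps_mat G n i)))"

definition u_seq ::
  "('g, 'b) monoid_scheme \<Rightarrow> nat \<Rightarrow> nat \<Rightarrow> ('g, 'f::field) gseq" where
  "u_seq G m k = (\<lambda>n\<in>{m..}. u_elt G n k)"

definition Hbar :: "('g, 'b) monoid_scheme \<Rightarrow> nat \<Rightarrow> ('f::field, ('g, 'f) gseq) module" where
  "Hbar G m = (Zbar G m)\<lparr>carrier :=
     gen_subalg (Zbar G m) (const_seq G m ` carrier (FGbar G m) \<union> u_seq G m ` {1..m})\<rparr>"

definition Hbar_g :: "('g, 'b) monoid_scheme \<Rightarrow> nat \<Rightarrow> (nat \<Rightarrow> 'g) \<Rightarrow> ('g, 'f::field) gseq" where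
  "Hbar_g G m g = const_seq G m (basis_elt (diag_mat m g))"

definition Hbar_s :: "('g, 'b) monoid_scheme \<Rightarrow> nat \<Rightarrow> nat \<Rightarrow> ('g, 'f::field) gseq" where
  "Hbar_s G m k = const_seq G m (basis_elt (perm_mat G m (transpose k (k+1))))"

definition Hbar_eps :: "('g, 'b) monoid_scheme \<Rightarrow> nat \<Rightarrow> nat \<Rightarrow> ('g, 'f::field) gseq" where
  "Hbar_eps G m l = const_seq G m (basis_elt (eps_mat G m l))"

datatype 'g wgen = GenG "nat \<Rightarrow> 'g" | GenS nat | GenX nat

definition wgens :: "('g, 'b) monoid_scheme \<Rightarrow> nat \<Rightarrow> 'g wgen set" where
  "wgens G m = GenG ` carrier (Gpow G m) \<union> GenS ` {1..<m} \<union> GenX ` {1..m}"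

definition free_monoid :: "'a set \<Rightarrow> 'a list monoid" where
  "free_monoid T = \<lparr>carrier = lists T, mult = (@), one = []\<rparr>"

abbreviation free_alg :: "'a set \<Rightarrow> ('f::field, 'a list \<Rightarrow> 'f) module" where
  "free_alg T \<equiv> monoid_algebra (free_monoid T)"

abbreviation letter :: "'a \<Rightarrow> ('a list \<Rightarrow> 'f::field)" where
  "letter x \<equiv> basis_elt [x]"

text \<open>
  The multiplication relations of \<open>G\<^sup>m\<close> include the identification of the neutral element
  of \<open>G\<^sup>m\<close> with the unit of the algebra.
\<close>

definition wreath_Hecke_rels ::
  "('g, 'b) monoid_scheme \<Rightarrow> nat \<Rightarrow> ('g wgen list \<Rightarrow> 'f::field) set" where
  "wreath_Hecke_rels G m =
    (let A = free_alg (wgens G m);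
         e = (\<lambda>g. letter (GenG g)); s = (\<lambda>i. letter (GenS i)); x = (\<lambda>i. letter (GenX i))
     in {e g \<otimes>\<^bsub>A\<^esub> e h \<ominus>\<^bsub>A\<^esub> e (g \<otimes>\<^bsub>Gpow G m\<^esub> h) | g h.
            g \<in> carrier (Gpow G m) \<and> h \<in> carrier (Gpow G m)}
      \<union> {e \<one>\<^bsub>Gpow G m\<^esub> \<ominus>\<^bsub>A\<^esub> \<one>\<^bsub>A\<^esub>}
      \<union> {s i \<otimes>\<^bsub>A\<^esub> s i \<ominus>\<^bsub>A\<^esub> \<one>\<^bsub>A\<^esub> | i. i \<in> {1..<m}}
      \<union> {s i \<otimes>\<^bsub>A\<^esub> s j \<ominus>\<^bsub>A\<^esub> s j \<otimes>\<^bsub>A\<^esub> s i | i j.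
            i \<in> {1..<m} \<and> j \<in> {1..<m} \<and> \<bar>int i - int j\<bar> > 1}
      \<union> {s i \<otimes>\<^bsub>A\<^esub> s (i+1) \<otimes>\<^bsub>A\<^esub> s i \<ominus>\<^bsub>A\<^esub> s (i+1) \<otimes>\<^bsub>A\<^esub> s i \<otimes>\<^bsub>A\<^esub> s (i+1) | i.
            i \<in> {1..<m} \<and> i + 1 \<in> {1..<m}}
      \<union> {s i \<otimes>\<^bsub>A\<^esub> e g \<ominus>\<^bsub>A\<^esub> e (perm_act m (transpose i (i+1)) g) \<otimes>\<^bsub>A\<^esub> s i | i g.
            i \<in> {1..<m} \<and> g \<in> carrier (Gpow G m)}
      \<union> {e g \<otimes>\<^bsub>A\<^esub> x k \<ominus>\<^bsub>A\<^esub> x k \<otimes>\<^bsub>A\<^esub> e g | g k.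
            g \<in> carrier (Gpow G m) \<and> k \<in> {1..m}}
      \<union> {s k \<otimes>\<^bsub>A\<^esub> x k \<ominus>\<^bsub>A\<^esub> (x (k+1) \<otimes>\<^bsub>A\<^esub> s k \<oplus>\<^bsub>A\<^esub> t_elt A e G m k (k+1)) | k.
            k \<in> {1..<m}}
      \<union> {s k \<otimes>\<^bsub>A\<^esub> x l \<ominus>\<^bsub>A\<^esub> x l \<otimes>\<^bsub>A\<^esub> s k | k l.
            k \<in> {1..<m} \<and> l \<in> {1..m} \<and> l \<noteq> k \<and> l \<noteq> k + 1}
      \<union> {x k \<otimes>\<^bsub>A\<^esub> x l \<ominus>\<^bsub>A\<^esub> x l \<otimes>\<^bsub>A\<^esub> x k | k l. k \<in> {1..m} \<and> l \<in> {1..m}})"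

definition wreath_Hecke_ideal ::
  "('g, 'b) monoid_scheme \<Rightarrow> nat \<Rightarrow> ('g wgen list \<Rightarrow> 'f::field) set" where
  "wreath_Hecke_ideal G m = Idl\<^bsub>free_alg (wgens G m)\<^esub> (wreath_Hecke_rels G m)"

definition wreath_Hecke ::
  "('g, 'b) monoid_scheme \<Rightarrow> nat \<Rightarrow> ('f::field, ('g wgen list \<Rightarrow> 'f) set) module" where
  "wreath_Hecke G m = quot_alg (free_alg (wgens G m)) (wreath_Hecke_ideal G m)"

definition wh_gen ::
  "('g, 'b) monoid_scheme \<Rightarrow> nat \<Rightarrow> 'g wgen \<Rightarrow> ('g wgen list \<Rightarrow> 'f::field) set" where
  "wh_gen G m a = wreath_Hecke_ideal G m +>\<^bsub>free_alg (wgens G m)\<^esub> letter a"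

end

theory Submission
  imports Defs
begin

text \<open>
  Killing the singular matrices maps the algebra of level \<open>n\<close> into an algebra of monomial matrices,
  where \<open>\<epsilon>\<^sub>l\<close> becomes \<open>0\<close> and \<open>u\<^sub>k\<close> becomes the Jucys-Murphy element \<open>\<Sum>\<^sub>i t\<^sub>k\<^sub>i (k i)\<close>, \<open>k < i \<le> n\<close>.
  These elements satisfy the relations of the wreath Hecke algebra, which therefore maps to the
  monomial algebra of every level, and the point is that these homomorphisms are jointly injective:
  modulo the relations every word is a combination of normal words \<open>x\<^sub>k\<^sub>1 \<dots> x\<^sub>k\<^sub>d g w\<close> with
  \<open>k\<^sub>1 \<le> \<dots> \<le> k\<^sub>d\<close>, and for large \<open>n\<close> their images are separated by the coefficients at monomial
  matrices which move \<open>d\<close> indices above \<open>m\<close>. Hence a sequence can be sent to the coset of any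
  noncommutative polynomial with the same image in all monomial algebras.
\<close>

section \<open>Monoid algebras\<close>

text \<open>\<open>Hbar G m\<close> is given by generators only, with no presentation, so a map out
  of it cannot be defined by prescribing images and checking relations. The construction runs the
  other way: the wreath Hecke algebra does have a presentation and is mapped to every level, and the
  map sought is the projection followed by the inverse of the resulting embedding. This needs the
  ideal of relations to be exactly the common kernel. No single level suffices, as the image at
  level n is spanned by finitely many matrices while the powers of x_1 are independent. A factor x_k
  brings in at most one index above m, so a word with d such factors becomes visible only when d
  fresh indices are available; there, among words with at most d factors, it alone contributes to
  the chosen coefficient, and it contributes exactly 1. The argument is therefore independent of the
  characteristic, and it yields the basis of normal words instead of presupposing it. Killing the
  singular matrices is multiplicative because they form an ideal whose complement is closed under
  products.\<close>

definition pairing :: "('a \<Rightarrow> 'f::field) \<Rightarrow> ('a \<Rightarrow> 'f) \<Rightarrow> 'f" where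
  "pairing \<alpha> F = (\<Sum>x\<in>supp \<alpha>. \<alpha> x * F x)"

text \<open>Supports shrink under cancellation, so sums over \<open>supp\<close> cannot be combined
  termwise; on one finite set containing all supports they can.\<close>

lemma pairing_superset: "finite S \<Longrightarrow> supp \<alpha> \<subseteq> S \<Longrightarrow> pairing \<alpha> F = (\<Sum>x\<in>S. \<alpha> x * F x)"
  unfolding pairing_def by (rule sum.mono_neutral_left) (auto simp: supp_def)

lemma pairing_cong: "(\<And>x. x \<in> supp \<alpha> \<Longrightarrow> F x = F' x) \<Longrightarrow> pairing \<alpha> F = pairing \<alpha> F'"
  unfolding pairing_def by (rule sum.cong) auto

lemma supp_add: "supp (\<lambda>x. \<alpha> x + \<beta> x :: 'f::field) \<subseteq> supp \<alpha> \<union> supp \<beta>"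
  by (auto simp: supp_def)

lemma supp_smult: "supp (\<lambda>x. c * \<alpha> x :: 'f::field) \<subseteq> supp \<alpha>"
  by (auto simp: supp_def)

lemma supp_basis [simp]: "supp (basis_elt x :: _ \<Rightarrow> 'f::field) = {x}"
  by (auto simp: supp_def basis_elt_def)

lemma supp_zero [simp]: "supp (\<lambda>x. 0 :: 'f::field) = {}"
  by (auto simp: supp_def)

lemma basis_apply: "basis_elt x y = (if y = x then 1 else 0)"
  by (simp add: basis_elt_def)

lemma pairing_basis [simp]: "pairing (basis_elt x) F = F x"
  unfolding pairing_def supp_basis by (simp add: basis_apply)

lemma pairing_add:
  assumes "finite (supp \<alpha>)" "finite (supp \<beta>)"
  shows "pairing (\<lambda>x. \<alpha> x + \<beta> x) F = pairing \<alpha> F + pairing \<beta> F"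
proof -
  let ?S = "supp \<alpha> \<union> supp \<beta>"
  have "finite ?S" using assms by auto
  then show ?thesis
    using pairing_superset[of ?S "\<lambda>x. \<alpha> x + \<beta> x" F] pairing_superset[of ?S \<alpha> F]
      pairing_superset[of ?S \<beta> F] supp_add[of \<alpha> \<beta>]
    by (simp add: sum.distrib distrib_right)
qed

lemma pairing_smult:
  assumes "finite (supp \<alpha>)"
  shows "pairing (\<lambda>x. c * \<alpha> x) F = c * pairing \<alpha> F"
  using pairing_superset[OF assms supp_smult[of c \<alpha>]]
  by (simp add: pairing_def sum_distrib_left mult.assoc)

lemma pairing_add_right: "pairing \<alpha> (\<lambda>x. F x + F' x) = pairing \<alpha> F + pairing \<alpha> F'"
  by (simp add: pairing_def sum.distrib distrib_left)

lemma pairing_swap: "pairing \<alpha> (\<lambda>x. pairing \<beta> (F x)) = pairing \<beta> (\<lambda>y. pairing \<alpha> (\<lambda>x. F x y))"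
  unfolding pairing_def sum_distrib_left
  by (subst sum.swap) (simp add: mult.left_commute)

lemma pairing_eval:
  assumes "finite (supp \<alpha>)"
  shows "pairing \<alpha> (\<lambda>y. if y = x then 1 else 0) = \<alpha> x"
proof -
  have "pairing \<alpha> (\<lambda>y. if y = x then 1 else 0) = (\<Sum>y\<in>supp \<alpha>. if x = y then \<alpha> y else 0)"
    unfolding pairing_def by (rule sum.cong) auto
  also have "\<dots> = \<alpha> x" using assms by (simp add: supp_def)
  finally show ?thesis .
qed

context
  fixes M :: "('a, 'b) monoid_scheme"
begin

abbreviation (input) "MA \<equiv> monoid_algebra M :: ('f::field, 'a \<Rightarrow> 'f) module"

lemma ma_carrier: "\<alpha> \<in> carrier (monoid_algebra M) \<longleftrightarrow> finite (supp \<alpha>) \<and> supp \<alpha> \<subseteq> carrier M"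
  by (simp add: monoid_algebra_def)

lemma ma_carrierD: "\<alpha> \<in> carrier (monoid_algebra M) \<Longrightarrow> finite (supp \<alpha>)"
  by (simp add: ma_carrier)

lemma ma_add: "\<alpha> \<oplus>\<^bsub>monoid_algebra M\<^esub> \<beta> = (\<lambda>x. \<alpha> x + \<beta> x)"
  by (simp add: monoid_algebra_def)

lemma ma_zero: "\<zero>\<^bsub>monoid_algebra M\<^esub> = (\<lambda>x. 0)"
  by (simp add: monoid_algebra_def)

lemma ma_one: "\<one>\<^bsub>monoid_algebra M\<^esub> = basis_elt \<one>\<^bsub>M\<^esub>"
  by (simp add: monoid_algebra_def)

lemma ma_smult: "c \<odot>\<^bsub>monoid_algebra M\<^esub> \<alpha> = (\<lambda>x. c * \<alpha> x)"
  by (simp add: monoid_algebra_def)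

text \<open>Convolution as an iterated pairing with an indicator function. In this form the ring
  laws reduce to linearity of \<open>pairing\<close> and to the laws of the monoid.\<close>

lemma ma_mult:
  assumes "finite (supp \<alpha>)" "finite (supp \<beta>)"
  shows "(\<alpha> \<otimes>\<^bsub>monoid_algebra M\<^esub> \<beta>) x
    = pairing \<alpha> (\<lambda>y. pairing \<beta> (\<lambda>z. if y \<otimes>\<^bsub>M\<^esub> z = x then 1 else 0))"
proof -
  have "(\<alpha> \<otimes>\<^bsub>monoid_algebra M\<^esub> \<beta>) x =
    (\<Sum>(y, z) \<in> {(y, z) \<in> supp \<alpha> \<times> supp \<beta>. y \<otimes>\<^bsub>M\<^esub> z = x}. \<alpha> y * \<beta> z)"
    by (simp add: monoid_algebra_def conj_assoc)
  also have "\<dots> = (\<Sum>(y, z) \<in> supp \<alpha> \<times> supp \<beta>. \<alpha> y * (\<beta> z * (if y \<otimes>\<^bsub>M\<^esub> z = x then 1 else 0)))"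
    using assms by (intro sum.mono_neutral_cong_left) (auto split: if_splits)
  also have "\<dots> = pairing \<alpha> (\<lambda>y. pairing \<beta> (\<lambda>z. if y \<otimes>\<^bsub>M\<^esub> z = x then 1 else 0))"
    unfolding pairing_def by (simp add: sum.cartesian_product sum_distrib_left)
  finally show ?thesis .
qed

lemma supp_mult:
  assumes "finite (supp \<alpha>)" "finite (supp \<beta>)"
  shows "supp (\<alpha> \<otimes>\<^bsub>monoid_algebra M\<^esub> \<beta>) \<subseteq> (\<lambda>(y, z). y \<otimes>\<^bsub>M\<^esub> z) ` (supp \<alpha> \<times> supp \<beta>)"
proof
  fix x assume "x \<in> supp (\<alpha> \<otimes>\<^bsub>monoid_algebra M\<^esub> \<beta>)"
  then have "pairing \<alpha> (\<lambda>y. pairing \<beta> (\<lambda>z. if y \<otimes>\<^bsub>M\<^esub> z = x then 1 else 0)) \<noteq> 0"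
    using ma_mult[OF assms, of x] by (simp add: supp_def)
  then obtain y z where "y \<in> supp \<alpha>" "z \<in> supp \<beta>" "y \<otimes>\<^bsub>M\<^esub> z = x"
    unfolding pairing_def by (auto elim!: sum.not_neutral_contains_not_neutral split: if_splits)
  then show "x \<in> (\<lambda>(y, z). y \<otimes>\<^bsub>M\<^esub> z) ` (supp \<alpha> \<times> supp \<beta>)" by force
qed

lemma finite_supp_mult:
  assumes "finite (supp \<alpha>)" "finite (supp \<beta>)"
  shows "finite (supp (\<alpha> \<otimes>\<^bsub>monoid_algebra M\<^esub> \<beta>))"
  using supp_mult[OF assms] assms by (meson finite_SigmaI finite_imageI finite_subset)

text \<open>Summation over the points of the product regroups into summation over pairs of factors.
  Applied to the inner product of a triple product it gives associativity.\<close>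

lemma pairing_mult:
  assumes "finite (supp \<alpha>)" "finite (supp \<beta>)"
  shows "pairing (\<alpha> \<otimes>\<^bsub>monoid_algebra M\<^esub> \<beta>) F = pairing \<alpha> (\<lambda>y. pairing \<beta> (\<lambda>z. F (y \<otimes>\<^bsub>M\<^esub> z)))"
proof -
  let ?P = "(\<lambda>(y, z). y \<otimes>\<^bsub>M\<^esub> z) ` (supp \<alpha> \<times> supp \<beta>)"
  have fin: "finite ?P" using assms by auto
  have "pairing (\<alpha> \<otimes>\<^bsub>monoid_algebra M\<^esub> \<beta>) F = (\<Sum>x\<in>?P. (\<alpha> \<otimes>\<^bsub>monoid_algebra M\<^esub> \<beta>) x * F x)"
    by (rule pairing_superset[OF fin supp_mult[OF assms]])
  also have "\<dots> = (\<Sum>x\<in>?P. \<Sum>y\<in>supp \<alpha>. \<Sum>z\<in>supp \<beta>.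
      if y \<otimes>\<^bsub>M\<^esub> z = x then \<alpha> y * (\<beta> z * F (y \<otimes>\<^bsub>M\<^esub> z)) else 0)"
    unfolding ma_mult[OF assms] pairing_def sum_distrib_left sum_distrib_right
    by (intro sum.cong refl) auto
  also have "\<dots> = (\<Sum>y\<in>supp \<alpha>. \<Sum>z\<in>supp \<beta>. \<Sum>x\<in>?P.
      if y \<otimes>\<^bsub>M\<^esub> z = x then \<alpha> y * (\<beta> z * F (y \<otimes>\<^bsub>M\<^esub> z)) else 0)"
    by (subst sum.swap, rule sum.cong[OF refl], rule sum.swap)
  also have "\<dots> = (\<Sum>y\<in>supp \<alpha>. \<Sum>z\<in>supp \<beta>. \<alpha> y * (\<beta> z * F (y \<otimes>\<^bsub>M\<^esub> z)))"
    using fin by (intro sum.cong refl) auto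
  also have "\<dots> = pairing \<alpha> (\<lambda>y. pairing \<beta> (\<lambda>z. F (y \<otimes>\<^bsub>M\<^esub> z)))"
    by (simp add: pairing_def sum_distrib_left)
  finally show ?thesis .
qed

lemma ma_mult_basis: "basis_elt x \<otimes>\<^bsub>monoid_algebra M\<^esub> basis_elt y = basis_elt (x \<otimes>\<^bsub>M\<^esub> y)"
  by (rule ext) (simp add: ma_mult basis_apply eq_commute)

lemma basis_closed: "x \<in> carrier M \<Longrightarrow> basis_elt x \<in> carrier (monoid_algebra M)"
  by (simp add: ma_carrier)

lemma ma_add_closed:
  "\<alpha> \<in> carrier MA \<Longrightarrow> \<beta> \<in> carrier MA \<Longrightarrow> \<alpha> \<oplus>\<^bsub>MA\<^esub> \<beta> \<in> carrier MA"
  using supp_add[of \<alpha> \<beta>] by (auto simp: ma_carrier ma_add intro: finite_subset)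

lemma ma_smult_closed: "\<alpha> \<in> carrier MA \<Longrightarrow> c \<odot>\<^bsub>MA\<^esub> \<alpha> \<in> carrier MA"
  using supp_smult[of c \<alpha>] by (auto simp: ma_carrier ma_smult intro: finite_subset)

lemma ma_abelian_group: "abelian_group MA"
proof (rule abelian_groupI)
  fix \<alpha> assume \<alpha>: "\<alpha> \<in> carrier MA"
  show "\<exists>\<beta>\<in>carrier MA. \<beta> \<oplus>\<^bsub>MA\<^esub> \<alpha> = \<zero>\<^bsub>MA\<^esub>"
    using ma_smult_closed[OF \<alpha>, of "-1"]
    by (intro bexI[of _ "(-1) \<odot>\<^bsub>MA\<^esub> \<alpha>"]) (auto simp: ma_smult ma_add ma_zero)
qed (auto simp: ma_add ma_zero add_ac ma_add_closed[unfolded ma_add] intro: ma_add_closed[unfolded ma_add],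
     auto simp: ma_carrier)

lemma ma_finsum:
  fixes f :: "'i \<Rightarrow> 'a \<Rightarrow> 'f::field"
  assumes "finite J" "\<And>j. j \<in> J \<Longrightarrow> f j \<in> carrier MA"
  shows "finsum MA f J = (\<lambda>x. \<Sum>j\<in>J. f j x)"
proof -
  interpret abelian_group MA by (rule ma_abelian_group)
  from assms show ?thesis
    by (induction J rule: finite_induct) (auto simp: ma_zero ma_add)
qed

end

lemma ma_ring:
  assumes "monoid M"
  shows "ring (monoid_algebra M :: ('f::field, 'a \<Rightarrow> 'f) module)" (is "ring ?A")
proof -
  interpret M: monoid M by fact
  have cl: "\<alpha> \<otimes>\<^bsub>?A\<^esub> \<beta> \<in> carrier ?A" if "\<alpha> \<in> carrier ?A" "\<beta> \<in> carrier ?A" for \<alpha> \<beta>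
    using that supp_mult[of \<alpha> \<beta> M] finite_supp_mult[of \<alpha> \<beta> M] by (fastforce simp: ma_carrier)
  show ?thesis
  proof (rule ringI)
    show "abelian_group ?A" by (rule ma_abelian_group)
    show "monoid ?A"
    proof (rule monoidI)
      fix \<alpha> \<beta> \<gamma> assume a: "\<alpha> \<in> carrier ?A" "\<beta> \<in> carrier ?A" "\<gamma> \<in> carrier ?A"
      then have f: "finite (supp \<alpha>)" "finite (supp \<beta>)" "finite (supp \<gamma>)" and
        s: "supp \<alpha> \<subseteq> carrier M" "supp \<beta> \<subseteq> carrier M" "supp \<gamma> \<subseteq> carrier M"
        by (auto simp: ma_carrier)
      show "\<alpha> \<otimes>\<^bsub>?A\<^esub> \<beta> \<otimes>\<^bsub>?A\<^esub> \<gamma> = \<alpha> \<otimes>\<^bsub>?A\<^esub> (\<beta> \<otimes>\<^bsub>?A\<^esub> \<gamma>)"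
      proof
        fix x
        show "(\<alpha> \<otimes>\<^bsub>?A\<^esub> \<beta> \<otimes>\<^bsub>?A\<^esub> \<gamma>) x = (\<alpha> \<otimes>\<^bsub>?A\<^esub> (\<beta> \<otimes>\<^bsub>?A\<^esub> \<gamma>)) x"
          using f s by (auto simp: ma_mult finite_supp_mult pairing_mult M.m_assoc subset_iff
              intro!: pairing_cong)
      qed
    next
      fix \<alpha> assume a: "\<alpha> \<in> carrier ?A"
      have s: "\<And>x. x \<in> supp \<alpha> \<Longrightarrow> x \<in> carrier M" and f: "finite (supp \<alpha>)"
        using a by (auto simp: ma_carrier)
      show "\<one>\<^bsub>?A\<^esub> \<otimes>\<^bsub>?A\<^esub> \<alpha> = \<alpha>"
      proof
        fix x
        have "pairing \<alpha> (\<lambda>z. if \<one>\<^bsub>M\<^esub> \<otimes>\<^bsub>M\<^esub> z = x then 1 else 0) = pairing \<alpha> (\<lambda>z. if z = x then 1 else 0)"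
          using s by (intro pairing_cong) simp
        then show "(\<one>\<^bsub>?A\<^esub> \<otimes>\<^bsub>?A\<^esub> \<alpha>) x = \<alpha> x"
          using f by (simp add: ma_one ma_mult pairing_eval)
      qed
      show "\<alpha> \<otimes>\<^bsub>?A\<^esub> \<one>\<^bsub>?A\<^esub> = \<alpha>"
      proof
        fix x
        have "pairing \<alpha> (\<lambda>z. if z \<otimes>\<^bsub>M\<^esub> \<one>\<^bsub>M\<^esub> = x then 1 else 0) = pairing \<alpha> (\<lambda>z. if z = x then 1 else 0)"
          using s by (intro pairing_cong) simp
        then show "(\<alpha> \<otimes>\<^bsub>?A\<^esub> \<one>\<^bsub>?A\<^esub>) x = \<alpha> x"
          using f by (simp add: ma_one ma_mult pairing_eval)
      qed
    qed (auto simp: cl ma_one basis_closed)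
    fix \<alpha> \<beta> \<gamma> assume a: "\<alpha> \<in> carrier ?A" "\<beta> \<in> carrier ?A" "\<gamma> \<in> carrier ?A"
    then have f: "finite (supp \<alpha>)" "finite (supp \<beta>)" "finite (supp \<gamma>)"
       "finite (supp (\<lambda>x. \<alpha> x + \<beta> x))"
      using ma_add_closed[of \<alpha> M \<beta>] by (auto simp: ma_carrier ma_add)
    show "(\<alpha> \<oplus>\<^bsub>?A\<^esub> \<beta>) \<otimes>\<^bsub>?A\<^esub> \<gamma> = \<alpha> \<otimes>\<^bsub>?A\<^esub> \<gamma> \<oplus>\<^bsub>?A\<^esub> \<beta> \<otimes>\<^bsub>?A\<^esub> \<gamma>"
      using f by (auto simp: ma_add ma_mult pairing_add)
    show "\<gamma> \<otimes>\<^bsub>?A\<^esub> (\<alpha> \<oplus>\<^bsub>?A\<^esub> \<beta>) = \<gamma> \<otimes>\<^bsub>?A\<^esub> \<alpha> \<oplus>\<^bsub>?A\<^esub> \<gamma> \<otimes>\<^bsub>?A\<^esub> \<beta>"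
      using f by (auto simp: ma_add ma_mult pairing_add pairing_add_right)
  qed
qed

lemma ma_smult_mult_left:
  assumes "finite (supp \<alpha>)" "finite (supp \<beta>)"
  shows "(c \<odot>\<^bsub>monoid_algebra M\<^esub> \<alpha>) \<otimes>\<^bsub>monoid_algebra M\<^esub> \<beta>
    = c \<odot>\<^bsub>monoid_algebra M\<^esub> (\<alpha> \<otimes>\<^bsub>monoid_algebra M\<^esub> \<beta>)"
proof -
  have "finite (supp (\<lambda>x. c * \<alpha> x))" using assms supp_smult[of c \<alpha>] finite_subset by blast
  then show ?thesis using assms by (auto simp: ma_smult ma_mult pairing_smult)
qed

text \<open>Induction on a finite set containing the support: deleting the coefficient at one point
  x leaves \<open>\<alpha>(x := 0)\<close> and a multiple of a basis element. It reduces linear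
  claims to basis elements.\<close>

lemma ma_span:
  assumes "\<alpha> \<in> carrier (monoid_algebra M)"
    and "P (\<lambda>x. 0 :: 'f::field)"
    and "\<And>\<alpha> \<beta>. \<alpha> \<in> carrier (monoid_algebra M) \<Longrightarrow> \<beta> \<in> carrier (monoid_algebra M)
      \<Longrightarrow> P \<alpha> \<Longrightarrow> P \<beta> \<Longrightarrow> P (\<alpha> \<oplus>\<^bsub>monoid_algebra M\<^esub> \<beta>)"
    and "\<And>c x. x \<in> carrier M \<Longrightarrow> P (c \<odot>\<^bsub>monoid_algebra M\<^esub> basis_elt x)"
  shows "P \<alpha>"
proof -
  have "\<forall>\<alpha> \<in> carrier (monoid_algebra M). supp \<alpha> \<subseteq> S \<longrightarrow> P \<alpha>" if "finite S" for S
    using that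
  proof (induction S rule: finite_induct)
    case empty
    have "\<alpha> = (\<lambda>x. 0)" if "supp \<alpha> \<subseteq> {}" for \<alpha> :: "'a \<Rightarrow> 'f" using that by (auto simp: supp_def)
    with assms(2) show ?case by metis
  next
    case (insert x S)
    show ?case
    proof (intro ballI impI)
      fix \<alpha> :: "'a \<Rightarrow> 'f" assume a: "\<alpha> \<in> carrier (monoid_algebra M)" "supp \<alpha> \<subseteq> insert x S"
      let ?\<beta> = "\<alpha>(x := 0)"
      have sb: "supp ?\<beta> \<subseteq> supp \<alpha> - {x}" by (auto simp: supp_def)
      then have b: "?\<beta> \<in> carrier (monoid_algebra M)"
        using a by (auto simp: ma_carrier intro: finite_subset)
      show "P \<alpha>"
      proof (cases "x \<in> carrier M")
        case True
        have "\<alpha> = ?\<beta> \<oplus>\<^bsub>monoid_algebra M\<^esub> \<alpha> x \<odot>\<^bsub>monoid_algebra M\<^esub> basis_elt x"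
          by (auto simp: ma_add ma_smult basis_elt_def)
        moreover have "P ?\<beta>" using insert.IH b sb a by blast
        moreover have "P (\<alpha> x \<odot>\<^bsub>monoid_algebra M\<^esub> basis_elt x)" using True assms(4) by blast
        ultimately show ?thesis
          using assms(3) b ma_smult_closed[OF basis_closed[OF True]] by metis
      next
        case False
        then have "supp \<alpha> \<subseteq> S" using a by (auto simp: ma_carrier)
        then show ?thesis using insert.IH a by blast
      qed
    qed
  qed
  from this[of "supp \<alpha>"] assms(1) show ?thesis by (auto simp: ma_carrier)
qed

text \<open>Unlike with \<open>lin_ext\<close>, basis elements may go to arbitrary vectors: words to
  products of sums of matrices, singular matrices to zero.\<close>

definition ma_ext :: "('a \<Rightarrow> 'c \<Rightarrow> 'f::field) \<Rightarrow> ('a \<Rightarrow> 'f) \<Rightarrow> 'c \<Rightarrow> 'f" where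
  "ma_ext \<phi> \<alpha> = (\<lambda>w. pairing \<alpha> (\<lambda>x. \<phi> x w))"

lemma ma_ext_basis [simp]: "ma_ext \<phi> (basis_elt x) = \<phi> x"
  by (simp add: ma_ext_def)

lemma ma_ext_closed:
  assumes "\<alpha> \<in> carrier (monoid_algebra M)"
    and "\<And>x. x \<in> carrier M \<Longrightarrow> \<phi> x \<in> carrier (monoid_algebra N)"
  shows "ma_ext \<phi> \<alpha> \<in> carrier (monoid_algebra N)"
proof -
  have "supp (ma_ext \<phi> \<alpha>) \<subseteq> (\<Union>x\<in>supp \<alpha>. supp (\<phi> x))"
    by (auto simp: supp_def ma_ext_def pairing_def elim!: sum.not_neutral_contains_not_neutral)
  moreover have "finite (\<Union>x\<in>supp \<alpha>. supp (\<phi> x))" "(\<Union>x\<in>supp \<alpha>. supp (\<phi> x)) \<subseteq> carrier N"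
    using assms by (fastforce simp: ma_carrier)+
  ultimately show ?thesis by (auto simp: ma_carrier intro: finite_subset)
qed

lemma ma_ext_add:
  assumes "finite (supp \<alpha>)" "finite (supp \<beta>)"
  shows "ma_ext \<phi> (\<alpha> \<oplus>\<^bsub>monoid_algebra M\<^esub> \<beta>)
    = ma_ext \<phi> \<alpha> \<oplus>\<^bsub>monoid_algebra N\<^esub> ma_ext \<phi> \<beta>"
  using assms by (simp add: ma_ext_def ma_add pairing_add)

lemma ma_ext_smult:
  assumes "finite (supp \<alpha>)"
  shows "ma_ext \<phi> (c \<odot>\<^bsub>monoid_algebra M\<^esub> \<alpha>) = c \<odot>\<^bsub>monoid_algebra N\<^esub> ma_ext \<phi> \<alpha>"
  using assms by (simp add: ma_ext_def ma_smult pairing_smult)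

lemma ma_ext_mult:
  assumes a: "\<alpha> \<in> carrier (monoid_algebra M)" "\<beta> \<in> carrier (monoid_algebra M)"
    and cl: "\<And>x. x \<in> carrier M \<Longrightarrow> \<phi> x \<in> carrier (monoid_algebra N)"
    and hom: "\<And>x y. x \<in> carrier M \<Longrightarrow> y \<in> carrier M \<Longrightarrow>
      \<phi> (x \<otimes>\<^bsub>M\<^esub> y) = \<phi> x \<otimes>\<^bsub>monoid_algebra N\<^esub> \<phi> y"
  shows "ma_ext \<phi> (\<alpha> \<otimes>\<^bsub>monoid_algebra M\<^esub> \<beta>)
    = ma_ext \<phi> \<alpha> \<otimes>\<^bsub>monoid_algebra N\<^esub> ma_ext \<phi> \<beta>"
proof
  fix w
  have f: "finite (supp \<alpha>)" "finite (supp \<beta>)"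
    and s: "\<And>x. x \<in> supp \<alpha> \<Longrightarrow> x \<in> carrier M" "\<And>x. x \<in> supp \<beta> \<Longrightarrow> x \<in> carrier M"
    using a by (auto simp: ma_carrier)
  have fp: "finite (supp (\<phi> x))" if "x \<in> carrier M" for x using cl[OF that] by (simp add: ma_carrier)
  have fe: "finite (supp (ma_ext \<phi> \<alpha>))" "finite (supp (ma_ext \<phi> \<beta>))"
    using ma_ext_closed[OF a(1) cl] ma_ext_closed[OF a(2) cl] by (auto simp: ma_carrier)
  \<comment> \<open>Cancellation can make \<open>supp (ma_ext \<phi> \<gamma>)\<close> smaller than
    the union of the supports of the images. Both sums are taken over \<open>?S\<close>, which
    contains all of these, so that they can be exchanged.\<close>
  have pe: "pairing (ma_ext \<phi> \<gamma>) F = pairing \<gamma> (\<lambda>x. pairing (\<phi> x) F)"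
    if g: "\<gamma> \<in> carrier (monoid_algebra M)" for \<gamma> F
  proof -
    let ?S = "supp (ma_ext \<phi> \<gamma>) \<union> (\<Union>x\<in>supp \<gamma>. supp (\<phi> x))"
    have fS: "finite ?S" using ma_ext_closed[OF g cl] g fp by (fastforce simp: ma_carrier)
    have "pairing (ma_ext \<phi> \<gamma>) F = (\<Sum>w\<in>?S. (\<Sum>x\<in>supp \<gamma>. \<gamma> x * \<phi> x w) * F w)"
      using pairing_superset[OF fS, of "ma_ext \<phi> \<gamma>" F] by (simp add: ma_ext_def pairing_def)
    also have "\<dots> = (\<Sum>x\<in>supp \<gamma>. \<gamma> x * (\<Sum>w\<in>?S. \<phi> x w * F w))"
      unfolding sum_distrib_left sum_distrib_right by (subst sum.swap) (simp add: mult.assoc)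
    also have "\<dots> = pairing \<gamma> (\<lambda>x. pairing (\<phi> x) F)"
      unfolding pairing_def[of \<gamma>]
      by (intro sum.cong refl arg_cong2[where f = "(*)"] sym[OF pairing_superset[OF fS]]) auto
    finally show ?thesis .
  qed
  have "ma_ext \<phi> (\<alpha> \<otimes>\<^bsub>monoid_algebra M\<^esub> \<beta>) w = pairing \<alpha> (\<lambda>y. pairing \<beta> (\<lambda>z. \<phi> (y \<otimes>\<^bsub>M\<^esub> z) w))"
    unfolding ma_ext_def by (rule pairing_mult[OF f])
  also have "\<dots> = pairing \<alpha> (\<lambda>y. pairing \<beta> (\<lambda>z. pairing (\<phi> y)
      (\<lambda>u. pairing (\<phi> z) (\<lambda>v. if u \<otimes>\<^bsub>N\<^esub> v = w then 1 else 0))))"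
    using s by (intro pairing_cong) (simp add: hom ma_mult fp)
  also have "\<dots> = pairing \<alpha> (\<lambda>y. pairing (\<phi> y) (\<lambda>u. pairing \<beta> (\<lambda>z.
      pairing (\<phi> z) (\<lambda>v. if u \<otimes>\<^bsub>N\<^esub> v = w then 1 else 0))))"
    by (intro pairing_cong pairing_swap)
  also have "\<dots> = (ma_ext \<phi> \<alpha> \<otimes>\<^bsub>monoid_algebra N\<^esub> ma_ext \<phi> \<beta>) w"
    by (simp add: ma_mult[OF fe] pe[OF a(1)] pe[OF a(2)])
  finally show "ma_ext \<phi> (\<alpha> \<otimes>\<^bsub>monoid_algebra M\<^esub> \<beta>) w
    = (ma_ext \<phi> \<alpha> \<otimes>\<^bsub>monoid_algebra N\<^esub> ma_ext \<phi> \<beta>) w" .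
qed

text \<open>The defining relations as axioms on elements of an arbitrary ring. Spanning by normal
  words follows from these axioms and is applied to the quotient of the free algebra; the monomial
  algebras are the instances that separate the normal words. The sum in \<open>S_X\<close> is the
  image of t_{k,k+1}.\<close>

locale wreath_rep = R: ring R + G: group G
  for R :: "('r, 's) ring_scheme" (structure) and G :: "('g, 'b) monoid_scheme" +
  fixes m :: nat and E :: "(nat \<Rightarrow> 'g) \<Rightarrow> 'r" and S X :: "nat \<Rightarrow> 'r"
  assumes finite_G: "finite (carrier G)"
    and E_closed: "g \<in> carrier (Gpow G m) \<Longrightarrow> E g \<in> carrier R"
    and S_closed: "i \<in> {1..<m} \<Longrightarrow> S i \<in> carrier R"
    and X_closed: "k \<in> {1..m} \<Longrightarrow> X k \<in> carrier R"
    and E_mult: "g \<in> carrier (Gpow G m) \<Longrightarrow> h \<in> carrier (Gpow G m) \<Longrightarrow>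
      E g \<otimes> E h = E (g \<otimes>\<^bsub>Gpow G m\<^esub> h)"
    and E_one: "E \<one>\<^bsub>Gpow G m\<^esub> = \<one>"
    and S_square: "i \<in> {1..<m} \<Longrightarrow> S i \<otimes> S i = \<one>"
    and S_far: "i \<in> {1..<m} \<Longrightarrow> j \<in> {1..<m} \<Longrightarrow> \<bar>int i - int j\<bar> > 1 \<Longrightarrow> S i \<otimes> S j = S j \<otimes> S i"
    and S_braid: "i \<in> {1..<m} \<Longrightarrow> i + 1 \<in> {1..<m} \<Longrightarrow>
      S i \<otimes> S (i+1) \<otimes> S i = S (i+1) \<otimes> S i \<otimes> S (i+1)"
    and S_E: "i \<in> {1..<m} \<Longrightarrow> g \<in> carrier (Gpow G m) \<Longrightarrow>
      S i \<otimes> E g = E (perm_act m (transpose i (i+1)) g) \<otimes> S i"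
    and E_X: "g \<in> carrier (Gpow G m) \<Longrightarrow> k \<in> {1..m} \<Longrightarrow> E g \<otimes> X k = X k \<otimes> E g"
    and S_X: "k \<in> {1..<m} \<Longrightarrow> S k \<otimes> X k = X (k+1) \<otimes> S k \<oplus>
      (\<Oplus>h\<in>carrier G. E (at_pos G m k h) \<otimes> E (at_pos G m (k+1) (inv\<^bsub>G\<^esub> h)))"
    and S_X_far: "k \<in> {1..<m} \<Longrightarrow> l \<in> {1..m} \<Longrightarrow> l \<noteq> k \<Longrightarrow> l \<noteq> k + 1 \<Longrightarrow> S k \<otimes> X l = X l \<otimes> S k"
    and X_X: "k \<in> {1..m} \<Longrightarrow> l \<in> {1..m} \<Longrightarrow> X k \<otimes> X l = X l \<otimes> X k"

lemma Gpow_carrier: "carrier (Gpow G n) = (\<Pi>\<^sub>E i\<in>{1..n}. carrier G)"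
  by (simp add: Gpow_def)

lemma Gpow_mult: "g \<otimes>\<^bsub>Gpow G n\<^esub> h = (\<lambda>i\<in>{1..n}. g i \<otimes>\<^bsub>G\<^esub> h i)"
  by (simp add: Gpow_def)

lemma Gpow_one: "\<one>\<^bsub>Gpow G n\<^esub> = (\<lambda>i\<in>{1..n}. \<one>\<^bsub>G\<^esub>)"
  by (simp add: Gpow_def)

lemma at_pos_closed: "group G \<Longrightarrow> h \<in> carrier G \<Longrightarrow> at_pos G n i h \<in> carrier (Gpow G n)"
  by (auto simp: Gpow_carrier at_pos_def group.is_monoid monoid.one_closed)

lemma perm_act_closed:
  assumes "i \<in> {1..<n}" "g \<in> carrier (Gpow G n)"
  shows "perm_act n (transpose i (i+1)) g \<in> carrier (Gpow G n)"
proof -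
  have "transpose i (i+1) j \<in> {1..n}" if "j \<in> {1..n}" for j
    using that assms(1) by (auto simp: transpose_def)
  then show ?thesis using assms(2) by (fastforce simp: Gpow_carrier perm_act_def)
qed

section \<open>Monomial maps\<close>

text \<open>A monomial matrix is encoded by the map sending a column to the row and the value of its
  nonzero entry; matrices of all sizes thereby lie in one monoid.\<close>

definition monomial :: "('g, 'b) monoid_scheme \<Rightarrow> (nat \<Rightarrow> nat \<times> 'g) monoid" where
  "monomial G = \<lparr>carrier = {f. \<forall>j. snd (f j) \<in> carrier G},
     mult = (\<lambda>f f' j. (fst (f (fst (f' j))), snd (f (fst (f' j))) \<otimes>\<^bsub>G\<^esub> snd (f' j))),
     one = (\<lambda>j. (j, \<one>\<^bsub>G\<^esub>))\<rparr>"

definition mon_diag :: "('g, 'b) monoid_scheme \<Rightarrow> nat \<Rightarrow> (nat \<Rightarrow> 'g) \<Rightarrow> nat \<Rightarrow> nat \<times> 'g" where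
  "mon_diag G n g = (\<lambda>j. (j, if j \<in> {1..n} then g j else \<one>\<^bsub>G\<^esub>))"

definition mon_perm :: "('g, 'b) monoid_scheme \<Rightarrow> (nat \<Rightarrow> nat) \<Rightarrow> nat \<Rightarrow> nat \<times> 'g" where
  "mon_perm G \<sigma> = (\<lambda>j. (\<sigma> j, \<one>\<^bsub>G\<^esub>))"

text \<open>The monomial matrix of \<open>h\<^sup>(\<^sup>k\<^sup>) (h\<inverse>)\<^sup>(\<^sup>i\<^sup>) (k i)\<close>.\<close>

definition mon_swap :: "('g, 'b) monoid_scheme \<Rightarrow> nat \<Rightarrow> nat \<Rightarrow> 'g \<Rightarrow> nat \<Rightarrow> nat \<times> 'g" where
  "mon_swap G k i h = (\<lambda>j. if j = i then (k, h) else if j = k then (i, inv\<^bsub>G\<^esub> h) else (j, \<one>\<^bsub>G\<^esub>))"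

abbreviation mon_alg :: "('g, 'b) monoid_scheme \<Rightarrow> ('f::field, (nat \<Rightarrow> nat \<times> 'g) \<Rightarrow> 'f) module" where
  "mon_alg G \<equiv> monoid_algebra (monomial G)"

text \<open>Over all h the matrices \<open>mon_swap G k i h\<close> add up to t_{ki} (k i). The sum
  is pointwise and not taken in the ring, so that coefficients can be read without closure
  conditions.\<close>

definition jm :: "('g, 'b) monoid_scheme \<Rightarrow> nat \<Rightarrow> nat \<Rightarrow> (nat \<Rightarrow> nat \<times> 'g) \<Rightarrow> 'f::field" where
  "jm G n k = (\<lambda>\<gamma>. \<Sum>i\<in>{k+1..n}. \<Sum>h\<in>carrier G. basis_elt (mon_swap G k i h) \<gamma>)"

locale finite_group = group G for G :: "('g, 'b) monoid_scheme" (structure) +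
  assumes finite_G: "finite (carrier G)"
begin

lemma monomial_carrier: "f \<in> carrier (monomial G) \<longleftrightarrow> (\<forall>j. snd (f j) \<in> carrier G)"
  by (simp add: monomial_def)

lemma monomial_mult:
  "f \<otimes>\<^bsub>monomial G\<^esub> f' = (\<lambda>j. (fst (f (fst (f' j))), snd (f (fst (f' j))) \<otimes> snd (f' j)))"
  by (simp add: monomial_def)

lemma monomial_one: "\<one>\<^bsub>monomial G\<^esub> = (\<lambda>j. (j, \<one>))"
  by (simp add: monomial_def)

lemma monomial_monoid: "monoid (monomial G)"
  by (rule monoidI) (auto simp: monomial_carrier monomial_mult monomial_one m_assoc)

sublocale M: monoid "monomial G" by (rule monomial_monoid)

abbreviation mon_mult (infixl "\<cdot>" 70) where
  "f \<cdot> f' \<equiv> f \<otimes>\<^bsub>monomial G\<^esub> f'"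

abbreviation mon_alg_mult (infixl "\<star>" 70) where
  "\<alpha> \<star> \<beta> \<equiv> \<alpha> \<otimes>\<^bsub>mon_alg G\<^esub> \<beta>"

lemma mon_alg_ring: "ring (mon_alg G)" by (rule ma_ring[OF monomial_monoid])

lemma mon_diag_closed: "g \<in> carrier (Gpow G n) \<Longrightarrow> mon_diag G n g \<in> carrier (monomial G)"
  by (auto simp: monomial_carrier mon_diag_def Gpow_carrier)

lemma mon_perm_closed: "mon_perm G \<sigma> \<in> carrier (monomial G)"
  by (auto simp: monomial_carrier mon_perm_def)

lemma mon_swap_closed: "h \<in> carrier G \<Longrightarrow> mon_swap G k i h \<in> carrier (monomial G)"
  by (auto simp: monomial_carrier mon_swap_def)

lemma mon_swap_involution:
  "h \<in> carrier G \<Longrightarrow> mon_swap G k i h \<cdot> mon_swap G k i h = \<one>\<^bsub>monomial G\<^esub>" if "k \<noteq> i"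
  using that by (auto simp: monomial_mult monomial_one mon_swap_def)

text \<open>Each swap is its own inverse, as its values h and \<open>inv h\<close> cancel. An
  equation with a swap on the left can thereby be solved for the other factor, which is how
  coefficients of products with \<open>jm\<close> are found.\<close>

lemma mon_swap_cancel:
  assumes "k \<noteq> i" "h \<in> carrier G" "f \<in> carrier (monomial G)"
  shows "mon_swap G k i h \<cdot> (mon_swap G k i h \<cdot> f) = f"
  using assms M.m_assoc[symmetric] mon_swap_closed by (simp add: mon_swap_involution)

text \<open>Conjugation by f moves the swapped indices to their images and twists h by the values of
  f there. The carrier also contains maps sending two columns to one row; injectivity keeps the
  remaining columns away from the two images.\<close>

lemma mon_swap_conj:
  assumes f: "f \<in> carrier (monomial G)" "inj (\<lambda>j. fst (f j))" and "k \<noteq> i" and h: "h \<in> carrier G"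
  shows "f \<cdot> mon_swap G k i h
    = mon_swap G (fst (f k)) (fst (f i)) (snd (f k) \<otimes> h \<otimes> inv (snd (f i))) \<cdot> f"
proof
  fix j
  have c: "snd (f j) \<in> carrier G" for j using f by (simp add: monomial_carrier)
  have i: "fst (f a) = fst (f b) \<longleftrightarrow> a = b" for a b using f(2) by (auto dest: injD)
  show "(f \<cdot> mon_swap G k i h) j
    = (mon_swap G (fst (f k)) (fst (f i)) (snd (f k) \<otimes> h \<otimes> inv (snd (f i))) \<cdot> f) j"
    using assms(3) h c by (auto simp: monomial_mult mon_swap_def i m_assoc inv_mult_group)
qed

lemma bij_betw_two_sided:
  assumes "a \<in> carrier G" "b \<in> carrier G"
  shows "bij_betw (\<lambda>h. a \<otimes> h \<otimes> inv b) (carrier G) (carrier G)"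
proof (rule bij_betwI[where g = "\<lambda>h. inv a \<otimes> h \<otimes> b"])
  show "inv a \<otimes> (a \<otimes> x \<otimes> inv b) \<otimes> b = x" if "x \<in> carrier G" for x
    using that assms by (simp add: m_assoc) (simp add: m_assoc[symmetric])
  show "a \<otimes> (inv a \<otimes> x \<otimes> b) \<otimes> inv b = x" if "x \<in> carrier G" for x
    using that assms by (simp add: m_assoc) (simp add: m_assoc[symmetric])
qed (use assms in auto)

text \<open>The twist of h under conjugation is a permutation of G and disappears in the sum over h.
  This is what the summation over G in t_{kl} achieves.\<close>

lemma sum_mon_swap_conj:
  fixes F :: "_ \<Rightarrow> 'f::field"
  assumes f: "f \<in> carrier (monomial G)" "inj (\<lambda>j. fst (f j))" and "k \<noteq> i"
  shows "(\<Sum>h\<in>carrier G. F (f \<cdot> mon_swap G k i h))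
    = (\<Sum>h\<in>carrier G. F (mon_swap G (fst (f k)) (fst (f i)) h \<cdot> f))"
proof -
  have c: "snd (f j) \<in> carrier G" for j using f by (simp add: monomial_carrier)
  have "(\<Sum>h\<in>carrier G. F (f \<cdot> mon_swap G k i h)) = (\<Sum>h\<in>carrier G.
    F (mon_swap G (fst (f k)) (fst (f i)) (snd (f k) \<otimes> h \<otimes> inv (snd (f i))) \<cdot> f))"
    using assms by (intro sum.cong) (auto simp: mon_swap_conj)
  also have "\<dots> = (\<Sum>h\<in>carrier G. F (mon_swap G (fst (f k)) (fst (f i)) h \<cdot> f))"
    by (rule sum.reindex_bij_betw[OF bij_betw_two_sided[OF c c]])
  finally show ?thesis .
qed

section \<open>Jucys-Murphy elements and their commutation relations\<close>

lemma supp_jm: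
  "supp (jm G n k :: _ \<Rightarrow> 'f::field) \<subseteq> (\<lambda>(i, h). mon_swap G k i h) ` ({k+1..n} \<times> carrier G)"
proof
  fix \<gamma> assume "\<gamma> \<in> supp (jm G n k :: _ \<Rightarrow> 'f)"
  then have "(\<Sum>i\<in>{k+1..n}. \<Sum>h\<in>carrier G. basis_elt (mon_swap G k i h) \<gamma>) \<noteq> (0::'f)"
    by (simp add: supp_def jm_def)
  then obtain i where i: "i \<in> {k+1..n}" "(\<Sum>h\<in>carrier G. basis_elt (mon_swap G k i h) \<gamma>) \<noteq> (0::'f)"
    by (rule sum.not_neutral_contains_not_neutral)
  from i(2) obtain h where "h \<in> carrier G" "basis_elt (mon_swap G k i h) \<gamma> \<noteq> (0::'f)"
    by (rule sum.not_neutral_contains_not_neutral)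
  with i(1) show "\<gamma> \<in> (\<lambda>(i, h). mon_swap G k i h) ` ({k+1..n} \<times> carrier G)"
    by (intro image_eqI[of _ _ "(i, h)"]) (auto simp: basis_apply split: if_splits)
qed

lemma jm_closed: "(jm G n k :: _ \<Rightarrow> 'f::field) \<in> carrier (mon_alg G)"
proof -
  let ?S = "(\<lambda>(i, h). mon_swap G k i h) ` ({k+1..n} \<times> carrier G)"
  have "finite ?S" using finite_G by auto
  moreover have "?S \<subseteq> carrier (monomial G)"
    by (rule image_subsetI) (auto simp: mon_swap_closed)
  ultimately show ?thesis
    unfolding ma_carrier by (intro conjI finite_subset[OF supp_jm] subset_trans[OF supp_jm])
qed

lemma pairing_jm: "pairing (jm G n k) F = (\<Sum>i\<in>{k+1..n}. \<Sum>h\<in>carrier G. F (mon_swap G k i h))"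
proof -
  let ?S = "(\<lambda>(i, h). mon_swap G k i h) ` ({k+1..n} \<times> carrier G)"
  have fin: "finite ?S" using finite_G by auto
  have "pairing (jm G n k) F = (\<Sum>x\<in>?S. jm G n k x * F x)"
    by (rule pairing_superset[OF fin supp_jm])
  also have "\<dots> = (\<Sum>i\<in>{k+1..n}. \<Sum>h\<in>carrier G. \<Sum>x\<in>?S. if x = mon_swap G k i h then F x else 0)"
    unfolding jm_def sum_distrib_right
    by (subst sum.swap, rule sum.cong[OF refl], subst sum.swap) (auto simp: basis_apply intro!: sum.cong)
  also have "\<dots> = (\<Sum>i\<in>{k+1..n}. \<Sum>h\<in>carrier G. F (mon_swap G k i h))"
    using fin by (intro sum.cong refl) auto
  finally show ?thesis .
qed

lemma finite_supp_jm [simp]: "finite (supp (jm G n k :: _ \<Rightarrow> 'f::field))"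
  using jm_closed[of n k] by (auto simp: ma_carrier)

lemma basis_mult_jm:
  "(basis_elt f \<star> jm G n k) \<gamma>
    = (\<Sum>i\<in>{k+1..n}. \<Sum>h\<in>carrier G. if f \<cdot> mon_swap G k i h = \<gamma> then 1 else (0::'f::field))"
  by (simp add: ma_mult pairing_jm)

lemma jm_mult_basis:
  "(jm G n k \<star> basis_elt f) \<gamma>
    = (\<Sum>i\<in>{k+1..n}. \<Sum>h\<in>carrier G. if mon_swap G k i h \<cdot> f = \<gamma> then 1 else (0::'f::field))"
  by (simp add: ma_mult pairing_jm)

text \<open>Conjugation by f permutes the summands of \<open>jm G n k\<close>, since f fixes k and
  permutes the indices from k + 1 to n. Three relations are obtained this way: with diagonal
  matrices, with distant transpositions, and among the \<open>jm\<close> themselves.\<close>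

lemma basis_jm_commute:
  assumes f: "f \<in> carrier (monomial G)" "inj (\<lambda>j. fst (f j))" "fst (f k) = k"
    and p: "\<And>i. i \<in> {k+1..n} \<Longrightarrow> fst (f i) \<in> {k+1..n}"
  shows "basis_elt f \<star> jm G n k = jm G n k \<star> (basis_elt f :: _ \<Rightarrow> 'f::field)"
proof
  fix \<gamma> :: "nat \<Rightarrow> nat \<times> 'g"
  let ?F = "\<lambda>x. if x = \<gamma> then 1 else (0::'f)"
  have "inj_on (\<lambda>j. fst (f j)) {k+1..n}" using f(2) by (rule inj_on_subset) auto
  then have bij: "bij_betw (\<lambda>j. fst (f j)) {k+1..n} {k+1..n}"
    unfolding bij_betw_def using p by (intro conjI endo_inj_surj image_subsetI finite_atLeastAtMost)
  have "(basis_elt f \<star> jm G n k) \<gamma>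
    = (\<Sum>i\<in>{k+1..n}. \<Sum>h\<in>carrier G. ?F (mon_swap G k (fst (f i)) h \<cdot> f))"
    unfolding basis_mult_jm
    by (rule sum.cong[OF refl], subst sum_mon_swap_conj[OF f(1,2), where F = ?F]) (auto simp: f(3))
  also have "\<dots> = (\<Sum>i\<in>{k+1..n}. \<Sum>h\<in>carrier G. ?F (mon_swap G k i h \<cdot> f))"
    by (rule sum.reindex_bij_betw[OF bij])
  also have "\<dots> = (jm G n k \<star> basis_elt f) \<gamma>"
    by (simp add: jm_mult_basis)
  finally show "(basis_elt f \<star> jm G n k) \<gamma>
    = (jm G n k \<star> (basis_elt f :: _ \<Rightarrow> 'f)) \<gamma>" .
qed

text \<open>Every summand of \<open>jm G n l\<close> swaps two indices above k and therefore
  commutes with \<open>jm G n k\<close> as a whole.\<close>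

lemma jm_commute_less:
  assumes "k < l"
  shows "jm G n k \<star> jm G n l = jm G n l \<star> (jm G n k :: _ \<Rightarrow> 'f::field)"
proof
  fix \<gamma>
  have c: "basis_elt (mon_swap G l i h) \<star> jm G n k
    = jm G n k \<star> (basis_elt (mon_swap G l i h) :: _ \<Rightarrow> 'f)"
    if "i \<in> {l+1..n}" "h \<in> carrier G" for i h
  proof (rule basis_jm_commute)
    show "inj (\<lambda>j. fst (mon_swap G l i h j))" by (auto simp: inj_def mon_swap_def)
  qed (use that assms in \<open>auto simp: mon_swap_def monomial_carrier\<close>)
  have "(jm G n k \<star> jm G n l) \<gamma> = pairing (jm G n l)
     (\<lambda>z. pairing (jm G n k) (\<lambda>y. if y \<cdot> z = \<gamma> then 1 else (0::'f)))"
    by (simp add: ma_mult) (rule pairing_swap)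
  also have "\<dots> = pairing (jm G n l) (\<lambda>z. (jm G n k \<star> basis_elt z) \<gamma>)"
    by (simp add: ma_mult)
  also have "\<dots> = (\<Sum>i\<in>{l+1..n}. \<Sum>h\<in>carrier G.
      (jm G n k \<star> basis_elt (mon_swap G l i h)) \<gamma>)"
    by (rule pairing_jm)
  also have "\<dots> = (\<Sum>i\<in>{l+1..n}. \<Sum>h\<in>carrier G.
      (basis_elt (mon_swap G l i h) \<star> jm G n k) \<gamma>)"
    by (simp only: c cong: sum.cong)
  also have "\<dots> = pairing (jm G n l) (\<lambda>z. (basis_elt z \<star> jm G n k) \<gamma>)"
    by (simp add: pairing_jm)
  also have "\<dots> = (jm G n l \<star> jm G n k) \<gamma>"
    by (simp add: ma_mult)
  finally show "(jm G n k \<star> jm G n l) \<gamma>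
    = (jm G n l \<star> (jm G n k :: _ \<Rightarrow> 'f)) \<gamma>" .
qed

lemma jm_commute: "jm G n k \<star> jm G n l = jm G n l \<star> (jm G n k :: _ \<Rightarrow> 'f::field)"
  by (cases k l rule: linorder_cases) (auto intro: jm_commute_less jm_commute_less[symmetric])

text \<open>Conjugation by (k k+1) turns the swap of k with i into a swap of k + 1 with the image of
  i. For i > k + 1 these make up \<open>jm G n (k+1)\<close>; for i = k + 1 the result swaps k + 1
  with k, and its product with (k k+1) is diagonal and contributes to t_{k,k+1}.\<close>

lemma perm_jm:
  assumes k: "k \<in> {1..<m}" and "m \<le> n"
  defines "s \<equiv> basis_elt (mon_perm G (transpose k (k+1))) :: _ \<Rightarrow> 'f::field"
  shows "s \<star> jm G n k = jm G n (k+1) \<star> s \<oplus>\<^bsub>mon_alg G\<^esub>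
    (\<lambda>\<gamma>. \<Sum>h\<in>carrier G. basis_elt (mon_diag G m (at_pos G m k h) \<cdot>
        mon_diag G m (at_pos G m (k+1) (inv h))) \<gamma>)"
proof
  fix \<gamma> :: "nat \<Rightarrow> nat \<times> 'g"
  let ?p = "mon_perm G (transpose k (k+1))"
  let ?F = "\<lambda>x. if x = \<gamma> then 1 else (0::'f)"
  have p: "?p \<in> carrier (monomial G)" "inj (\<lambda>j. fst (?p j))"
    by (auto simp: mon_perm_closed) (auto simp: mon_perm_def inj_def transpose_def split: if_splits)
  have d: "mon_swap G (k+1) k h \<cdot> ?p =
      mon_diag G m (at_pos G m (k+1) h) \<cdot> mon_diag G m (at_pos G m k (inv h))"
    if "h \<in> carrier G" for h
    using k that by (auto simp: monomial_mult mon_swap_def mon_diag_def at_pos_def mon_perm_def transpose_def)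
  have d': "mon_swap G (k+1) k h \<cdot> ?p =
      mon_diag G m (at_pos G m k (inv h)) \<cdot> mon_diag G m (at_pos G m (k+1) h)"
    if "h \<in> carrier G" for h
    unfolding d[OF that] using k that
    by (auto simp: monomial_mult mon_diag_def at_pos_def)
  have "(s \<star> jm G n k) \<gamma> = (\<Sum>i\<in>{k+1..n}. \<Sum>h\<in>carrier G.
      ?F (mon_swap G (k+1) (fst (?p i)) h \<cdot> ?p))"
    unfolding basis_mult_jm s_def
    by (rule sum.cong[OF refl], subst sum_mon_swap_conj[OF p, where F = ?F]) (auto simp: mon_perm_def)
  \<comment> \<open>The index k + 1 does occur, because k + 1 \<le> m \<le> n.\<close>
  also have "{k+1..n} = insert (k+1) {k+1+1..n}" using assms by auto
  also have "(\<Sum>i\<in>\<dots>. \<Sum>h\<in>carrier G. ?F (mon_swap G (k+1) (fst (?p i)) h \<cdot> ?p))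
     = (\<Sum>h\<in>carrier G. ?F (mon_swap G (k+1) (fst (?p (k+1))) h \<cdot> ?p))
     + (\<Sum>i\<in>{k+1+1..n}. \<Sum>h\<in>carrier G. ?F (mon_swap G (k+1) (fst (?p i)) h \<cdot> ?p))"
    by (rule sum.insert) auto
  also have "(\<Sum>i\<in>{k+1+1..n}. \<Sum>h\<in>carrier G. ?F (mon_swap G (k+1) (fst (?p i)) h \<cdot> ?p))
     = (\<Sum>i\<in>{k+1+1..n}. \<Sum>h\<in>carrier G. ?F (mon_swap G (k+1) i h \<cdot> ?p))"
    by (intro sum.cong refl) (auto simp: mon_perm_def)
  also have "\<dots> = (jm G n (k+1) \<star> s) \<gamma>"
    unfolding s_def jm_mult_basis ..
  also have "(\<Sum>h\<in>carrier G. ?F (mon_swap G (k+1) (fst (?p (k+1))) h \<cdot> ?p))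
     = (\<Sum>h\<in>carrier G. ?F (mon_diag G m (at_pos G m k (inv h)) \<cdot> mon_diag G m (at_pos G m (k+1) h)))"
    by (intro sum.cong refl, subst d'[symmetric]) (auto simp: mon_perm_def)
  \<comment> \<open>The conjugated swap has put h at k + 1 and its inverse at k; replacing h by its
    inverse gives the positions prescribed in t_{k,k+1}.\<close>
  also have "\<dots> = (\<Sum>h\<in>carrier G. ?F (mon_diag G m (at_pos G m k h) \<cdot> mon_diag G m (at_pos G m (k+1) (inv h))))"
    by (rule sum.reindex_bij_witness[where i = "\<lambda>h. inv h" and j = "\<lambda>h. inv h"]) auto
  also have "\<dots> = (\<Sum>h\<in>carrier G. basis_elt (mon_diag G m (at_pos G m k h) \<cdot>
        mon_diag G m (at_pos G m (k+1) (inv h))) \<gamma>)"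
    by (intro sum.cong refl) (auto simp: basis_apply)
  finally show "(s \<star> jm G n k) \<gamma> = (jm G n (k+1) \<star> s \<oplus>\<^bsub>mon_alg G\<^esub>
    (\<lambda>\<gamma>. \<Sum>h\<in>carrier G. basis_elt (mon_diag G m (at_pos G m k h) \<cdot>
        mon_diag G m (at_pos G m (k+1) (inv h))) \<gamma>)) \<gamma>"
    by (simp add: ma_add add.commute)
qed

lemma mon_diag_mult:
  "mon_diag G m g \<cdot> mon_diag G m h = mon_diag G m (g \<otimes>\<^bsub>Gpow G m\<^esub> h)"
  by (auto simp: monomial_mult mon_diag_def Gpow_mult)

lemma mon_perm_mult: "mon_perm G \<sigma> \<cdot> mon_perm G \<tau> = mon_perm G (\<sigma> \<circ> \<tau>)"
  by (auto simp: monomial_mult mon_perm_def)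

lemma mon_perm_id: "mon_perm G id = \<one>\<^bsub>monomial G\<^esub>"
  by (auto simp: monomial_one mon_perm_def)

lemma inv_transpose: "inv_into UNIV (transpose a b) = transpose a b"
  by (intro Hilbert_Choice.inv_equality transpose_involutory)

lemma mon_perm_diag:
  assumes "i \<in> {1..<m}" "g \<in> carrier (Gpow G m)"
  shows "mon_perm G (transpose i (i+1)) \<cdot> mon_diag G m g
    = mon_diag G m (perm_act m (transpose i (i+1)) g) \<cdot> mon_perm G (transpose i (i+1))"
  using assms unfolding perm_act_def inv_transpose
  by (auto simp: monomial_mult mon_perm_def mon_diag_def Gpow_carrier transpose_def PiE_iff)

lemma mon_alg_wreath_rep:
  assumes "m \<le> n"
  shows "wreath_rep (mon_alg G :: ('f::field, _) module) G m (\<lambda>g. basis_elt (mon_diag G m g))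
    (\<lambda>i. basis_elt (mon_perm G (transpose i (i+1)))) (jm G n)"
proof -
  interpret B: ring "mon_alg G :: ('f, _) module" by (rule mon_alg_ring)
  have inj_perm: "inj (\<lambda>j. fst (mon_perm G (transpose i (i+1)) j))" for i
    by (auto simp: mon_perm_def inj_def transpose_def split: if_splits)
  show ?thesis
  proof (unfold_locales)
    fix i j :: nat assume ij: "i \<in> {1..<m}" "j \<in> {1..<m}" "1 < \<bar>int i - int j\<bar>"
    have "transpose i (i+1) \<circ> transpose j (j+1) = transpose j (j+1) \<circ> transpose i (i+1)"
      using ij by (auto simp: transpose_def fun_eq_iff)
    then show "basis_elt (mon_perm G (transpose i (i+1))) \<star> basis_elt (mon_perm G (transpose j (j+1)))
      = basis_elt (mon_perm G (transpose j (j+1))) \<star> (basis_elt (mon_perm G (transpose i (i+1))) :: _ \<Rightarrow> 'f)"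
      by (simp add: ma_mult_basis mon_perm_mult)
  next
    fix i :: nat assume ij: "i \<in> {1..<m}" "i+1 \<in> {1..<m}"
    have "transpose i (i+1) \<circ> transpose (i+1) (i+1+1) \<circ> transpose i (i+1)
      = transpose (i+1) (i+1+1) \<circ> transpose i (i+1) \<circ> transpose (i+1) (i+1+1)"
      by (auto simp: transpose_def fun_eq_iff)
    then show "basis_elt (mon_perm G (transpose i (i+1))) \<star> basis_elt (mon_perm G (transpose (i+1) (i+1+1)))
       \<star> basis_elt (mon_perm G (transpose i (i+1)))
      = basis_elt (mon_perm G (transpose (i+1) (i+1+1))) \<star> basis_elt (mon_perm G (transpose i (i+1)))
       \<star> (basis_elt (mon_perm G (transpose (i+1) (i+1+1))) :: _ \<Rightarrow> 'f)"
      by (simp add: ma_mult_basis mon_perm_mult)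
  next
    fix g and k :: nat assume gk: "g \<in> carrier (Gpow G m)" "k \<in> {1..m}"
    show "basis_elt (mon_diag G m g) \<star> jm G n k
      = jm G n k \<star> (basis_elt (mon_diag G m g) :: _ \<Rightarrow> 'f)"
      by (rule basis_jm_commute) (auto simp: mon_diag_closed[OF gk(1)], auto simp: mon_diag_def inj_def)
  next
    fix k :: nat assume k: "k \<in> {1..<m}"
    have "(\<Oplus>\<^bsub>mon_alg G\<^esub>h\<in>carrier G. basis_elt (mon_diag G m (at_pos G m k h)) \<star>
        basis_elt (mon_diag G m (at_pos G m (k+1) (inv h)))) =
        ((\<lambda>\<gamma>. \<Sum>h\<in>carrier G. basis_elt (mon_diag G m (at_pos G m k h) \<cdot>
        mon_diag G m (at_pos G m (k+1) (inv h))) \<gamma>) :: _ \<Rightarrow> 'f)"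
      unfolding ma_mult_basis
      using at_pos_closed[OF group_axioms] mon_diag_closed
      by (intro ma_finsum finite_G basis_closed M.m_closed) auto
    then show "basis_elt (mon_perm G (transpose k (k+1))) \<star> jm G n k =
      jm G n (k+1) \<star> basis_elt (mon_perm G (transpose k (k+1))) \<oplus>\<^bsub>mon_alg G\<^esub>
       (\<Oplus>\<^bsub>mon_alg G\<^esub>h\<in>carrier G. basis_elt (mon_diag G m (at_pos G m k h)) \<star>
        (basis_elt (mon_diag G m (at_pos G m (k+1) (inv h))) :: _ \<Rightarrow> 'f))"
      using perm_jm[OF k assms] by simp
  next
    fix k l :: nat assume kl: "k \<in> {1..<m}" "l \<in> {1..m}" "l \<noteq> k" "l \<noteq> k + 1"
    show "basis_elt (mon_perm G (transpose k (k+1))) \<star> jm G n l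
      = jm G n l \<star> (basis_elt (mon_perm G (transpose k (k+1))) :: _ \<Rightarrow> 'f)"
    proof (rule basis_jm_commute)
      show "fst (mon_perm G (transpose k (k+1)) i) \<in> {l+1..n}" if "i \<in> {l+1..n}" for i
        using that kl assms by (auto simp: mon_perm_def transpose_def)
    qed (use kl in \<open>auto simp: mon_perm_closed inj_perm[simplified]\<close>, auto simp: mon_perm_def)
  next
    fix i g assume "i \<in> {1..<m}" "g \<in> carrier (Gpow G m)"
    then show "basis_elt (mon_perm G (transpose i (i+1))) \<star> basis_elt (mon_diag G m g)
      = basis_elt (mon_diag G m (perm_act m (transpose i (i+1)) g)) \<star>
        (basis_elt (mon_perm G (transpose i (i+1))) :: _ \<Rightarrow> 'f)"
      unfolding ma_mult_basis by (subst mon_perm_diag) auto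
  next
    have "mon_diag G m \<one>\<^bsub>Gpow G m\<^esub> = \<one>\<^bsub>monomial G\<^esub>"
      by (auto simp: mon_diag_def Gpow_one monomial_one)
    then show "basis_elt (mon_diag G m \<one>\<^bsub>Gpow G m\<^esub>) = (\<one>\<^bsub>mon_alg G\<^esub> :: _ \<Rightarrow> 'f)"
      by (simp add: ma_one)
  next
    fix k l
    show "jm G n k \<star> jm G n l = jm G n l \<star> (jm G n k :: _ \<Rightarrow> 'f)"
      by (rule jm_commute)
  qed (simp_all add: finite_G jm_closed ma_mult_basis mon_diag_mult ma_one mon_perm_mult
        mon_perm_id[unfolded id_def] transpose_comp_involutory id_def basis_closed mon_diag_closed mon_perm_closed)
qed

end

section \<open>The Coxeter presentation of the symmetric group\<close>

definition adj_perm :: "nat list \<Rightarrow> nat \<Rightarrow> nat" where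
  "adj_perm js = foldr (\<lambda>i \<sigma>. transpose i (i+1) \<circ> \<sigma>) js id"

lemma adj_perm_Nil [simp]: "adj_perm [] = id"
  by (simp add: adj_perm_def)

lemma adj_perm_Cons: "adj_perm (i # js) = transpose i (i+1) \<circ> adj_perm js"
  by (simp add: adj_perm_def)

lemma adj_perm_append: "adj_perm (is @ js) = adj_perm is \<circ> adj_perm js"
  by (induction "is") (auto simp: adj_perm_Cons comp_assoc)

lemma bij_adj_perm: "bij (adj_perm js)"
proof (induction js)
  case (Cons i js)
  then show ?case unfolding adj_perm_Cons by (rule bij_comp) (rule bij_transpose)
qed (simp only: adj_perm_Nil bij_id)

lemma adj_perm_fixes: "js \<in> lists {1..<r} \<Longrightarrow> x \<notin> {1..r} \<Longrightarrow> adj_perm js x = x"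
  by (induction js) (auto simp: adj_perm_Cons transpose_def)

text \<open>The words s_r ... s_j with j from 1 to r + 1 represent the cosets of S_r in S_(r+1), and
  the coset of a permutation is recognised by the preimage of r + 1. The case j = r + 1 is the empty
  word.\<close>

lemma adj_perm_descending:
  "j \<le> Suc r \<Longrightarrow> adj_perm (rev [j..<Suc r]) j = Suc r"
proof (induction r)
  case 0
  then show ?case by (cases j) (auto simp: adj_perm_Cons)
next
  case (Suc r)
  show ?case
  proof (cases "j = Suc (Suc r)")
    case False
    then have "rev [j..<Suc (Suc r)] = Suc r # rev [j..<Suc r]" using Suc.prems by simp
    then show ?thesis using Suc False by (simp add: adj_perm_Cons)
  qed simp
qed

text \<open>The descending word that begins at the preimage j of the largest index carries j to that
  index; dividing by it leaves a permutation of one index fewer.\<close>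

lemma adj_perm_surj:
  assumes "bij \<sigma>" "\<And>x. x \<notin> {1..m} \<Longrightarrow> \<sigma> x = x"
  shows "\<exists>js \<in> lists {1..<m}. adj_perm js = \<sigma>"
  using assms
proof (induction m arbitrary: \<sigma>)
  case 0
  then have "\<sigma> = id" by auto
  then show ?case by (intro bexI[of _ "[]"]) auto
next
  case (Suc r)
  define j where "j = inv_into UNIV \<sigma> (Suc r)"
  have j: "\<sigma> j = Suc r" unfolding j_def using Suc.prems(1) by (simp add: bij_is_surj surj_f_inv_f)
  have j_in: "j \<in> {1..Suc r}"
  proof (rule ccontr)
    assume "j \<notin> {1..Suc r}"
    then show False using Suc.prems(2)[of j] j by auto
  qed
  let ?D = "adj_perm (rev [j..<Suc r])"
  have bD: "bij ?D" by (rule bij_adj_perm)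
  define \<sigma>' where "\<sigma>' = \<sigma> \<circ> inv_into UNIV ?D"
  have "bij \<sigma>'" unfolding \<sigma>'_def using Suc.prems(1) bD by (intro bij_comp bij_imp_bij_inv)
  moreover have "\<sigma>' x = x" if x: "x \<notin> {1..r}" for x
  proof (cases "x = Suc r")
    case True
    have "?D j = Suc r" using j_in by (intro adj_perm_descending) auto
    then have "inv_into UNIV ?D (Suc r) = j" using bD by (metis bij_inv_eq_iff)
    then show ?thesis using j True by (simp add: \<sigma>'_def)
  next
    case False
    then have "x \<notin> {1..Suc r}" using x by auto
    moreover from this have "?D x = x" using j_in by (intro adj_perm_fixes[where r = "Suc r"]) auto
    then have "inv_into UNIV ?D x = x" using bD by (metis bij_inv_eq_iff)
    ultimately show ?thesis using Suc.prems(2) by (simp add: \<sigma>'_def)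
  qed
  ultimately obtain js where js: "js \<in> lists {1..<r}" "adj_perm js = \<sigma>'" using Suc.IH by blast
  have "adj_perm (js @ rev [j..<Suc r]) = \<sigma>"
    using bD by (simp add: adj_perm_append js \<sigma>'_def comp_assoc bij_is_inj)
  moreover have "js @ rev [j..<Suc r] \<in> lists {1..<Suc r}"
    using js(1) j_in by auto
  ultimately show ?case by blast
qed

section \<open>Normal forms for words in abstract Coxeter generators\<close>

locale coxeter_rep = monoid M for M (structure) +
  fixes m :: nat and S :: "nat \<Rightarrow> 'a"
  assumes S_closed: "i \<in> {1..<m} \<Longrightarrow> S i \<in> carrier M"
    and S_square: "i \<in> {1..<m} \<Longrightarrow> S i \<otimes> S i = \<one>"
    and S_far: "i \<in> {1..<m} \<Longrightarrow> j \<in> {1..<m} \<Longrightarrow> i + 1 < j \<Longrightarrow> S i \<otimes> S j = S j \<otimes> S i"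
    and S_braid: "i \<in> {1..<m} \<Longrightarrow> i + 1 \<in> {1..<m} \<Longrightarrow>
      S i \<otimes> S (i+1) \<otimes> S i = S (i+1) \<otimes> S i \<otimes> S (i+1)"
begin

definition sprod :: "nat list \<Rightarrow> 'a" where
  "sprod js = foldr (\<lambda>i x. S i \<otimes> x) js \<one>"

lemma sprod_Nil [simp]: "sprod [] = \<one>" and sprod_Cons: "sprod (i # js) = S i \<otimes> sprod js"
  by (simp_all add: sprod_def)

lemma sprod_closed: "js \<in> lists {1..<m} \<Longrightarrow> sprod js \<in> carrier M"
  by (induction js) (auto simp: sprod_Cons S_closed)

lemma sprod_append:
  "is \<in> lists {1..<m} \<Longrightarrow> js \<in> lists {1..<m} \<Longrightarrow> sprod (is @ js) = sprod is \<otimes> sprod js"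
  by (induction "is") (auto simp: sprod_Cons m_assoc S_closed sprod_closed)

lemma sprod_far:
  assumes "js \<in> lists {1..<m}" "i \<in> {1..<m}" "\<forall>j \<in> set js. i + 1 < j \<or> j + 1 < i"
  shows "sprod js \<otimes> S i = S i \<otimes> sprod js"
  using assms
proof (induction js)
  case (Cons j js)
  have j: "j \<in> {1..<m}" "js \<in> lists {1..<m}" using Cons.hyps .
  have cl: "S j \<in> carrier M" "S i \<in> carrier M" "sprod js \<in> carrier M"
    using S_closed[OF j(1)] S_closed[OF Cons.prems(1)] sprod_closed[OF j(2)] .
  have "S j \<otimes> S i = S i \<otimes> S j" using Cons.prems j S_far[of i j] S_far[of j i] by auto
  moreover have "sprod js \<otimes> S i = S i \<otimes> sprod js" using Cons by auto
  ultimately show ?case using cl by (metis m_assoc sprod_Cons)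
qed (auto simp: S_closed)

text \<open>The action of the generators on the cosets of S_r in S_(r+1). The representative s_r ...
  s_j grows for i = j - 1, shrinks for i = j, and commutes with s_i for i < j - 1; for i > j a braid
  relation turns s_i into s_(i-1) on its way to the left.\<close>

lemma sprod_descending_snoc:
  assumes r: "Suc r \<le> m" and j: "j \<in> {1..Suc r}" and i: "i \<in> {1..r}"
  shows "\<exists>is \<in> lists {1..<r}. \<exists>j' \<in> {1..Suc r}.
    sprod (rev [j..<Suc r]) \<otimes> S i = sprod is \<otimes> sprod (rev [j'..<Suc r])"
proof -
  have cl: "S i \<in> carrier M" if "i \<in> {1..r}" for i using that r by (auto intro: S_closed)
  have cD: "sprod (rev [a..<b]) \<in> carrier M" if "1 \<le> a" "b \<le> Suc r" for a b
    using that r by (intro sprod_closed) auto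
  have snoc: "sprod (rev [a..<Suc r]) = sprod (rev [Suc a..<Suc r]) \<otimes> S a" if "a \<in> {1..r}" for a
  proof -
    have "rev [a..<Suc r] = rev [Suc a..<Suc r] @ [a]" using that by (simp add: upt_conv_Cons)
    then show ?thesis using that r by (simp add: sprod_append sprod_Cons S_closed del: upt_Suc)
        (subst sprod_append, auto simp: sprod_Cons S_closed)
  qed
  consider "Suc i = j" | "i = j" | "Suc i < j" | a where "i = Suc a" "j \<le> a"
    by (metis Suc_lessI linorder_cases Suc_le_mono less_eq_Suc_le not0_implies_Suc less_nat_zero_code)
  then show ?thesis
  proof cases
    case 1
    then show ?thesis using snoc[OF i] i j cD[of i "Suc r"]
      by (intro bexI[of _ "[]"] bexI[of _ i]) (auto simp del: upt_Suc)
  next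
    case 2
    have "sprod (rev [j..<Suc r]) \<otimes> S i = sprod (rev [Suc i..<Suc r]) \<otimes> (S i \<otimes> S i)"
      using snoc[OF i] 2 cl[OF i] cD[of "Suc i" "Suc r"] by (simp add: m_assoc del: upt_Suc)
    then show ?thesis using i r cD[of "Suc i" "Suc r"]
      by (intro bexI[of _ "[]"] bexI[of _ "Suc i"]) (auto simp: S_square simp del: upt_Suc)
  next
    case 3
    then have "sprod (rev [j..<Suc r]) \<otimes> S i = S i \<otimes> sprod (rev [j..<Suc r])"
      using i j r by (intro sprod_far) auto
    then show ?thesis using 3 i j cl[OF i]
      by (intro bexI[of _ "[i]"] bexI[of _ j]) (auto simp: sprod_Cons simp del: upt_Suc)
  next
    case 4
    \<comment> \<open>With a = i - 1 the word is A s_i s_a B. The indices in B are below a, so B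
      commutes with s_i; those in A are above i, so A commutes with s_a. Between them the braid
      relation applies.\<close>
    let ?A = "sprod (rev [Suc i..<Suc r])" and ?B = "sprod (rev [j..<a])"
    have a: "a \<in> {1..<m}" "i \<in> {1..<m}" "Suc a \<in> {1..<m}" using 4 j i r by auto
    have cAB: "?A \<in> carrier M" "?B \<in> carrier M" using i j r 4 by (auto intro: cD simp del: upt_Suc)
    have "[j..<Suc r] = [j..<a] @ [a..<Suc r]"
      using 4 i upt_add_eq_append[of j a "Suc r - a"] by (simp del: upt_Suc)
    moreover have "[a..<Suc r] = a # i # [Suc i..<Suc r]"
      using 4 i by (simp add: upt_conv_Cons del: upt_Suc)
    ultimately have "[j..<Suc r] = [j..<a] @ [a, i] @ [Suc i..<Suc r]" by simp
    then have "rev [j..<Suc r] = rev [Suc i..<Suc r] @ [i, a] @ rev [j..<a]" by simp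
    then have D: "sprod (rev [j..<Suc r]) = ?A \<otimes> (S i \<otimes> (S a \<otimes> ?B))"
    proof -
      have l: "rev [Suc i..<Suc r] \<in> lists {1..<m}" "rev [j..<a] \<in> lists {1..<m}"
        "[i, a] @ rev [j..<a] \<in> lists {1..<m}"
        using a i j r 4 by (auto simp del: upt_Suc)
      show ?thesis unfolding \<open>rev [j..<Suc r] = _\<close> sprod_append[OF l(1,3)]
        by (simp add: sprod_Cons)
    qed
    have B: "?B \<otimes> S i = S i \<otimes> ?B" using 4 a j by (intro sprod_far) auto
    have A: "?A \<otimes> S a = S a \<otimes> ?A" using 4 a r by (intro sprod_far) (auto simp del: upt_Suc)
    have br: "S i \<otimes> (S a \<otimes> S i) = S a \<otimes> (S i \<otimes> S a)"
      using S_braid[of a] a 4 by (simp add: m_assoc S_closed)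
    have c: "S i \<in> carrier M" "S a \<in> carrier M" using a by (auto intro: S_closed)
    have "sprod (rev [j..<Suc r]) \<otimes> S i = ?A \<otimes> (S i \<otimes> (S a \<otimes> (?B \<otimes> S i)))"
      using D c cAB by (simp add: m_assoc)
    also have "\<dots> = ?A \<otimes> ((S i \<otimes> (S a \<otimes> S i)) \<otimes> ?B)" using B c cAB by (simp add: m_assoc)
    also have "\<dots> = (?A \<otimes> S a) \<otimes> (S i \<otimes> (S a \<otimes> ?B))" using br c cAB by (simp add: m_assoc)
    also have "\<dots> = S a \<otimes> sprod (rev [j..<Suc r])" using A D c cAB by (simp add: m_assoc)
    finally show ?thesis using 4 i j c
      by (intro bexI[of _ "[a]"] bexI[of _ j]) (auto simp: sprod_Cons simp del: upt_Suc)
  qed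
qed

text \<open>Letters are absorbed one at a time from the right; what each of them releases to the
  left is a word without s_r.\<close>

lemma sprod_normal_form:
  assumes r: "Suc r \<le> m" and "is \<in> lists {1..<Suc r}"
  shows "\<exists>js \<in> lists {1..<r}. \<exists>j \<in> {1..Suc r}. sprod is = sprod js \<otimes> sprod (rev [j..<Suc r])"
  using assms(2)
proof (induction "is" rule: rev_induct)
  case Nil
  then show ?case by (intro bexI[of _ "[]"] bexI[of _ "Suc r"]) auto
next
  case (snoc i "is")
  have "is \<in> lists {1..<Suc r}" using snoc.prems by simp
  then obtain js j where IH: "js \<in> lists {1..<r}" "j \<in> {1..Suc r}"
    "sprod is = sprod js \<otimes> sprod (rev [j..<Suc r])" using snoc.IH by blast
  have i: "i \<in> {1..r}" using snoc.prems by auto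
  from sprod_descending_snoc[OF r IH(2) i] obtain js' j' where
    D: "js' \<in> lists {1..<r}" "j' \<in> {1..Suc r}"
    "sprod (rev [j..<Suc r]) \<otimes> S i = sprod js' \<otimes> sprod (rev [j'..<Suc r])" by blast
  have sub: "lists {1..<r} \<subseteq> lists {1..<m}" "lists {1..<Suc r} \<subseteq> lists {1..<m}"
    using r by (auto intro!: lists_mono)
  have cl: "sprod js \<in> carrier M" "sprod js' \<in> carrier M" "S i \<in> carrier M"
    "sprod (rev [j..<Suc r]) \<in> carrier M" "sprod (rev [j'..<Suc r]) \<in> carrier M"
    using IH D i r sub by (auto intro!: sprod_closed S_closed simp del: upt_Suc)
  have "sprod (is @ [i]) = sprod is \<otimes> S i"
    using snoc.prems sub i r by (subst sprod_append) (auto simp: sprod_Cons S_closed)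
  also have "\<dots> = sprod js \<otimes> (sprod js' \<otimes> sprod (rev [j'..<Suc r]))"
    using IH D cl by (simp add: m_assoc del: upt_Suc)
  also have "\<dots> = sprod (js @ js') \<otimes> sprod (rev [j'..<Suc r])"
    using IH D sub cl by (subst sprod_append) (auto simp: m_assoc simp del: upt_Suc)
  finally show ?case using IH D by (intro bexI[of _ "js @ js'"] bexI[of _ j']) (auto simp del: upt_Suc)
qed

text \<open>Normal forms are computed in the product of \<open>M\<close> with the permutations, which keeps track of
  the permutation of a word along with its value.\<close>

lemma sprod_eq_of_adj_perm_eq:
  assumes "is \<in> lists {1..<m}" "is' \<in> lists {1..<m}" "adj_perm is = adj_perm is'"
  shows "sprod is = sprod is'"
proof -
  let ?P = "\<lparr>carrier = UNIV, mult = (\<circ>), one = id\<rparr> :: (nat \<Rightarrow> nat) monoid"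
  let ?S = "\<lambda>i. (S i, transpose i (i+1))"
  have "monoid ?P" by (rule monoidI) (auto simp: comp_assoc)
  then interpret MP: monoid "M \<times>\<times> ?P" by (intro DirProd_monoid monoid_axioms)
  interpret P: coxeter_rep "M \<times>\<times> ?P" m ?S
    by unfold_locales (use S_far in \<open>auto simp: DirProd_def S_closed S_square S_braid[simplified] transpose_def fun_eq_iff\<close>)
  have P: "P.sprod js = (sprod js, adj_perm js)" for js
  proof (induction js)
    case Nil
    show ?case unfolding P.sprod_Nil sprod_Nil adj_perm_Nil by (simp add: DirProd_def id_def)
  next
    case (Cons j js)
    show ?case unfolding P.sprod_Cons Cons sprod_Cons adj_perm_Cons by (simp add: DirProd_def comp_def)
  qed
  have "\<forall>is is'. is \<in> lists {1..<Suc r} \<longrightarrow> is' \<in> lists {1..<Suc r} \<longrightarrow> adj_perm is = adj_perm is' \<longrightarrow>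
     sprod is = sprod is'" if "Suc r \<le> m" for r
    using that
  proof (induction r)
    case (Suc r)
    let ?D = "\<lambda>j. rev [j..<Suc (Suc r)]"
    show ?case
    proof (intro allI impI)
      fix "is" is' assume a: "is \<in> lists {1..<Suc (Suc r)}" "is' \<in> lists {1..<Suc (Suc r)}"
        "adj_perm is = adj_perm is'"
      obtain js j where js: "js \<in> lists {1..<Suc r}" "j \<in> {1..Suc (Suc r)}"
        "P.sprod is = P.sprod js \<otimes>\<^bsub>M \<times>\<times> ?P\<^esub> P.sprod (?D j)"
        using P.sprod_normal_form[OF Suc.prems a(1)] by blast
      obtain js' j' where js': "js' \<in> lists {1..<Suc r}" "j' \<in> {1..Suc (Suc r)}"
        "P.sprod is' = P.sprod js' \<otimes>\<^bsub>M \<times>\<times> ?P\<^esub> P.sprod (?D j')"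
        using P.sprod_normal_form[OF Suc.prems a(2)] by blast
      have s: "sprod is = sprod js \<otimes> sprod (?D j)" "sprod is' = sprod js' \<otimes> sprod (?D j')"
        and p: "adj_perm is = adj_perm js \<circ> adj_perm (?D j)" "adj_perm is' = adj_perm js' \<circ> adj_perm (?D j')"
        using js(3) js'(3) unfolding P by (auto simp: DirProd_def simp del: upt_Suc)
      \<comment> \<open>The letters of ks fix the largest index. So the j of the coset
        representative is the preimage of that index and can be read off the permutation.\<close>
      have img: "adj_perm ks (adj_perm (?D i) i) = Suc (Suc r)"
        if "ks \<in> lists {1..<Suc r}" "i \<in> {1..Suc (Suc r)}" for ks i
        using that adj_perm_descending[of i "Suc r"] adj_perm_fixes[OF that(1), of "Suc (Suc r)"]
        by (simp del: upt_Suc)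
      have p': "adj_perm is = adj_perm js' \<circ> adj_perm (?D j')" using p(2) a(3) by simp
      have "adj_perm is j = Suc (Suc r)"
        unfolding p(1) comp_apply by (rule img[OF js(1,2)])
      moreover have "adj_perm is j' = Suc (Suc r)"
        unfolding p' comp_apply by (rule img[OF js'(1,2)])
      ultimately have "adj_perm is j = adj_perm is j'" by simp
      then have jj: "j = j'" by (rule injD[OF bij_is_inj[OF bij_adj_perm]])
      have "adj_perm js = adj_perm js'"
      proof
        fix x
        have x: "adj_perm (?D j) (inv_into UNIV (adj_perm (?D j)) x) = x"
          by (rule surj_f_inv_f[OF bij_is_surj[OF bij_adj_perm]])
        show "adj_perm js x = adj_perm js' x"
          using fun_cong[OF trans[OF p(1)[symmetric] p'[folded jj]], of "inv_into UNIV (adj_perm (?D j)) x"]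
          unfolding comp_apply x .
      qed
      then have "sprod js = sprod js'"
        by (rule Suc.IH[OF Suc_leD[OF Suc.prems], rule_format, OF js(1) js'(1)])
      then show "sprod is = sprod is'" using s jj by simp
    qed
  qed (simp add: lists_empty)
  note * = this
  show ?thesis
  proof (cases m)
    case 0
    then show ?thesis using assms(1,2) by (simp add: lists_empty)
  next
    case (Suc r)
    show ?thesis using *[of r] assms unfolding Suc by blast
  qed
qed

end

section \<open>Spanning by normal words\<close>

fun gen_val :: "((nat \<Rightarrow> 'g) \<Rightarrow> 'r) \<Rightarrow> (nat \<Rightarrow> 'r) \<Rightarrow> (nat \<Rightarrow> 'r) \<Rightarrow> 'g wgen \<Rightarrow> 'r" where
  "gen_val E S X (GenG g) = E g"
| "gen_val E S X (GenS i) = S i"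
| "gen_val E S X (GenX k) = X k"

definition group_gens :: "('g, 'b) monoid_scheme \<Rightarrow> nat \<Rightarrow> 'g wgen set" where
  "group_gens G m = GenG ` carrier (Gpow G m) \<union> GenS ` {1..<m}"

text \<open>The element of the wreath product of G with S_m spelled by a group word. The value at
  \<open>GenX\<close> is a default; the words in question are those over
  \<open>group_gens\<close>.\<close>

definition mon_word :: "('g, 'b) monoid_scheme \<Rightarrow> nat \<Rightarrow> 'g wgen list \<Rightarrow> nat \<Rightarrow> nat \<times> 'g" where
  "mon_word G m v = foldr (\<lambda>a f. gen_val (mon_diag G m) (\<lambda>i. mon_perm G (transpose i (i+1)))
     (\<lambda>_. \<one>\<^bsub>monomial G\<^esub>) a \<otimes>\<^bsub>monomial G\<^esub> f) v \<one>\<^bsub>monomial G\<^esub>"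

context finite_group begin

lemma mon_word_Nil [simp]: "mon_word G m [] = \<one>\<^bsub>monomial G\<^esub>"
  by (simp add: mon_word_def)

lemma mon_word_GenG: "mon_word G m (GenG g # v) = mon_diag G m g \<cdot> mon_word G m v"
  by (simp add: mon_word_def)

lemma mon_word_GenS:
  "mon_word G m (GenS i # v) = mon_perm G (transpose i (i+1)) \<cdot> mon_word G m v"
  by (simp add: mon_word_def)

lemma mon_word_closed: "v \<in> lists (group_gens G m) \<Longrightarrow> mon_word G m v \<in> carrier (monomial G)"
  by (induction v) (auto simp: group_gens_def mon_word_GenG mon_word_GenS
      simp del: One_nat_def intro!: M.m_closed mon_diag_closed mon_perm_closed)

lemma mon_word_map_GenS: "mon_word G m (map GenS js) = mon_perm G (adj_perm js)"
  by (induction js) (simp_all only: list.map mon_word_Nil mon_word_GenS mon_perm_mult adj_perm_Nil adj_perm_Cons mon_perm_id)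

text \<open>The decomposition in the semidirect product of G^m and S_m: the permutation is the row
  map, and g can then be read off because every row is hit.\<close>

lemma mon_diag_perm_inject:
  assumes "mon_diag G m g \<cdot> mon_perm G \<sigma> = mon_diag G m g' \<cdot> mon_perm G \<sigma>'"
    and "g \<in> carrier (Gpow G m)" "g' \<in> carrier (Gpow G m)" "bij \<sigma>"
  shows "g = g' \<and> \<sigma> = \<sigma>'"
proof -
  have e: "(\<sigma> j, if \<sigma> j \<in> {1..m} then g (\<sigma> j) else \<one>) = (\<sigma>' j, if \<sigma>' j \<in> {1..m} then g' (\<sigma>' j) else \<one>)" for j
    using fun_cong[OF assms(1), of j] assms(2,3)
    by (auto simp: monomial_mult mon_diag_def mon_perm_def Gpow_carrier PiE_iff split: if_splits)
  then have s: "\<sigma> = \<sigma>'" by auto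
  have "g i = g' i" if "i \<in> {1..m}" for i
  proof -
    obtain j where "\<sigma> j = i" using assms(4) by (metis bij_pointE)
    then show ?thesis using e[of j] that by auto
  qed
  then have "g = g'" using assms(2,3) unfolding Gpow_carrier by (intro PiE_ext[of g]) auto
  with s show ?thesis by simp
qed

end

context wreath_rep begin

definition word :: "'g wgen list \<Rightarrow> 'r" where
  "word u = foldr (\<lambda>a x. gen_val E S X a \<otimes> x) u \<one>"

lemma word_Nil [simp]: "word [] = \<one>" and word_Cons: "word (a # u) = gen_val E S X a \<otimes> word u"
  by (simp_all add: word_def)

lemma gen_val_closed: "a \<in> wgens G m \<Longrightarrow> gen_val E S X a \<in> carrier R"
  by (auto simp: wgens_def E_closed S_closed X_closed)

lemma word_closed: "u \<in> lists (wgens G m) \<Longrightarrow> word u \<in> carrier R"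
  by (induction u) (auto simp: word_Cons gen_val_closed)

lemma word_append:
  "u \<in> lists (wgens G m) \<Longrightarrow> v \<in> lists (wgens G m) \<Longrightarrow> word (u @ v) = word u \<otimes> word v"
  by (induction u) (auto simp: word_Cons gen_val_closed word_closed R.m_assoc)

sublocale finite_group G by unfold_locales (rule finite_G)

text \<open>\<open>S_E\<close> moves group elements to the left past the S i. The same rewriting is
  carried out in R and on monomial maps, so the g and the permutation of the normal form are those
  of the matrix.\<close>

lemma group_word_normal_form:
  assumes "v \<in> lists (group_gens G m)"
  shows "\<exists>g \<in> carrier (Gpow G m). \<exists>js \<in> lists {1..<m}. word v = E g \<otimes> word (map GenS js) \<and>
    mon_word G m v = mon_diag G m g \<cdot> mon_perm G (adj_perm js)"
  using assms
proof (induction v)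
  case Nil
  have "mon_diag G m \<one>\<^bsub>Gpow G m\<^esub> \<cdot> mon_perm G id = \<one>\<^bsub>monomial G\<^esub>"
    by (auto simp: mon_diag_def mon_perm_def monomial_mult monomial_one Gpow_one)
  moreover have "\<one>\<^bsub>Gpow G m\<^esub> \<in> carrier (Gpow G m)" by (auto simp: Gpow_one Gpow_carrier)
  ultimately show ?case
    by (intro bexI[of _ "\<one>\<^bsub>Gpow G m\<^esub>"] bexI[of _ "[]"]) (simp_all only: mon_word_Nil adj_perm_Nil
        list.map word_Nil E_one R.l_one[OF R.one_closed] lists.Nil simp_thms)
next
  case (Cons a v)
  then obtain g js where IH: "g \<in> carrier (Gpow G m)" "js \<in> lists {1..<m}"
    "word v = E g \<otimes> word (map GenS js)"
    "mon_word G m v = mon_diag G m g \<cdot> mon_perm G (adj_perm js)" by auto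
  have w: "word (map GenS js) \<in> carrier R"
    using IH(2) by (intro word_closed) (auto simp: wgens_def)
  note cl = IH(1,2) w E_closed S_closed mon_diag_closed mon_perm_closed
  show ?case
  proof (cases a)
    case (GenG h)
    then have h: "h \<in> carrier (Gpow G m)" using Cons.hyps by (auto simp: group_gens_def)
    have "h \<otimes>\<^bsub>Gpow G m\<^esub> g \<in> carrier (Gpow G m)" using h IH(1) by (auto simp: Gpow_carrier Gpow_mult)
    then show ?thesis using GenG h cl
      by (intro bexI[of _ "h \<otimes>\<^bsub>Gpow G m\<^esub> g"] bexI[of _ js])
        (auto simp: word_Cons IH(3,4) mon_word_GenG E_mult[symmetric] R.m_assoc[symmetric]
          mon_diag_mult[symmetric] M.m_assoc[symmetric])
  next
    case (GenS i)
    then have i: "i \<in> {1..<m}" using Cons.hyps by (auto simp: group_gens_def)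
    let ?g = "perm_act m (transpose i (i+1)) g"
    have g: "?g \<in> carrier (Gpow G m)" using i IH(1) by (rule perm_act_closed)
    have 1: "word (a # v) = E ?g \<otimes> word (map GenS (i # js))"
      using GenS cl g S_E[OF i IH(1)] S_closed[OF i] 
      by (simp add: word_Cons IH(3) R.m_assoc[symmetric])
    have 2: "mon_word G m (a # v) = mon_diag G m ?g \<cdot> mon_perm G (adj_perm (i # js))"
      unfolding GenS mon_word_GenS IH(4) adj_perm_Cons mon_perm_mult[symmetric]
      using mon_perm_diag[OF i IH(1)] cl g by (simp add: M.m_assoc[symmetric] del: One_nat_def)
    show ?thesis using 1 2 g i IH(2) by (intro bexI[of _ ?g] bexI[of _ "i # js"]) auto
  next
    case (GenX k)
    then show ?thesis using Cons.hyps by (auto simp: group_gens_def)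
  qed
qed

text \<open>What the E g and S i generate multiplicatively is an image of the wreath product: the
  matrix determines the g and the permutation of the normal form, and by the Coxeter relations the
  permutation determines the product of the S i.\<close>

lemma group_word_eq:
  assumes "v \<in> lists (group_gens G m)" "v' \<in> lists (group_gens G m)" "mon_word G m v = mon_word G m v'"
  shows "word v = word v'"
proof -
  interpret C: coxeter_rep R m S
    by unfold_locales (use S_far in \<open>auto simp: S_closed S_square S_braid[simplified]\<close>)
  have C: "word (map GenS js) = C.sprod js" for js
    by (induction js) (auto simp: word_Cons C.sprod_Cons)
  obtain g js where 1: "g \<in> carrier (Gpow G m)" "js \<in> lists {1..<m}" "word v = E g \<otimes> word (map GenS js)"
    "mon_word G m v = mon_diag G m g \<cdot> mon_perm G (adj_perm js)"
    using group_word_normal_form[OF assms(1)] by blast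
  obtain g' js' where 2: "g' \<in> carrier (Gpow G m)" "js' \<in> lists {1..<m}" "word v' = E g' \<otimes> word (map GenS js')"
    "mon_word G m v' = mon_diag G m g' \<cdot> mon_perm G (adj_perm js')"
    using group_word_normal_form[OF assms(2)] by blast
  have "mon_diag G m g \<cdot> mon_perm G (adj_perm js)
    = mon_diag G m g' \<cdot> mon_perm G (adj_perm js')"
    using 1(4) 2(4) assms(3) by simp
  from mon_diag_perm_inject[OF this 1(1) 2(1) bij_adj_perm]
  have g: "g = g'" and p: "adj_perm js = adj_perm js'" by auto
  show ?thesis unfolding 1(3) 2(3) C C.sprod_eq_of_adj_perm_eq[OF 1(2) 2(2) p] g ..
qed

text \<open>Integral combinations only, as R is merely a ring. They suffice because the relations
  have integral coefficients; scalars are put back once R is the quotient of the free algebra. Group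
  words v are arbitrary here and are reduced to one per matrix later.\<close>

inductive_set nspan :: "'r set" where
  base: "sorted ks \<Longrightarrow> ks \<in> lists {1..m} \<Longrightarrow> v \<in> lists (group_gens G m) \<Longrightarrow>
    word (map GenX ks @ v) \<in> nspan"
| zero: "\<zero> \<in> nspan"
| add: "x \<in> nspan \<Longrightarrow> y \<in> nspan \<Longrightarrow> x \<oplus> y \<in> nspan"
| neg: "x \<in> nspan \<Longrightarrow> \<ominus> x \<in> nspan"

lemma mixed_closed:
  "ks \<in> lists {1..m} \<Longrightarrow> v \<in> lists (group_gens G m) \<Longrightarrow> map GenX ks @ v \<in> lists (wgens G m)"
  by (auto simp: wgens_def group_gens_def)

lemma mixed_word_closed:
  "ks \<in> lists {1..m} \<Longrightarrow> v \<in> lists (group_gens G m) \<Longrightarrow> word (map GenX ks @ v) \<in> carrier R"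
  by (intro word_closed mixed_closed)

lemma nspan_closed: "x \<in> nspan \<Longrightarrow> x \<in> carrier R"
  by (induction rule: nspan.induct) (simp_all only: mixed_word_closed R.zero_closed R.a_closed R.a_inv_closed)

lemma nspan_left_mult:
  assumes "c \<in> carrier R"
    and "\<And>ks v. sorted ks \<Longrightarrow> ks \<in> lists {1..m} \<Longrightarrow> v \<in> lists (group_gens G m) \<Longrightarrow>
      c \<otimes> word (map GenX ks @ v) \<in> nspan"
    and "y \<in> nspan"
  shows "c \<otimes> y \<in> nspan"
  using assms(3)
proof (induction rule: nspan.induct)
  case (add x y)
  then show ?case using assms(1) nspan_closed by (simp add: R.r_distr nspan.add)
next
  case (neg x)
  then show ?case using assms(1) nspan_closed by (simp add: R.r_minus nspan.neg)
qed (auto simp: assms nspan.zero)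

lemma X_word_insort:
  assumes "k \<in> {1..m}" "ks \<in> lists {1..m}" "v \<in> lists (group_gens G m)"
  shows "X k \<otimes> word (map GenX ks @ v) = word (map GenX (insort k ks) @ v)"
  using assms
proof (induction ks)
  case (Cons l ks)
  have l: "l \<in> {1..m}" "ks \<in> lists {1..m}" using Cons.prems(2) by simp_all
  have c: "word (map GenX ks @ v) \<in> carrier R" "X k \<in> carrier R" "X l \<in> carrier R"
    using l Cons.prems(1,3) by (simp_all only: mixed_word_closed X_closed)
  have "X k \<otimes> (X l \<otimes> word (map GenX ks @ v)) = X l \<otimes> (X k \<otimes> word (map GenX ks @ v))"
    using c X_X[of k l] l Cons.prems by (simp add: R.m_assoc[symmetric])
  then show ?case using Cons by (auto simp: word_Cons)
qed (simp add: word_Cons)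

lemma nspan_X: "k \<in> {1..m} \<Longrightarrow> y \<in> nspan \<Longrightarrow> X k \<otimes> y \<in> nspan"
proof (rule nspan_left_mult)
  fix ks v assume "k \<in> {1..m}" "sorted ks" "ks \<in> lists {1..m}" "v \<in> lists (group_gens G m)"
  then show "X k \<otimes> word (map GenX ks @ v) \<in> nspan"
    by (subst X_word_insort) (auto intro!: nspan.base simp: sorted_insort set_insort_key)
qed (auto intro: X_closed)

lemma nspan_X_word: "ks \<in> lists {1..m} \<Longrightarrow> v \<in> lists (group_gens G m) \<Longrightarrow> word (map GenX ks @ v) \<in> nspan"
proof (induction ks)
  case Nil
  then show ?case using nspan.base[of "[]" v] by simp
next
  case (Cons k ks)
  then show ?case by (auto simp: word_Cons intro!: nspan_X)
qed

lemma nspan_E: "g \<in> carrier (Gpow G m) \<Longrightarrow> y \<in> nspan \<Longrightarrow> E g \<otimes> y \<in> nspan"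
proof (rule nspan_left_mult)
  fix ks v assume g: "g \<in> carrier (Gpow G m)" and s: "sorted ks" and ks: "ks \<in> lists {1..m}"
    and v: "v \<in> lists (group_gens G m)"
  have "E g \<otimes> word (map GenX ks @ v) = word (map GenX ks @ GenG g # v)"
    using ks
  proof (induction ks)
    case (Cons l ks)
    have c: "word (map GenX ks @ v) \<in> carrier R" "E g \<in> carrier R" "X l \<in> carrier R"
      using Cons.hyps g v by (simp_all only: mixed_word_closed X_closed E_closed)
    have "E g \<otimes> (X l \<otimes> word (map GenX ks @ v)) = X l \<otimes> (E g \<otimes> word (map GenX ks @ v))"
      using c E_X[OF g, of l] Cons.hyps by (simp add: R.m_assoc[symmetric])
    then show ?case using Cons by (auto simp: word_Cons)
  qed (simp add: word_Cons)
  moreover have "GenG g # v \<in> lists (group_gens G m)" using g v by (auto simp: group_gens_def)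
  ultimately show "E g \<otimes> word (map GenX ks @ v) \<in> nspan"
    using nspan.base[OF s ks] by simp
qed (auto intro: E_closed)

lemma nspan_finsum:
  assumes "finite J" "\<And>j. j \<in> J \<Longrightarrow> f j \<in> carrier R" "\<And>j. j \<in> J \<Longrightarrow> f j \<otimes> y \<in> nspan" "y \<in> carrier R"
  shows "(\<Oplus>j\<in>J. f j) \<otimes> y \<in> nspan"
  using assms
proof (induction J rule: finite_induct)
  case (insert j J)
  then show ?case by (auto simp: R.finsum_insert R.l_distr Pi_iff intro!: nspan.add)
qed (auto simp: nspan.zero)

lemma at_pos_E_closed: "h \<in> carrier G \<Longrightarrow> E (at_pos G m k h) \<in> carrier R"
  by (intro E_closed at_pos_closed G.group_axioms)

text \<open>Moving S k past the first X l costs at most a sum of group elements in which S k and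
  that X l are gone. The induction hypothesis covers the main term, stability of the span under
  group elements the error term.\<close>

lemma nspan_S_word:
  assumes k: "k \<in> {1..<m}" and "ks \<in> lists {1..m}" and v: "v \<in> lists (group_gens G m)"
  shows "S k \<otimes> word (map GenX ks @ v) \<in> nspan"
  using assms(2)
proof (induction ks)
  case Nil
  have "GenS k # v \<in> lists (group_gens G m)" using k v by (auto simp: group_gens_def)
  then have "word (GenS k # v) \<in> nspan" using nspan.base[of "[]"] by fastforce
  then show ?case by (simp add: word_Cons)
next
  case (Cons l ks)
  let ?w = "word (map GenX ks @ v)"
  let ?f = "\<lambda>h. E (at_pos G m k h) \<otimes> E (at_pos G m (k+1) (inv\<^bsub>G\<^esub> h))"
  let ?t = "\<Oplus>h\<in>carrier G. ?f h"
  have l: "l \<in> {1..m}" and w: "?w \<in> nspan" and IH: "S k \<otimes> ?w \<in> nspan"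
    using Cons v by (auto intro!: nspan_X_word)
  have k': "k \<in> {1..m}" "k + 1 \<in> {1..m}" using k by auto
  have wc: "?w \<in> carrier R" using w by (rule nspan_closed)
  have fc: "?f h \<in> carrier R" if "h \<in> carrier G" for h using that by (simp add: at_pos_E_closed)
  have tc: "?t \<in> carrier R" using fc by (intro R.finsum_closed) auto
  note c = wc tc S_closed[OF k] X_closed[OF k'(1)] X_closed[OF k'(2)] X_closed[OF l]
  have goal: "S k \<otimes> word (map GenX (l # ks) @ v) = (S k \<otimes> X l) \<otimes> ?w"
    using c by (simp add: word_Cons R.m_assoc)
  consider "l = k" | "l = k + 1" | "l \<noteq> k" "l \<noteq> k + 1" by blast
  then show ?case
  proof cases
    case 1
    have "?t \<otimes> ?w \<in> nspan"
    proof (rule nspan_finsum[OF finite_G fc _ wc])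
      fix h assume h: "h \<in> carrier G"
      then have "?f h \<otimes> ?w = E (at_pos G m k h) \<otimes> (E (at_pos G m (k+1) (inv\<^bsub>G\<^esub> h)) \<otimes> ?w)"
        using wc by (simp add: R.m_assoc at_pos_E_closed)
      also have "\<dots> \<in> nspan" using h w by (intro nspan_E at_pos_closed G.group_axioms) auto
      finally show "?f h \<otimes> ?w \<in> nspan" .
    qed auto
    moreover have "(S k \<otimes> X k) \<otimes> ?w = X (k+1) \<otimes> (S k \<otimes> ?w) \<oplus> ?t \<otimes> ?w"
      unfolding S_X[OF k] using c by (simp add: R.l_distr R.m_assoc)
    ultimately show ?thesis
      using 1 goal nspan_X[OF k'(2) IH] by (simp add: nspan.add)
  next
    case 2
    \<comment> \<open>The axiom \<open>S_X\<close> moves S k past X k. The rule for X (k+1) comes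
      from multiplying it by S k on both sides; the error term becomes the conjugate of
      \<open>?t\<close>, again a sum of products of two group elements.\<close>
    let ?p = "perm_act m (transpose k (k+1))"
    let ?f' = "\<lambda>h. E (?p (at_pos G m k h)) \<otimes> E (?p (at_pos G m (k+1) (inv\<^bsub>G\<^esub> h)))"
    have pc: "?p (at_pos G m i h) \<in> carrier (Gpow G m)" if "h \<in> carrier G" for i h
      using that by (intro perm_act_closed k at_pos_closed G.group_axioms)
    have f'c: "?f' h \<in> carrier R" if "h \<in> carrier G" for h
      using that pc by (simp add: E_closed)
    have "S k \<otimes> ?f h \<otimes> S k = ?f' h" if h: "h \<in> carrier G" for h
    proof -
      have a: "at_pos G m k h \<in> carrier (Gpow G m)" "at_pos G m (k+1) (inv\<^bsub>G\<^esub> h) \<in> carrier (Gpow G m)"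
        using h by (auto intro!: at_pos_closed G.group_axioms)
      note cc = c E_closed[OF a(1)] E_closed[OF a(2)] E_closed[OF pc[OF h]] E_closed[OF pc[OF G.inv_closed[OF h]]]
      have "S k \<otimes> ?f h \<otimes> S k = (S k \<otimes> E (at_pos G m k h)) \<otimes> E (at_pos G m (k+1) (inv\<^bsub>G\<^esub> h)) \<otimes> S k"
        using cc by (simp add: R.m_assoc)
      also have "\<dots> = E (?p (at_pos G m k h)) \<otimes> (S k \<otimes> E (at_pos G m (k+1) (inv\<^bsub>G\<^esub> h))) \<otimes> S k"
        unfolding S_E[OF k a(1)] using cc by (simp add: R.m_assoc)
      also have "\<dots> = ?f' h \<otimes> (S k \<otimes> S k)"
        unfolding S_E[OF k a(2)] using cc by (simp add: R.m_assoc)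
      also have "\<dots> = ?f' h" using cc by (simp add: S_square[OF k])
      finally show ?thesis .
    qed
    note conj = this
    have "S k \<otimes> ?t \<otimes> S k = (\<Oplus>h\<in>carrier G. S k \<otimes> ?f h) \<otimes> S k"
      using fc c by (subst R.finsum_rdistr[OF finite_G]) (auto simp: Pi_iff)
    also have "\<dots> = (\<Oplus>h\<in>carrier G. S k \<otimes> ?f h \<otimes> S k)"
      using fc c by (intro R.finsum_ldistr finite_G) auto
    also have "\<dots> = (\<Oplus>h\<in>carrier G. ?f' h)"
      using conj f'c by (intro R.finsum_cong' refl) auto
    finally have "S k \<otimes> ?t \<otimes> S k = (\<Oplus>h\<in>carrier G. ?f' h)" .
    moreover have "(\<Oplus>h\<in>carrier G. ?f' h) \<otimes> ?w \<in> nspan"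
    proof (rule nspan_finsum[OF finite_G f'c _ wc])
      fix h assume h: "h \<in> carrier G"
      then have "?f' h \<otimes> ?w = E (?p (at_pos G m k h)) \<otimes> (E (?p (at_pos G m (k+1) (inv\<^bsub>G\<^esub> h))) \<otimes> ?w)"
        using wc pc by (simp add: R.m_assoc E_closed)
      also have "\<dots> \<in> nspan" using h w pc by (intro nspan_E) auto
      finally show "?f' h \<otimes> ?w \<in> nspan" .
    qed auto
    ultimately have tw: "(S k \<otimes> ?t \<otimes> S k) \<otimes> ?w \<in> nspan" by simp
    have "X k \<otimes> S k = S k \<otimes> (S k \<otimes> X k) \<otimes> S k"
      using c by (simp add: R.m_assoc[symmetric] S_square[OF k])
    also have "\<dots> = S k \<otimes> X (k+1) \<otimes> (S k \<otimes> S k) \<oplus> S k \<otimes> ?t \<otimes> S k"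
      unfolding S_X[OF k] using c by (simp add: R.l_distr R.r_distr R.m_assoc)
    finally have "X k \<otimes> S k = S k \<otimes> X (k+1) \<oplus> S k \<otimes> ?t \<otimes> S k" using c by (simp add: S_square[OF k])
    then have "X k \<otimes> S k \<oplus> \<ominus> (S k \<otimes> ?t \<otimes> S k) = S k \<otimes> X (k+1)"
      using c by (simp add: R.a_assoc R.r_neg)
    then have "(S k \<otimes> X (k+1)) \<otimes> ?w = X k \<otimes> (S k \<otimes> ?w) \<oplus> \<ominus> ((S k \<otimes> ?t \<otimes> S k) \<otimes> ?w)"
    proof -
      have "(S k \<otimes> X (k+1)) \<otimes> ?w = (X k \<otimes> S k \<oplus> \<ominus> (S k \<otimes> ?t \<otimes> S k)) \<otimes> ?w"
        using \<open>X k \<otimes> S k \<oplus> \<ominus> _ = _\<close> by simp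
      also have "\<dots> = (X k \<otimes> S k) \<otimes> ?w \<oplus> (\<ominus> (S k \<otimes> ?t \<otimes> S k)) \<otimes> ?w"
        using c by (intro R.l_distr R.m_closed R.a_inv_closed)
      also have "(\<ominus> (S k \<otimes> ?t \<otimes> S k)) \<otimes> ?w = \<ominus> ((S k \<otimes> ?t \<otimes> S k) \<otimes> ?w)"
        using c by (intro R.l_minus R.m_closed)
      also have "(X k \<otimes> S k) \<otimes> ?w = X k \<otimes> (S k \<otimes> ?w)"
        using c by (intro R.m_assoc)
      finally show ?thesis .
    qed
    then show ?thesis
      using 2 goal nspan_X[OF k'(1) IH] tw by (simp add: nspan.add nspan.neg)
  next
    case 3
    then have "(S k \<otimes> X l) \<otimes> ?w = X l \<otimes> (S k \<otimes> ?w)"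
      using S_X_far[OF k l] c by (simp add: R.m_assoc)
    then show ?thesis using goal nspan_X[OF l IH] by simp
  qed
qed

lemma nspan_S: "k \<in> {1..<m} \<Longrightarrow> y \<in> nspan \<Longrightarrow> S k \<otimes> y \<in> nspan"
  by (rule nspan_left_mult) (auto intro: nspan_S_word S_closed)

text \<open>The span contains the empty word and is stable under left multiplication by every
  generator.\<close>

lemma word_in_nspan: "u \<in> lists (wgens G m) \<Longrightarrow> word u \<in> nspan"
proof (induction u)
  case Nil
  then show ?case using nspan.base[of "[]" "[]"] by simp
next
  case (Cons a u)
  then show ?case by (auto simp: wgens_def word_Cons intro!: nspan_X nspan_S nspan_E)
qed

end

section \<open>Linear independence of the normal words\<close>

text \<open>One summand of an expanded product of \<open>jm\<close>, applied to w: the triple (k, i,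
  h) is the swap chosen from the factor \<open>jm G n k\<close>.\<close>

definition swaps :: "('g, 'b) monoid_scheme \<Rightarrow> (nat \<times> nat \<times> 'g) list \<Rightarrow> (nat \<Rightarrow> nat \<times> 'g) \<Rightarrow> nat \<Rightarrow> nat \<times> 'g" where
  "swaps G L w = foldr (\<lambda>(k, i, h) f. mon_swap G k i h \<otimes>\<^bsub>monomial G\<^esub> f) L w"

abbreviation idxs :: "(nat \<times> nat \<times> 'g) list \<Rightarrow> nat list" where
  "idxs L \<equiv> map (\<lambda>x. fst (snd x)) L"

definition jm_prod :: "('g, 'b) monoid_scheme \<Rightarrow> nat \<Rightarrow> nat list \<Rightarrow> (nat \<Rightarrow> nat \<times> 'g) \<Rightarrow> (nat \<Rightarrow> nat \<times> 'g) \<Rightarrow> 'f::field" where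
  "jm_prod G n ks w = foldr (\<lambda>k \<beta>. jm G n k \<otimes>\<^bsub>mon_alg G\<^esub> \<beta>) ks (basis_elt w)"

definition monomial_upto :: "('g, 'b) monoid_scheme \<Rightarrow> nat \<Rightarrow> (nat \<Rightarrow> nat \<times> 'g) set" where
  "monomial_upto G m = {w \<in> carrier (monomial G).
     (\<forall>j \<le> m. fst (w j) \<le> m) \<and> (\<forall>j > m. w j = (j, \<one>\<^bsub>G\<^esub>))}"

text \<open>Satisfied by all summands of an expanded product of \<open>jm\<close> with first indices
  at most m. The index i may itself be at most m; such summands, too, have to be told apart from the
  one used for detection.\<close>

definition good_swaps :: "('g, 'b) monoid_scheme \<Rightarrow> nat \<Rightarrow> (nat \<times> nat \<times> 'g) list \<Rightarrow> bool" where
  "good_swaps G m L \<longleftrightarrow> (\<forall>(k, i, h) \<in> set L. k \<le> m \<and> k < i \<and> h \<in> carrier G)"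

section \<open>Recovering a list of swaps from its product\<close>

context finite_group begin

lemma swaps_Nil [simp]: "swaps G [] w = w"
  by (simp add: swaps_def)

lemma swaps_Cons: "swaps G ((k, i, h) # L) w = mon_swap G k i h \<cdot> swaps G L w"
  by (simp add: swaps_def)

lemma good_swaps_Cons:
  "good_swaps G m ((k, i, h) # L) \<longleftrightarrow> k \<le> m \<and> k < i \<and> h \<in> carrier G \<and> good_swaps G m L"
  by (auto simp: good_swaps_def)

lemma good_swaps_fst: "good_swaps G m L \<Longrightarrow> map fst L \<in> lists {..m}"
  by (induction L) (simp_all add: good_swaps_Cons split_paired_all)

lemma swaps_closed:
  "good_swaps G m L \<Longrightarrow> w \<in> carrier (monomial G) \<Longrightarrow> swaps G L w \<in> carrier (monomial G)"
  by (induction L) (auto simp: swaps_Cons good_swaps_Cons intro!: M.m_closed mon_swap_closed)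

lemma swaps_fixes:
  assumes "good_swaps G m L" "w \<in> monomial_upto G m" "j > m" "j \<notin> set (idxs L)"
  shows "swaps G L w j = (j, \<one>)"
  using assms
proof (induction L)
  case (Cons x L)
  obtain k i h where x: "x = (k, i, h)" by (cases x)
  then show ?case using Cons by (auto simp: swaps_Cons good_swaps_Cons monomial_mult mon_swap_def)
qed (auto simp: monomial_upto_def)

text \<open>The matrix w and the swaps further right fix i, so only the first swap acts on column i,
  and its k and h stand there. This is how a list is decoded.\<close>

lemma swaps_head:
  assumes "good_swaps G m ((k, i, h) # L)" "w \<in> monomial_upto G m" "i > m" "i \<notin> set (idxs L)"
  shows "swaps G ((k, i, h) # L) w i = (k, h)"
  using assms swaps_fixes[of m L w i] by (auto simp: swaps_Cons good_swaps_Cons monomial_mult mon_swap_def)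

text \<open>Once its own swap has taken column j to some k \<le> m, it could return to row j only
  through a second swap with index j, which distinctness excludes.\<close>

lemma swaps_moves:
  assumes "good_swaps G m L" "w \<in> monomial_upto G m" "distinct (idxs L)" "\<forall>i \<in> set (idxs L). i > m"
    "j \<in> set (idxs L)"
  shows "swaps G L w j \<noteq> (j, \<one>)"
  using assms
proof (induction L)
  case (Cons x L)
  obtain k i h where x: "x = (k, i, h)" by (cases x)
  show ?case
  proof (cases "j = i")
    case True
    then show ?thesis using Cons.prems swaps_head[of m k i h L w] by (auto simp: x good_swaps_Cons)
  next
    case False
    have g: "good_swaps G m L" and k: "k \<le> m" "h \<in> carrier G"
      using Cons.prems(1) by (auto simp: x good_swaps_Cons)
    have c: "snd (swaps G L w j) \<in> carrier G"
      using swaps_closed[OF g, of w] Cons.prems(2) by (auto simp: monomial_upto_def monomial_carrier)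
    have j: "j > m" using Cons.prems by auto
    have "swaps G L w j \<noteq> (j, \<one>)" using Cons False g by (auto simp: x)
    then show ?thesis using False c j k
      by (cases "swaps G L w j") (auto simp: x swaps_Cons monomial_mult mon_swap_def)
  qed
qed auto

text \<open>Reading the list from right to left, column j stays put until the swap with index j
  sends it to some k \<le> m, with value h. A later swap with the same k sends it on to an index
  above m, where it remains because the indices are distinct. So a final row at most m is the k of
  the swap with index j, and no swap to the left of that one has the same k.\<close>

lemma swaps_trace:
  assumes "good_swaps G m L" "w \<in> monomial_upto G m" "distinct (idxs L)" "\<forall>i \<in> set (idxs L). i > m"
    "j > m"
  shows "if fst (swaps G L w j) \<le> m
    then \<exists>L1 L2. L = L1 @ (fst (swaps G L w j), j, snd (swaps G L w j)) # L2 \<and>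
      fst (swaps G L w j) \<notin> fst ` set L1
    else fst (swaps G L w j) \<in> insert j (set (idxs L))"
  using assms(1,3,4)
proof (induction L)
  case Nil
  then show ?case using assms by (auto simp: monomial_upto_def)
next
  case (Cons x L)
  obtain k i h where x: "x = (k, i, h)" by (cases x)
  have g: "good_swaps G m L" and k: "k \<le> m" "h \<in> carrier G" and i: "i > m" "i \<notin> set (idxs L)"
    using Cons.prems by (auto simp: x good_swaps_Cons)
  let ?f = "swaps G L w" and ?f' = "swaps G (x # L) w"
  show ?case
  proof (cases "j = i")
    case True
    have "?f' j = (k, h)" unfolding True x
      using Cons.prems i assms(2) by (intro swaps_head[of m]) (auto simp: x)
    then show ?thesis using k(1) True
      by (simp only: fst_conv snd_conv if_True) (intro exI[of _ "[]"] exI[of _ L], simp add: x)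
  next
    case False
    have c: "snd (?f j) \<in> carrier G"
      using swaps_closed[OF g, of w] assms(2) by (auto simp: monomial_upto_def monomial_carrier)
    note IH = Cons.IH[OF g] 
    show ?thesis
    proof (cases "fst (?f j) \<le> m")
      case True
      then obtain L1 L2 where L: "L = L1 @ (fst (?f j), j, snd (?f j)) # L2" "fst (?f j) \<notin> fst ` set L1"
        using IH Cons.prems by auto
      show ?thesis
      proof (cases "fst (?f j) = k")
        case True
        then have "fst (?f' j) = i" using k i by (auto simp: x swaps_Cons monomial_mult mon_swap_def)
        then show ?thesis using i by (simp add: x)
      next
        case False
        then have e: "?f' j = ?f j" using True i c
          by (auto simp: x swaps_Cons monomial_mult mon_swap_def prod_eq_iff)
        have "x # L = (x # L1) @ (fst (?f' j), j, snd (?f' j)) # L2 \<and> fst (?f' j) \<notin> fst ` set (x # L1)"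
          using L False unfolding e by (auto simp: x)
        then show ?thesis using True e by (metis (no_types, lifting))
      qed
    next
      case gt: False
      then have "fst (?f j) \<in> insert j (set (idxs L))" using IH Cons.prems by auto
      moreover from this have "fst (?f j) \<noteq> i" using i False by auto
      ultimately have "fst (?f' j) = fst (?f j)"
        using gt k by (auto simp: x swaps_Cons monomial_mult mon_swap_def)
      then show ?thesis using gt \<open>fst (?f j) \<in> insert j (set (idxs L))\<close> by auto
    qed
  qed
qed

text \<open>The head (k, i, h) of L is visible in column i, so \<open>swaps_trace\<close> finds it
  in L', not preceded by any triple with the same k. Since both lists are sorted and the roles can
  be exchanged, it is the head of L' as well, and \<open>mon_swap_cancel\<close> removes it from
  both sides.\<close>

lemma swaps_inject_distinct:
  assumes "good_swaps G m L" "good_swaps G m L'" "w \<in> monomial_upto G m" "w' \<in> monomial_upto G m"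
    and "distinct (idxs L)" "\<forall>i \<in> set (idxs L). i > m" "distinct (idxs L')" "\<forall>i \<in> set (idxs L'). i > m"
    and "sorted (map fst L)" "sorted (map fst L')" "length L = length L'"
    and "swaps G L w = swaps G L' w'"
  shows "L = L' \<and> w = w'"
  using assms(1,2,5-)
proof (induction L arbitrary: L')
  case (Cons x M)
  from \<open>length (x # M) = length L'\<close> obtain x' M' where L': "L' = x' # M'" by (cases L') auto
  obtain k i h where x: "x = (k, i, h)" by (cases x)
  obtain k' i' h' where x': "x' = (k', i', h')" by (cases x')
  have key: "\<exists>L1 L2. B = L1 @ (k, i, h) # L2 \<and> k \<notin> fst ` set L1"
    if "good_swaps G m ((k, i, h) # A)" "good_swaps G m B" "u \<in> monomial_upto G m" "v \<in> monomial_upto G m"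
      "i > m" "i \<notin> set (idxs A)" "distinct (idxs B)" "\<forall>i \<in> set (idxs B). i > m"
      "swaps G ((k, i, h) # A) u = swaps G B v" for k i h A B u v
  proof -
    have "swaps G B v i = (k, h)" using swaps_head[of m k i h A u] that by metis
    moreover have "k \<le> m" using that by (auto simp: good_swaps_Cons)
    ultimately show ?thesis using swaps_trace[of m B v i] that by auto
  qed
  have kk: "k \<in> fst ` set L'" if "L' = L1 @ (k, i, h) # L2" for L' :: "(nat \<times> nat \<times> 'g) list" and L1 k i h L2
    using that by force
  obtain L1 L2 where 1: "L' = L1 @ (k, i, h) # L2" "k \<notin> fst ` set L1"
    using key[of k i h M L' w w'] Cons.prems assms(3,4) by (auto simp: x)
  obtain K1 K2 where 2: "x # M = K1 @ (k', i', h') # K2" "k' \<notin> fst ` set K1"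
    using key[of k' i' h' M' "x # M" w' w] Cons.prems assms(3,4) by (auto simp: x' L')
  \<comment> \<open>Sortedness makes the head of either list minimal, hence k = k'. A nonempty
    \<open>L1\<close> would then begin with a triple of first index k.\<close>
  have "k' \<le> k" using kk[OF 1(1)] Cons.prems by (auto simp: L' x')
  moreover have "k \<le> k'" using kk[OF 2(1)] Cons.prems by (auto simp: x)
  ultimately have "k = k'" by simp
  then have "L1 = []" using 1 by (cases L1) (auto simp: L' x')
  then have xx: "x' = x" "M' = L2" using 1 by (auto simp: L' x)
  have g: "good_swaps G m M" "good_swaps G m M'" and ki: "k \<noteq> i" "h \<in> carrier G"
    using Cons.prems by (auto simp: L' xx x good_swaps_Cons)
  have "mon_swap G k i h \<cdot> swaps G M w = mon_swap G k i h \<cdot> swaps G M' w'"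
    using Cons.prems(10) unfolding L' xx(1) unfolding x swaps_Cons .
  then have "swaps G M w = swaps G M' w'"
    using mon_swap_cancel[OF ki] swaps_closed[OF g(1)] swaps_closed[OF g(2)] assms(3,4)
    by (metis (no_types, lifting) monomial_upto_def mem_Collect_eq)
  then have "M = M' \<and> w = w'" using Cons.prems g by (intro Cons.IH) (auto simp: L')
  then show ?case by (simp add: L' xx)
qed auto

text \<open>The indices above \<open>m\<close> moved by the left-hand side are exactly its \<open>length L\<close> swapped indices, so
  the shorter right-hand side has to use the same ones, each of them once.\<close>

lemma swaps_inject:
  assumes "good_swaps G m L" "good_swaps G m L'" "w \<in> monomial_upto G m" "w' \<in> monomial_upto G m"
    and "distinct (idxs L)" "\<forall>i \<in> set (idxs L). i > m"
    and "sorted (map fst L)" "sorted (map fst L')" "length L' \<le> length L"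
    and "swaps G L w = swaps G L' w'"
  shows "L = L' \<and> w = w'"
proof -
  have sub: "set (idxs L) \<subseteq> set (idxs L')"
  proof
    fix j assume j: "j \<in> set (idxs L)"
    show "j \<in> set (idxs L')"
      using swaps_moves[OF assms(1,3,5,6) j] swaps_fixes[OF assms(2,4), of j] assms(6,10) j by auto
  qed
  have c: "card (set (idxs L)) = length L" using distinct_card[OF assms(5)] by simp
  have "card (set (idxs L)) \<le> card (set (idxs L'))" using sub by (intro card_mono) auto
  moreover have "card (set (idxs L')) \<le> length L'" using card_length[of "idxs L'"] by simp
  ultimately have e: "card (set (idxs L')) = length L'" "length L = length L'"
    using c assms(9) by auto
  then have "distinct (idxs L')" using card_distinct[of "idxs L'"] by simp
  moreover have "set (idxs L) = set (idxs L')" using sub c e by (intro card_subset_eq) auto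
  ultimately show ?thesis using assms e by (intro swaps_inject_distinct) auto
qed

text \<open>For each swap s the equation s z = \<gamma> has the single solution z = s
  \<gamma>.\<close>

lemma jm_mult_eval:
  assumes \<beta>: "\<beta> \<in> carrier (mon_alg G)" and \<gamma>: "\<gamma> \<in> carrier (monomial G)"
  shows "(jm G n k \<star> \<beta>) \<gamma>
    = (\<Sum>i\<in>{k+1..n}. \<Sum>h\<in>carrier G. \<beta> (mon_swap G k i h \<cdot> \<gamma>))"
proof -
  have f: "finite (supp \<beta>)" and s: "supp \<beta> \<subseteq> carrier (monomial G)" using \<beta> by (auto simp: ma_carrier)
  have "pairing \<beta> (\<lambda>z. if mon_swap G k i h \<cdot> z = \<gamma> then 1 else 0)
     = \<beta> (mon_swap G k i h \<cdot> \<gamma>)" if "i \<in> {k+1..n}" "h \<in> carrier G" for i h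
  proof -
    have ki: "k \<noteq> i" using that by auto
    have "pairing \<beta> (\<lambda>z. if mon_swap G k i h \<cdot> z = \<gamma> then 1 else 0)
      = pairing \<beta> (\<lambda>z. if z = mon_swap G k i h \<cdot> \<gamma> then 1 else 0)"
      using s mon_swap_cancel[OF ki that(2)] \<gamma> by (intro pairing_cong) (metis subsetD)
    then show ?thesis using pairing_eval[OF f] by simp
  qed
  then show ?thesis by (simp add: ma_mult f pairing_jm)
qed

lemma jm_prod_closed:
  "w \<in> carrier (monomial G) \<Longrightarrow> (jm_prod G n ks w :: _ \<Rightarrow> 'f::field) \<in> carrier (mon_alg G)"
proof (induction ks)
  case Nil
  then show ?case by (simp add: jm_prod_def basis_closed)
next
  case (Cons k ks)
  interpret B: ring "mon_alg G :: ('f, _) module" by (rule mon_alg_ring)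
  show ?case using Cons B.m_closed[OF jm_closed] by (simp add: jm_prod_def)
qed

lemma jm_prod_Cons_eval:
  assumes "w \<in> carrier (monomial G)" "\<gamma> \<in> carrier (monomial G)"
  shows "jm_prod G n (k # ks) w \<gamma>
    = (\<Sum>i\<in>{k+1..n}. \<Sum>h\<in>carrier G. jm_prod G n ks w (mon_swap G k i h \<cdot> \<gamma>))"
  using jm_mult_eval[OF jm_prod_closed[OF assms(1)] assms(2)] by (simp add: jm_prod_def)

text \<open>On expanding the product, some choice of one swap from every factor must produce
  \<gamma>.\<close>

lemma jm_prod_nonzero:
  assumes "ks \<in> lists {..m}" "w \<in> carrier (monomial G)" "\<gamma> \<in> carrier (monomial G)"
    and "jm_prod G n ks w \<gamma> \<noteq> (0::'f::field)"
  shows "\<exists>L. map fst L = ks \<and> good_swaps G m L \<and> \<gamma> = swaps G L w"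
  using assms(1,3,4)
proof (induction ks arbitrary: \<gamma>)
  case Nil
  then show ?case by (auto simp: jm_prod_def basis_apply good_swaps_def split: if_splits)
next
  case (Cons k ks)
  have "(\<Sum>i\<in>{k+1..n}. \<Sum>h\<in>carrier G. jm_prod G n ks w (mon_swap G k i h \<cdot> \<gamma>)) \<noteq> (0::'f)"
    using Cons.prems jm_prod_Cons_eval[OF assms(2)] by metis
  then obtain i where i: "i \<in> {k+1..n}"
    "(\<Sum>h\<in>carrier G. jm_prod G n ks w (mon_swap G k i h \<cdot> \<gamma>)) \<noteq> (0::'f)"
    by (rule sum.not_neutral_contains_not_neutral)
  then obtain h where h: "h \<in> carrier G" "jm_prod G n ks w (mon_swap G k i h \<cdot> \<gamma>) \<noteq> (0::'f)"
    by (auto elim: sum.not_neutral_contains_not_neutral)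
  obtain L where L: "map fst L = ks" "good_swaps G m L" "mon_swap G k i h \<cdot> \<gamma> = swaps G L w"
    using Cons.IH[OF _ h(2)] h(1) Cons.prems M.m_closed mon_swap_closed by blast
  have "\<gamma> = swaps G ((k, i, h) # L) w"
    using mon_swap_cancel[of k i h \<gamma>] i h Cons.prems L(3) by (simp add: swaps_Cons)
  moreover have "good_swaps G m ((k, i, h) # L)" using L i h Cons by (auto simp: good_swaps_Cons)
  ultimately show ?case using L by (intro exI[of _ "(k, i, h) # L"]) simp
qed

text \<open>Of the choices i', h' in the first factor only those of the given list contribute,
  because any other would lead to a second list of swaps with the same product. The coefficient is
  thus 1 in every characteristic.\<close>

lemma jm_prod_swaps_eq_1:
  assumes "good_swaps G m L" "w \<in> monomial_upto G m" "distinct (idxs L)" "\<forall>i \<in> set (idxs L). m < i \<and> i \<le> n"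
    and "sorted (map fst L)"
  shows "jm_prod G n (map fst L) w (swaps G L w) = (1::'f::field)"
  using assms(1,3-)
proof (induction L)
  case Nil
  then show ?case by (simp add: jm_prod_def basis_apply)
next
  case (Cons x L)
  obtain k i h where x: "x = (k, i, h)" by (cases x)
  have g: "good_swaps G m L" and kih: "k \<le> m" "k < i" "h \<in> carrier G" "i \<le> n"
    using Cons.prems by (auto simp: x good_swaps_Cons)
  have w: "w \<in> carrier (monomial G)" using assms(2) by (simp add: monomial_upto_def)
  let ?\<gamma> = "swaps G (x # L) w"
  have \<gamma>: "?\<gamma> \<in> carrier (monomial G)" using swaps_closed[OF Cons.prems(1) w] .
  have ks: "map fst L \<in> lists {..m}" using g by (rule good_swaps_fst)
  have "jm_prod G n (map fst L) w (mon_swap G k i' h' \<cdot> ?\<gamma>)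
     = (if i' = i \<and> h' = h then 1 else (0::'f))" if ih: "i' \<in> {k+1..n}" "h' \<in> carrier G" for i' h'
  proof (cases "i' = i \<and> h' = h")
    case True
    then have "mon_swap G k i' h' \<cdot> ?\<gamma> = swaps G L w"
      using mon_swap_cancel[of k i h "swaps G L w"] kih swaps_closed[OF g w] by (simp add: x swaps_Cons)
    then show ?thesis using True Cons g by simp
  next
    case False
    have "\<not> jm_prod G n (map fst L) w (mon_swap G k i' h' \<cdot> ?\<gamma>) \<noteq> (0::'f)"
    proof
      assume "jm_prod G n (map fst L) w (mon_swap G k i' h' \<cdot> ?\<gamma>) \<noteq> (0::'f)"
      then obtain L' where L': "map fst L' = map fst L" "good_swaps G m L'"
        "mon_swap G k i' h' \<cdot> ?\<gamma> = swaps G L' w"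
        using jm_prod_nonzero[OF ks w] \<gamma> ih M.m_closed mon_swap_closed by metis
      have "?\<gamma> = swaps G ((k, i', h') # L') w"
        using mon_swap_cancel[of k i' h' ?\<gamma>] ih \<gamma> L'(3) by (simp add: swaps_Cons)
      moreover have "good_swaps G m ((k, i', h') # L')" using L' ih kih by (auto simp: good_swaps_Cons)
      moreover have "length L' = length L" using map_eq_imp_length_eq[OF L'(1)] .
      ultimately have "x # L = (k, i', h') # L' \<and> w = w"
        using Cons.prems L' assms(2) by (intro swaps_inject[of m]) (auto simp: x)
      then show False using False by (auto simp: x)
    qed
    then show ?thesis using False by simp
  qed
  then have "jm_prod G n (map fst (x # L)) w ?\<gamma>
     = (\<Sum>i'\<in>{k+1..n}. \<Sum>h'\<in>carrier G. if i' = i \<and> h' = h then 1 else (0::'f))"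
    unfolding x list.map fst_conv jm_prod_Cons_eval[OF w \<gamma>[unfolded x]] by (intro sum.cong refl) (auto simp: x)
  also have "\<dots> = (\<Sum>i'\<in>{k+1..n}. if i' = i then (\<Sum>h'\<in>carrier G. if h' = h then 1 else 0) else (0::'f))"
    by (intro sum.cong refl) auto
  also have "\<dots> = 1" using kih finite_G by simp
  finally show ?case .
qed

lemma mon_word_upto: "v \<in> lists (group_gens G m) \<Longrightarrow> mon_word G m v \<in> monomial_upto G m"
proof (induction v)
  case Nil
  then show ?case by (auto simp: monomial_upto_def monomial_one monomial_carrier)
next
  case (Cons a v)
  then have "mon_word G m (a # v) \<in> carrier (monomial G)" by (intro mon_word_closed) auto
  then show ?case using Cons by (auto simp: group_gens_def mon_word_GenG mon_word_GenS monomial_upto_def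
        monomial_mult mon_diag_def mon_perm_def transpose_def Gpow_carrier)
qed

end

definition jm_word :: "('g, 'b) monoid_scheme \<Rightarrow> nat \<Rightarrow> nat \<Rightarrow> 'g wgen list \<Rightarrow> (nat \<Rightarrow> nat \<times> 'g) \<Rightarrow> 'f::field" where
  "jm_word G m n = wreath_rep.word (mon_alg G) (\<lambda>g. basis_elt (mon_diag G m g))
     (\<lambda>i. basis_elt (mon_perm G (transpose i (i+1)))) (jm G n)"

context finite_group begin

lemma jm_word_mixed:
  assumes "m \<le> n" "v \<in> lists (group_gens G m)"
  shows "jm_word G m n (map GenX ks @ v) = (jm_prod G n ks (mon_word G m v) :: _ \<Rightarrow> 'f::field)"
proof -
  interpret W: wreath_rep "mon_alg G :: ('f, _) module" G m "\<lambda>g. basis_elt (mon_diag G m g)"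
    "\<lambda>i. basis_elt (mon_perm G (transpose i (i+1)))" "jm G n"
    by (rule mon_alg_wreath_rep[OF assms(1)])
  have "W.word v = basis_elt (mon_word G m v)"
    using assms(2) by (induction v)
      (auto simp: W.word_Cons group_gens_def ma_mult_basis mon_word_GenG mon_word_GenS ma_one simp del: One_nat_def)
  moreover have "W.word (map GenX ks @ v) = foldr (\<lambda>k \<beta>. jm G n k \<star> \<beta>) ks (W.word v)"
    by (induction ks) (simp_all only: list.map append_Nil append_Cons W.word_Cons gen_val.simps foldr.simps id_apply comp_apply)
  ultimately show ?thesis by (simp add: jm_word_def jm_prod_def)
qed

text \<open>A normal word \<open>x\<^sub>k\<^sub>1 \<dots> x\<^sub>k\<^sub>d v\<close> of maximal \<open>d\<close> in the support is detected, for \<open>n = m + d\<close>, by the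
  coefficient at the product of the transpositions of \<open>k\<^sub>p\<close> and the new index \<open>m + p\<close>.\<close>

lemma normal_words_independent:
  fixes a :: "'g wgen list \<Rightarrow> 'f::field"
  assumes V: "V \<subseteq> lists (group_gens G m)" "inj_on (mon_word G m) V"
    and fin: "finite (supp a)"
    and supp: "\<And>t. t \<in> supp a \<Longrightarrow> \<exists>ks v. t = map GenX ks @ v \<and> sorted ks \<and> ks \<in> lists {1..m} \<and> v \<in> V"
    and zero: "\<And>n. n \<ge> m \<Longrightarrow> ma_ext (jm_word G m n) a = (\<lambda>_. 0)"
  shows "a = (\<lambda>_. 0)"
proof (rule ccontr)
  assume "a \<noteq> (\<lambda>_. 0)"
  then have ne: "supp a \<noteq> {}" by (auto simp: supp_def)
  obtain kf vf where kv: "\<And>t. t \<in> supp a \<Longrightarrow>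
      t = map GenX (kf t) @ vf t \<and> sorted (kf t) \<and> kf t \<in> lists {1..m} \<and> vf t \<in> V"
    using supp by metis
  define d where "d = Max ((\<lambda>t. length (kf t)) ` supp a)"
  have "d \<in> (\<lambda>t. length (kf t)) ` supp a" unfolding d_def using fin ne by (intro Max_in) auto
  then obtain t where t: "t \<in> supp a" "d = length (kf t)" by auto
  have max: "length (kf t') \<le> d" if "t' \<in> supp a" for t'
    unfolding d_def using fin that by (intro Max_ge) auto
  define L where "L = zip (kf t) (map (\<lambda>i. (i, \<one>)) [m+1..<m+1+d])"
  have "idxs L = map fst (map snd L)" by simp
  also have "\<dots> = [m+1..<m+1+d]"
    unfolding L_def using t(2) by (simp only: map_snd_zip length_map length_upt add_diff_cancel_left') (simp add: comp_def)
  finally have L: "map fst L = kf t" "idxs L = [m+1..<m+1+d]"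
    by (simp_all add: L_def t(2) del: upt_Suc)
  have "good_swaps G m L"
    unfolding good_swaps_def
  proof clarify
    fix k i h assume "(k, i, h) \<in> set L"
    then have "k \<in> set (kf t)" "(i, h) \<in> set (map (\<lambda>i. (i, \<one>)) [m+1..<m+1+d])"
      unfolding L_def by (rule set_zip_leftD, rule set_zip_rightD)
    then show "k \<le> m \<and> k < i \<and> h \<in> carrier G" using kv[OF t(1)] by fastforce
  qed
  let ?w = "\<lambda>t. mon_word G m (vf t)"
  have v: "vf t' \<in> lists (group_gens G m)" if "t' \<in> supp a" for t'
    using kv[OF that] V(1) by blast
  have w: "?w t' \<in> monomial_upto G m" "?w t' \<in> carrier (monomial G)" if "t' \<in> supp a" for t'
    using v[OF that] by (rule mon_word_upto, rule mon_word_closed)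
  let ?\<gamma> = "swaps G L (?w t)"
  have \<gamma>: "?\<gamma> \<in> carrier (monomial G)" using \<open>good_swaps G m L\<close> w[OF t(1)] by (intro swaps_closed)
  have "jm_word G m (m + d) t' ?\<gamma> = (if t' = t then 1 else (0::'f))" if t': "t' \<in> supp a" for t'
  proof -
    have e: "jm_word G m (m + d) t' = (jm_prod G (m + d) (kf t') (?w t') :: _ \<Rightarrow> 'f)"
      using kv[OF t'] jm_word_mixed[OF le_add1 v[OF t']] by metis
    show ?thesis
    proof (cases "t' = t")
      case True
      have "jm_prod G (m + d) (map fst L) (?w t) ?\<gamma> = (1::'f)"
        using \<open>good_swaps G m L\<close> w[OF t(1)] kv[OF t(1)] L
        by (intro jm_prod_swaps_eq_1) auto
      then show ?thesis unfolding e L(1) using True by simp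
    next
      case False
      have "\<not> jm_prod G (m + d) (kf t') (?w t') ?\<gamma> \<noteq> (0::'f)"
      proof
        assume "jm_prod G (m + d) (kf t') (?w t') ?\<gamma> \<noteq> (0::'f)"
        moreover have "kf t' \<in> lists {..m}" using kv[OF t'] by auto
        ultimately obtain L' where L': "map fst L' = kf t'" "good_swaps G m L'" "?\<gamma> = swaps G L' (?w t')"
          using jm_prod_nonzero[OF _ w(2)[OF t'] \<gamma>] by blast
        have "length L' = length (kf t')" using L'(1) by (metis length_map)
        moreover have "length L = d" using L(1) t(2) by (metis length_map)
        \<comment> \<open>Here the maximality of d enters: \<open>swaps_inject\<close> requires the
          second list to be no longer than the first.\<close>
        ultimately have "L = L' \<and> ?w t = ?w t'"
          using L' L max[OF t'] kv[OF t'] kv[OF t(1)] w(1)[OF t'] w(1)[OF t(1)] \<open>good_swaps G m L\<close>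
          by (intro swaps_inject[of m]) auto
        then have "kf t' = kf t" "vf t' = vf t"
          using L L' kv[OF t'] kv[OF t(1)] inj_onD[OF V(2)] by auto
        then show False using False kv[OF t'] kv[OF t(1)] by metis
      qed
      then show ?thesis unfolding e using False by simp
    qed
  qed
  then have "ma_ext (jm_word G m (m + d)) a ?\<gamma> = pairing a (\<lambda>t'. if t' = t then 1 else 0)"
    unfolding ma_ext_def by (rule pairing_cong)
  then have "a t = 0" using zero[of "m + d"] pairing_eval[OF fin] by simp
  then show False using t(1) by (simp add: supp_def)
qed

end

section \<open>The wreath Hecke algebra\<close>

lemma free_monoid_simps [simp]:
  "carrier (free_monoid T) = lists T" "u \<otimes>\<^bsub>free_monoid T\<^esub> v = u @ v" "\<one>\<^bsub>free_monoid T\<^esub> = []"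
  by (simp_all add: free_monoid_def)

lemma free_alg_ring: "ring (free_alg T :: ('f::field, 'a list \<Rightarrow> 'f) module)"
  by (rule ma_ring, rule monoidI) auto

lemma letter_closed: "a \<in> T \<Longrightarrow> letter a \<in> carrier (free_alg T)"
  by (simp add: basis_closed)

lemma wgens_iff [simp]:
  "GenG g \<in> wgens G m \<longleftrightarrow> g \<in> carrier (Gpow G m)" "GenS i \<in> wgens G m \<longleftrightarrow> i \<in> {1..<m}"
  "GenX k \<in> wgens G m \<longleftrightarrow> k \<in> {1..m}"
  by (auto simp: wgens_def)

lemma ball_image1: "(\<forall>r \<in> {f x | x. P x}. Q r) \<longleftrightarrow> (\<forall>x. P x \<longrightarrow> Q (f x))"
  and ball_image2: "(\<forall>r \<in> {g x y | x y. R x y}. Q r) \<longleftrightarrow> (\<forall>x y. R x y \<longrightarrow> Q (g x y))"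
  by blast+

lemma (in ring_hom_ring) hom_finsum_add:
  "finite J \<Longrightarrow> (\<And>j. j \<in> J \<Longrightarrow> f j \<in> carrier R) \<Longrightarrow> h (finsum R f J) = (\<Oplus>\<^bsub>S\<^esub>j\<in>J. h (f j))"
proof (induction J rule: finite_induct)
  case (insert j J)
  then have "finsum R f J \<in> carrier R" by (intro R.finsum_closed) auto
  with insert show ?case by (simp add: Pi_iff)
qed simp

text \<open>Translates the relations, which are differences in the free algebra, into the equations
  of \<open>wreath_rep\<close>.\<close>

lemma (in ring_hom_ring) hom_minus_eq_zero:
  "a \<in> carrier R \<Longrightarrow> b \<in> carrier R \<Longrightarrow> h (a \<ominus> b) = \<zero>\<^bsub>S\<^esub> \<longleftrightarrow> h a = h b"
  unfolding R.minus_eq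
  by (auto simp: S.r_neg) (metis S.minus_equality S.minus_minus S.a_inv_closed hom_closed)

lemma gen_closed:
  assumes "group G"
  shows "\<one>\<^bsub>Gpow G m\<^esub> \<in> carrier (Gpow G m)"
    "g \<in> carrier (Gpow G m) \<Longrightarrow> h \<in> carrier (Gpow G m) \<Longrightarrow> g \<otimes>\<^bsub>Gpow G m\<^esub> h \<in> carrier (Gpow G m)"
    "i \<in> {1..<m} \<Longrightarrow> g \<in> carrier (Gpow G m) \<Longrightarrow>
      perm_act m (transpose i (i+1)) g \<in> carrier (Gpow G m)"
    "k \<in> {1..<m} \<Longrightarrow> k + 1 \<in> {1..m}" "k \<in> {1..<m} \<Longrightarrow> k \<in> {1..m}"
proof -
  interpret group G by fact
  show "\<one>\<^bsub>Gpow G m\<^esub> \<in> carrier (Gpow G m)" by (auto simp: Gpow_one Gpow_carrier)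
  show "g \<otimes>\<^bsub>Gpow G m\<^esub> h \<in> carrier (Gpow G m)" if "g \<in> carrier (Gpow G m)" "h \<in> carrier (Gpow G m)"
    using that by (auto simp: Gpow_mult Gpow_carrier)
  show "perm_act m (transpose i (i+1)) g \<in> carrier (Gpow G m)" if "i \<in> {1..<m}" "g \<in> carrier (Gpow G m)"
    using that by (rule perm_act_closed)
qed auto

lemma gen_letter_closed:
  "g \<in> carrier (Gpow G m) \<Longrightarrow> letter (GenG g) \<in> carrier (free_alg (wgens G m))"
  "i \<in> {1..<m} \<Longrightarrow> letter (GenS i) \<in> carrier (free_alg (wgens G m))"
  "k \<in> {1..m} \<Longrightarrow> letter (GenX k) \<in> carrier (free_alg (wgens G m))"
  by (simp_all add: letter_closed del: One_nat_def)

text \<open>The axioms mention E, S and X only at arguments that occur as generators, including the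
  \<open>at_pos\<close> elements inside t_{k,k+1}. The evaluation of a letter is known to be the
  intended matrix or \<open>jm\<close> only for those.\<close>

lemma wreath_rep_cong:
  assumes "wreath_rep R G m E S X"
    and "\<And>a. a \<in> wgens G m \<Longrightarrow> gen_val E' S' X' a = gen_val E S X a"
  shows "wreath_rep R G m E' S' X'"
proof -
  interpret W: wreath_rep R G m E S X by fact
  have e: "E' g = E g" if "g \<in> carrier (Gpow G m)" for g using assms(2)[of "GenG g"] that by simp
  have s: "S' i = S i" if "i \<in> {1..<m}" for i using assms(2)[of "GenS i"] that by (simp del: One_nat_def)
  have x: "X' k = X k" if "k \<in> {1..m}" for k using assms(2)[of "GenX k"] that by (simp del: One_nat_def)
  have t: "(\<Oplus>\<^bsub>R\<^esub>h\<in>carrier G. E' (at_pos G m k h) \<otimes>\<^bsub>R\<^esub> E' (at_pos G m l (inv\<^bsub>G\<^esub> h)))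
    = (\<Oplus>\<^bsub>R\<^esub>h\<in>carrier G. E (at_pos G m k h) \<otimes>\<^bsub>R\<^esub> E (at_pos G m l (inv\<^bsub>G\<^esub> h)))" for k l
    by (intro W.R.finsum_cong') (auto simp: e at_pos_closed W.G.group_axioms W.E_closed)
  note gc = gen_closed[OF W.G.group_axioms]
  show ?thesis
    using assms(1) unfolding wreath_rep_def wreath_rep_axioms_def
    by (simp add: e s x gc t
        del: One_nat_def add_2_eq_Suc' atLeastLessThan_iff atLeastAtMost_iff)
qed

context finite_group begin

text \<open>Used in both directions: for the quotient map it makes the quotient a
  \<open>wreath_rep\<close>, to which spanning applies; for the evaluation at level n it shows that
  the relations are killed.\<close>

lemma hecke_rels_vanish_iff:
  fixes \<phi> :: "('g wgen list \<Rightarrow> 'f::field) \<Rightarrow> 'r" and R :: "('r, 's) ring_scheme"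
  assumes "ring_hom_ring (free_alg (wgens G m)) R \<phi>"
  shows "(\<forall>r \<in> wreath_Hecke_rels G m. \<phi> r = \<zero>\<^bsub>R\<^esub>) \<longleftrightarrow>
    wreath_rep R G m (\<lambda>g. \<phi> (letter (GenG g))) (\<lambda>i. \<phi> (letter (GenS i))) (\<lambda>k. \<phi> (letter (GenX k)))"
proof -
  let ?A = "free_alg (wgens G m) :: ('f, 'g wgen list \<Rightarrow> 'f) module"
  interpret A: ring ?A by (rule free_alg_ring)
  interpret h: ring_hom_ring ?A R \<phi> by fact
  have e: "letter (GenG g) \<in> carrier ?A" if "g \<in> carrier (Gpow G m)" for g
    using that by (rule gen_letter_closed(1))
  note gc = gen_closed[OF group_axioms]
  have at: "at_pos G m k h \<in> carrier (Gpow G m)" if "h \<in> carrier G" for k h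
    using that by (intro at_pos_closed group_axioms)
  have t: "t_elt ?A (\<lambda>g. letter (GenG g)) G m k l \<in> carrier ?A" for k l
    unfolding t_elt_def using at e by (intro A.finsum_closed) auto
  have ht: "\<phi> (t_elt ?A (\<lambda>g. letter (GenG g)) G m k l) = (\<Oplus>\<^bsub>R\<^esub>h\<in>carrier G.
      \<phi> (letter (GenG (at_pos G m k h))) \<otimes>\<^bsub>R\<^esub> \<phi> (letter (GenG (at_pos G m l (inv h)))))" for k l
  proof -
    have "\<phi> (t_elt ?A (\<lambda>g. letter (GenG g)) G m k l) = (\<Oplus>\<^bsub>R\<^esub>h\<in>carrier G.
      \<phi> (letter (GenG (at_pos G m k h)) \<otimes>\<^bsub>?A\<^esub> letter (GenG (at_pos G m l (inv h)))))"
      unfolding t_elt_def using at e by (intro h.hom_finsum_add finite_G) auto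
    also have "\<dots> = (\<Oplus>\<^bsub>R\<^esub>h\<in>carrier G.
      \<phi> (letter (GenG (at_pos G m k h))) \<otimes>\<^bsub>R\<^esub> \<phi> (letter (GenG (at_pos G m l (inv h)))))"
      using at e by (intro h.S.finsum_cong') auto
    finally show ?thesis .
  qed
  show ?thesis
    unfolding wreath_Hecke_rels_def Let_def ball_Un ball_image1 ball_image2 wreath_rep_def wreath_rep_axioms_def
    by (simp add: h.S.ring_axioms finite_G h.hom_minus_eq_zero gen_letter_closed gc t ht del: One_nat_def add_2_eq_Suc' atLeastLessThan_iff atLeastAtMost_iff) blast
qed

lemma hecke_rels_closed:
  "wreath_Hecke_rels G m \<subseteq> carrier (free_alg (wgens G m) :: ('f::field, _) module)"
proof -
  let ?A = "free_alg (wgens G m) :: ('f, 'g wgen list \<Rightarrow> 'f) module"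
  interpret A: ring ?A by (rule free_alg_ring)
  have e: "letter (GenG g) \<in> carrier ?A" if "g \<in> carrier (Gpow G m)" for g
    using that by (rule gen_letter_closed(1))
  have t: "t_elt ?A (\<lambda>g. letter (GenG g)) G m k l \<in> carrier ?A" for k l
    unfolding t_elt_def using e at_pos_closed[OF group_axioms] by (intro A.finsum_closed) auto
  note gc = gen_closed[OF group_axioms]
  have "\<forall>r \<in> wreath_Hecke_rels G m. r \<in> carrier ?A"
    unfolding wreath_Hecke_rels_def Let_def ball_Un ball_image1 ball_image2
    by (simp add: gen_letter_closed gc t
        del: One_nat_def add_2_eq_Suc' atLeastLessThan_iff atLeastAtMost_iff)
  then show ?thesis by blast
qed

lemma jm_eval_hom:
  assumes "m \<le> n"
  shows "ring_hom_ring (free_alg (wgens G m) :: ('f::field, _) module) (mon_alg G) (ma_ext (jm_word G m n))"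
    and "wreath_rep (mon_alg G :: ('f, _) module) G m (\<lambda>g. ma_ext (jm_word G m n) (letter (GenG g)))
      (\<lambda>i. ma_ext (jm_word G m n) (letter (GenS i))) (\<lambda>k. ma_ext (jm_word G m n) (letter (GenX k)))"
proof -
  interpret W: wreath_rep "mon_alg G :: ('f, _) module" G m "\<lambda>g. basis_elt (mon_diag G m g)"
    "\<lambda>i. basis_elt (mon_perm G (transpose i (i+1)))" "jm G n"
    by (rule mon_alg_wreath_rep[OF assms])
  let ?A = "free_alg (wgens G m) :: ('f, 'g wgen list \<Rightarrow> 'f) module"
  have w: "jm_word G m n = W.word" by (simp only: jm_word_def)
  have c: "jm_word G m n u \<in> carrier (mon_alg G :: ('f, _) module)" if "u \<in> lists (wgens G m)" for u
    unfolding w using that by (rule W.word_closed)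
  have app: "jm_word G m n (u @ v) = (jm_word G m n u \<star> jm_word G m n v :: _ \<Rightarrow> 'f)"
    if "u \<in> lists (wgens G m)" "v \<in> lists (wgens G m)" for u v
    unfolding w using that by (rule W.word_append)
  show "ring_hom_ring ?A (mon_alg G) (ma_ext (jm_word G m n))"
  proof (rule ring_hom_ringI)
    show "ring ?A" by (rule free_alg_ring)
    show "ring (mon_alg G :: ('f, _) module)" by (rule mon_alg_ring)
    show "ma_ext (jm_word G m n) a \<in> carrier (mon_alg G)" if "a \<in> carrier ?A" for a
      using that c by (rule ma_ext_closed) simp
    show "ma_ext (jm_word G m n) (a \<otimes>\<^bsub>?A\<^esub> b) = ma_ext (jm_word G m n) a \<star> ma_ext (jm_word G m n) b"
      if "a \<in> carrier ?A" "b \<in> carrier ?A" for a b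
      using that app by (intro ma_ext_mult c) simp_all
    show "ma_ext (jm_word G m n) (a \<oplus>\<^bsub>?A\<^esub> b) = ma_ext (jm_word G m n) a \<oplus>\<^bsub>mon_alg G\<^esub> ma_ext (jm_word G m n) b"
      if "a \<in> carrier ?A" "b \<in> carrier ?A" for a b
      using that by (intro ma_ext_add) (auto simp: ma_carrier)
    show "ma_ext (jm_word G m n) \<one>\<^bsub>?A\<^esub> = \<one>\<^bsub>mon_alg G\<^esub>"
      unfolding ma_one[of "free_monoid (wgens G m)"] ma_ext_basis w free_monoid_simps by (rule W.word_Nil)
  qed
  have "gen_val (\<lambda>g. ma_ext (jm_word G m n) (letter (GenG g))) (\<lambda>i. ma_ext (jm_word G m n) (letter (GenS i)))
    (\<lambda>k. ma_ext (jm_word G m n) (letter (GenX k))) a = W.word [a]" for a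
    by (cases a) (simp_all add: w)
  moreover have "W.word [a] = gen_val (\<lambda>g. basis_elt (mon_diag G m g))
    (\<lambda>i. basis_elt (mon_perm G (transpose i (i+1)))) (jm G n) a" if "a \<in> wgens G m" for a
    unfolding W.word_Cons W.word_Nil using that by (intro W.R.r_one W.gen_val_closed)
  ultimately show "wreath_rep (mon_alg G :: ('f, _) module) G m (\<lambda>g. ma_ext (jm_word G m n) (letter (GenG g)))
      (\<lambda>i. ma_ext (jm_word G m n) (letter (GenS i))) (\<lambda>k. ma_ext (jm_word G m n) (letter (GenX k)))"
    by (intro wreath_rep_cong[OF W.wreath_rep_axioms]) simp
qed

section \<open>The ideal of relations as the common kernel of the evaluations\<close>

lemma hecke_ideal:
  "ideal (wreath_Hecke_ideal G m) (free_alg (wgens G m) :: ('f::field, _) module)"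
  and hecke_rels_subset_ideal: "wreath_Hecke_rels G m \<subseteq> (wreath_Hecke_ideal G m :: ('g wgen list \<Rightarrow> 'f) set)"
  unfolding wreath_Hecke_ideal_def
  using ring.genideal_ideal[OF free_alg_ring hecke_rels_closed] ring.genideal_self[OF free_alg_ring hecke_rels_closed]
  by blast+

lemma hecke_ideal_eval_zero:
  fixes a :: "'g wgen list \<Rightarrow> 'f::field"
  assumes "m \<le> n" "a \<in> wreath_Hecke_ideal G m"
  shows "ma_ext (jm_word G m n) a = (\<lambda>_. 0)"
proof -
  let ?A = "free_alg (wgens G m) :: ('f, 'g wgen list \<Rightarrow> 'f) module"
  interpret h: ring_hom_ring ?A "mon_alg G :: ('f, _) module" "ma_ext (jm_word G m n)"
    by (rule jm_eval_hom[OF assms(1)])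
  have "\<forall>r \<in> wreath_Hecke_rels G m. ma_ext (jm_word G m n) r = (\<zero>\<^bsub>mon_alg G\<^esub> :: _ \<Rightarrow> 'f)"
    by (rule iffD2[OF hecke_rels_vanish_iff[OF h.ring_hom_ring_axioms] jm_eval_hom(2)[OF assms(1)]])
  note van = this
  have "wreath_Hecke_rels G m \<subseteq> a_kernel ?A (mon_alg G) (ma_ext (jm_word G m n))"
    unfolding a_kernel_def'
  proof (rule subsetI, rule CollectI, rule conjI)
    fix r :: "'g wgen list \<Rightarrow> 'f" assume r: "r \<in> wreath_Hecke_rels G m"
    show "r \<in> carrier ?A" using hecke_rels_closed r by (rule subsetD)
    show "ma_ext (jm_word G m n) r = \<zero>\<^bsub>mon_alg G\<^esub>" using van r by (rule bspec)
  qed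
  then have "wreath_Hecke_ideal G m \<subseteq> a_kernel ?A (mon_alg G) (ma_ext (jm_word G m n))"
    unfolding wreath_Hecke_ideal_def by (rule h.R.genideal_minimal[OF h.kernel_is_ideal])
  then have "a \<in> a_kernel ?A (mon_alg G) (ma_ext (jm_word G m n))" using assms(2) by (rule subsetD)
  then have "ma_ext (jm_word G m n) a = \<zero>\<^bsub>mon_alg G\<^esub>"
    unfolding a_kernel_def' by (elim CollectE conjE)
  then show ?thesis unfolding ma_zero .
qed

text \<open>One word per monomial matrix. By \<open>group_word_eq\<close> the choice does not matter
  modulo the relations, and it makes \<open>mon_word\<close> injective, as independence
  requires.\<close>

definition canonical_words :: "nat \<Rightarrow> 'g wgen list set" where
  "canonical_words m = (\<lambda>w. SOME v. v \<in> lists (group_gens G m) \<and> mon_word G m v = w) `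
     mon_word G m ` lists (group_gens G m)"

lemma canonical_words:
  "canonical_words m \<subseteq> lists (group_gens G m)" "inj_on (mon_word G m) (canonical_words m)"
  "v \<in> lists (group_gens G m) \<Longrightarrow> \<exists>v' \<in> canonical_words m. mon_word G m v' = mon_word G m v"
proof -
  let ?c = "\<lambda>w. SOME v. v \<in> lists (group_gens G m) \<and> mon_word G m v = w"
  have c: "?c w \<in> lists (group_gens G m) \<and> mon_word G m (?c w) = w"
    if "w \<in> mon_word G m ` lists (group_gens G m)" for w
    by (rule someI_ex[where P = "\<lambda>v. v \<in> lists (group_gens G m) \<and> mon_word G m v = w"])
      (use that in \<open>auto simp del: in_lists_conv_set\<close>)
  show "canonical_words m \<subseteq> lists (group_gens G m)"
    unfolding canonical_words_def by (rule image_subsetI) (rule conjunct1[OF c])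
  show "inj_on (mon_word G m) (canonical_words m)"
    unfolding canonical_words_def
  proof (rule inj_onI, elim imageE[where f = ?c])
      fix x y w w' assume e: "mon_word G m x = mon_word G m y" and x: "x = ?c w" and y: "y = ?c w'"
      and w: "w \<in> mon_word G m ` lists (group_gens G m)" "w' \<in> mon_word G m ` lists (group_gens G m)"
    have "w = w'" using e conjunct2[OF c[OF w(1)]] conjunct2[OF c[OF w(2)]] unfolding x y by simp
    then show "x = y" unfolding x y by simp
  qed
  show "\<exists>v' \<in> canonical_words m. mon_word G m v' = mon_word G m v" if v: "v \<in> lists (group_gens G m)"
    unfolding canonical_words_def
  proof (rule bexI)
    show "mon_word G m (?c (mon_word G m v)) = mon_word G m v" by (rule conjunct2[OF c[OF imageI[OF v]]])
  qed (intro imageI v)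
qed

definition normal_words :: "nat \<Rightarrow> 'g wgen list set" where
  "normal_words m = {map GenX ks @ v | ks v. sorted ks \<and> ks \<in> lists {1..m} \<and> v \<in> canonical_words m}"

lemma normal_words_subset: "normal_words m \<subseteq> lists (wgens G m)"
proof -
  have c: "v \<in> lists (wgens G m)" if "v \<in> canonical_words m" for v
  proof -
    have "group_gens G m \<subseteq> wgens G m" by (auto simp: group_gens_def wgens_def)
    then show ?thesis using subsetD[OF canonical_words(1) that] lists_mono by blast
  qed
  have "map GenX ks \<in> lists (wgens G m)" if "ks \<in> lists {1..m}" for ks
    using that by (auto simp: wgens_def)
  note ks = this
  show ?thesis
  proof
    fix t assume "t \<in> normal_words m"
    then obtain ks v where "t = map GenX ks @ v" "ks \<in> lists {1..m}" "v \<in> canonical_words m"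
      unfolding normal_words_def by blast
    then show "t \<in> lists (wgens G m)" using c ks by (simp only: append_in_lists_conv)
  qed
qed

text \<open>The quotient is a \<open>wreath_rep\<close>, so every word lies in its
  \<open>nspan\<close>. The elements there are cosets of combinations of normal words, since a group
  word may be replaced by the canonical one with the same matrix.\<close>

lemma normal_representative:
  fixes a :: "'g wgen list \<Rightarrow> 'f::field"
  assumes "a \<in> carrier (free_alg (wgens G m))"
  shows "\<exists>b \<in> carrier (free_alg (wgens G m)). supp b \<subseteq> normal_words m \<and>
    wreath_Hecke_ideal G m +>\<^bsub>free_alg (wgens G m)\<^esub> a = wreath_Hecke_ideal G m +>\<^bsub>free_alg (wgens G m)\<^esub> b"
proof -
  let ?A = "free_alg (wgens G m) :: ('f, 'g wgen list \<Rightarrow> 'f) module"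
  let ?I = "wreath_Hecke_ideal G m :: ('g wgen list \<Rightarrow> 'f) set"
  let ?q = "(+>\<^bsub>?A\<^esub>) ?I"
  interpret A: ring ?A by (rule free_alg_ring)
  interpret I: ideal ?I ?A by (rule hecke_ideal)
  interpret q: ring_hom_ring ?A "?A Quot ?I" ?q by (rule I.rcos_ring_hom_ring)
  let ?N = "{b \<in> carrier ?A. supp b \<subseteq> normal_words m}"
  have N_zero: "\<zero>\<^bsub>?A\<^esub> \<in> ?N"
    using A.zero_closed by (simp add: ma_zero)
  have N_add: "b \<oplus>\<^bsub>?A\<^esub> b' \<in> ?N" if "b \<in> ?N" "b' \<in> ?N" for b b'
    using that supp_add[of b b'] A.a_closed[of b b'] by (auto simp: ma_add)
  have N_smult: "c \<odot>\<^bsub>?A\<^esub> b \<in> ?N" if "b \<in> ?N" for c b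
    using that supp_smult[of c b] ma_smult_closed[of b "free_monoid (wgens G m)" c] by (auto simp: ma_smult)
  have N_neg: "\<ominus>\<^bsub>?A\<^esub> b \<in> ?N" if "b \<in> ?N" for b
  proof -
    have "\<ominus>\<^bsub>?A\<^esub> b = (-1) \<odot>\<^bsub>?A\<^esub> b"
      using that N_smult[OF that, of "-1"] by (intro A.minus_equality) (auto simp: ma_add ma_zero ma_smult)
    then show ?thesis using N_smult[OF that] by simp
  qed
  have "\<forall>r \<in> wreath_Hecke_rels G m. ?q r = \<zero>\<^bsub>?A Quot ?I\<^esub>"
  proof
    fix r :: "'g wgen list \<Rightarrow> 'f" assume "r \<in> wreath_Hecke_rels G m"
    then have "r \<in> ?I" by (rule subsetD[OF hecke_rels_subset_ideal])
    then have "?q r = ?I" by (rule A.a_rcos_zero[OF hecke_ideal])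
    then show "?q r = \<zero>\<^bsub>?A Quot ?I\<^esub>" unfolding FactRing_def by simp
  qed
  then have "wreath_rep (?A Quot ?I) G m (\<lambda>g. ?q (letter (GenG g))) (\<lambda>i. ?q (letter (GenS i))) (\<lambda>k. ?q (letter (GenX k)))"
    by (rule iffD1[OF hecke_rels_vanish_iff[OF q.ring_hom_ring_axioms]])
  then interpret W: wreath_rep "?A Quot ?I" G m "\<lambda>g. ?q (letter (GenG g))" "\<lambda>i. ?q (letter (GenS i))"
    "\<lambda>k. ?q (letter (GenX k))" .
  have word: "W.word u = ?q (basis_elt u)" if "u \<in> lists (wgens G m)" for u
    using that
  proof (induction u)
    case Nil
    then show ?case using q.hom_one by (simp add: ma_one)
  next
    case (Cons a u)
    have "gen_val (\<lambda>g. ?q (letter (GenG g))) (\<lambda>i. ?q (letter (GenS i))) (\<lambda>k. ?q (letter (GenX k))) a = ?q (letter a)"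
      by (cases a) auto
    moreover have "(basis_elt (a # u) :: _ \<Rightarrow> 'f) = letter a \<otimes>\<^bsub>?A\<^esub> basis_elt u" by (simp add: ma_mult_basis)
    moreover have "letter a \<in> carrier ?A" using Cons.hyps(1) by (rule letter_closed)
    moreover have "basis_elt u \<in> carrier ?A" using Cons.hyps(2) by (intro basis_closed) simp
    ultimately show ?case unfolding W.word_Cons Cons.IH by (simp only: q.hom_mult)
  qed
  have nspan: "y \<in> ?q ` ?N" if "y \<in> W.nspan" for y
    using that
  proof (induction rule: W.nspan.induct)
    case (base ks v)
    obtain v' where v': "v' \<in> canonical_words m" "mon_word G m v' = mon_word G m v"
      using canonical_words(3)[OF base(3)] by blast
    have gv': "v' \<in> lists (group_gens G m)" using v' canonical_words(1) by blast
    have l: "map GenX ks \<in> lists (wgens G m)" "v \<in> lists (wgens G m)" "v' \<in> lists (wgens G m)"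
      using W.mixed_closed[OF base(2), of "[]"] W.mixed_closed[OF _ base(3), of "[]"] W.mixed_closed[OF _ gv', of "[]"]
      by simp_all
    have n: "map GenX ks @ v' \<in> normal_words m" using base v' by (auto simp: normal_words_def)
    have "W.word (map GenX ks @ v) = W.word (map GenX ks @ v')"
      unfolding W.word_append[OF l(1,2)] W.word_append[OF l(1,3)] W.group_word_eq[OF base(3) gv' v'(2)[symmetric]] ..
    also have "\<dots> = ?q (basis_elt (map GenX ks @ v'))" using n normal_words_subset by (intro word) blast
    finally have e: "W.word (map GenX ks @ v) = ?q (basis_elt (map GenX ks @ v'))" .
    have "map GenX ks @ v' \<in> carrier (free_monoid (wgens G m))"
      unfolding free_monoid_simps by (rule subsetD[OF normal_words_subset n])
    then have "(basis_elt (map GenX ks @ v') :: _ \<Rightarrow> 'f) \<in> ?N" using n by (simp add: basis_closed)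
    then show ?case unfolding e by (rule imageI)
  next
    case zero
    show ?case unfolding q.hom_zero[symmetric] by (rule imageI[OF N_zero])
  next
    case (add x y)
    from add.IH(1) obtain b where b: "x = ?q b" "b \<in> ?N" by (rule imageE)
    from add.IH(2) obtain b' where b': "y = ?q b'" "b' \<in> ?N" by (rule imageE)
    have "b \<in> carrier ?A" "b' \<in> carrier ?A" using b(2) b'(2) by simp_all
    note e = q.hom_add[OF this]
    show ?case unfolding b(1) b'(1) e[symmetric] by (rule imageI[OF N_add[OF b(2) b'(2)]])
  next
    case (neg x)
    from neg.IH obtain b where b: "x = ?q b" "b \<in> ?N" by (rule imageE)
    then have "b \<in> carrier ?A" by simp
    note e = q.hom_a_inv[OF this]
    show ?case unfolding b(1) e[symmetric] by (rule imageI[OF N_neg[OF b(2)]])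
  qed
  have "?q a \<in> ?q ` ?N"
    using assms
  proof (rule ma_span[where P = "\<lambda>a. ?q a \<in> ?q ` ?N"])
    show "?q (\<lambda>x. 0) \<in> ?q ` ?N" using N_zero unfolding ma_zero by blast
  next
    fix a b :: "'g wgen list \<Rightarrow> 'f"
    assume ab: "a \<in> carrier ?A" "b \<in> carrier ?A" "?q a \<in> ?q ` ?N" "?q b \<in> ?q ` ?N"
    from ab(3) obtain a' where a': "?q a = ?q a'" "a' \<in> ?N" by (rule imageE)
    from ab(4) obtain b' where b': "?q b = ?q b'" "b' \<in> ?N" by (rule imageE)
    have "a' \<in> carrier ?A" "b' \<in> carrier ?A" using a'(2) b'(2) by simp_all
    note e = q.hom_add[OF this]
    show "?q (a \<oplus>\<^bsub>?A\<^esub> b) \<in> ?q ` ?N"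
      unfolding q.hom_add[OF ab(1,2)] a'(1) b'(1) e[symmetric]
      by (rule imageI[OF N_add[OF a'(2) b'(2)]])
  next
    fix c and u :: "'g wgen list" assume "u \<in> carrier (free_monoid (wgens G m))"
    then have u: "u \<in> lists (wgens G m)" by simp
    have bu: "basis_elt u \<in> carrier ?A" using u by (intro basis_closed) simp
    have "?q (basis_elt u) \<in> ?q ` ?N"
      using nspan[OF W.word_in_nspan[OF u]] unfolding word[OF u] .
    then obtain b where b: "?q (basis_elt u) = ?q b" "b \<in> ?N" by (rule imageE)
    have bc: "b \<in> carrier ?A" using b(2) by simp
    \<comment> \<open>Scaling by c is multiplication by c times the unit, so the ring homomorphism
      \<open>?q\<close> is compatible with it.\<close>
    let ?c = "c \<odot>\<^bsub>?A\<^esub> \<one>\<^bsub>?A\<^esub>"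
    have cc: "?c \<in> carrier ?A" by (rule ma_smult_closed[OF A.one_closed])
    have s: "c \<odot>\<^bsub>?A\<^esub> x = ?c \<otimes>\<^bsub>?A\<^esub> x" if "x \<in> carrier ?A" for x
      unfolding ma_smult_mult_left[OF ma_carrierD[OF A.one_closed] ma_carrierD[OF that]] A.l_one[OF that] ..
    have "?q (c \<odot>\<^bsub>?A\<^esub> basis_elt u) = ?q (c \<odot>\<^bsub>?A\<^esub> b)"
      unfolding s[OF bu] s[OF bc] q.hom_mult[OF cc bu] q.hom_mult[OF cc bc] b(1) ..
    then show "?q (c \<odot>\<^bsub>?A\<^esub> basis_elt u) \<in> ?q ` ?N"
      using imageI[OF N_smult[OF b(2)]] by simp
  qed
  then obtain b where "?q a = ?q b" "b \<in> ?N" by (rule imageE)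
  then show ?thesis by blast
qed

text \<open>An element killed at all levels has a normal representative b modulo the ideal. Then b
  is killed as well, so it is zero by the independence of the normal words.\<close>

lemma hecke_ideal_iff:
  fixes a :: "'g wgen list \<Rightarrow> 'f::field"
  assumes "a \<in> carrier (free_alg (wgens G m))"
  shows "a \<in> wreath_Hecke_ideal G m \<longleftrightarrow> (\<forall>n \<ge> m. ma_ext (jm_word G m n) a = (\<lambda>_. 0))"
proof
  assume z: "\<forall>n \<ge> m. ma_ext (jm_word G m n) a = (\<lambda>_. 0)"
  let ?A = "free_alg (wgens G m) :: ('f, 'g wgen list \<Rightarrow> 'f) module"
  let ?I = "wreath_Hecke_ideal G m :: ('g wgen list \<Rightarrow> 'f) set"
  interpret I: ideal ?I ?A by (rule hecke_ideal)
  obtain b where b: "b \<in> carrier ?A" "supp b \<subseteq> normal_words m" "?I +>\<^bsub>?A\<^esub> a = ?I +>\<^bsub>?A\<^esub> b"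
    using normal_representative[OF assms] by blast
  have d: "a \<ominus>\<^bsub>?A\<^esub> b \<in> ?I"
    using I.quotient_eq_iff_same_a_r_cos[OF hecke_ideal assms b(1)] b(3) by simp
  have "ma_ext (jm_word G m n) b = (\<lambda>_. 0)" if n: "n \<ge> m" for n
  proof -
    interpret h: ring_hom_ring ?A "mon_alg G :: ('f, _) module" "ma_ext (jm_word G m n)"
      by (rule jm_eval_hom[OF n])
    have "ma_ext (jm_word G m n) (a \<ominus>\<^bsub>?A\<^esub> b) = \<zero>\<^bsub>mon_alg G\<^esub>"
      using hecke_ideal_eval_zero[OF n d] by (simp add: ma_zero)
    then show ?thesis using h.hom_minus_eq_zero[OF assms b(1)] z n by simp
  qed
  then have "b = (\<lambda>_. 0)"
    using b(2) ma_carrierD[OF b(1)] canonical_words(1,2)[of m]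
    by (intro normal_words_independent[of "canonical_words m" m]) (auto simp: normal_words_def)
  then have "?I +>\<^bsub>?A\<^esub> a = ?I" using b(3) I.a_rcos_zero[OF hecke_ideal additive_subgroup.zero_closed[OF I.additive_subgroup_axioms]]
    by (simp add: ma_zero)
  then show "a \<in> ?I" using I.rcos_const_imp_mem[OF assms] by simp
qed (auto intro: hecke_ideal_eval_zero)

end

section \<open>From matrices to monomial maps\<close>

text \<open>With at most one nonzero term the undefined clause of \<open>zadd\<close> is never
  reached, and the sum is that term.\<close>

lemma foldr_zadd_unique:
  assumes "distinct xs" "\<And>k k'. f k \<noteq> None \<Longrightarrow> f k' \<noteq> None \<Longrightarrow> k = k'"
  shows "foldr zadd (map f xs) None = Some c \<longleftrightarrow> (\<exists>k \<in> set xs. f k = Some c)"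
  using assms(1)
proof (induction xs)
  case (Cons k xs)
  show ?case
  proof (cases "f k")
    case None
    then show ?thesis using Cons.IH Cons.prems by simp
  next
    case (Some a)
    have none: "f k' = None" if "k' \<in> set xs" for k'
    proof (rule ccontr)
      assume "f k' \<noteq> None"
      then have "k = k'" using Some by (intro assms(2)) simp_all
      then show False using that Cons.prems by simp
    qed
    have "(\<forall>k' \<in> set ys. f k' = None) \<Longrightarrow> foldr zadd (map f ys) None = None" for ys
      by (induction ys) simp_all
    then have "foldr zadd (map f xs) None = None" using none by blast
    then show ?thesis using Some none by auto
  qed
qed simp

text \<open>For elements of \<open>Gbar_set G n\<close> this is invertibility: with at most one
  entry per row and column, a matrix without zero columns is monomial.\<close>

definition full_mat :: "nat \<Rightarrow> 'g gmat \<Rightarrow> bool" where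
  "full_mat n \<gamma> \<longleftrightarrow> (\<forall>j \<in> {1..n}. \<exists>i. \<gamma> i j \<noteq> None)"

text \<open>The default for a column without entries also covers the columns beyond the size of the
  matrix, so that adding a unit block does not change the value.\<close>

definition mat_mon :: "('g, 'b) monoid_scheme \<Rightarrow> 'g gmat \<Rightarrow> nat \<Rightarrow> nat \<times> 'g" where
  "mat_mon G \<gamma> = (\<lambda>j. if \<exists>i. \<gamma> i j \<noteq> None then (THE x. \<gamma> (fst x) j = Some (snd x)) else (j, \<one>\<^bsub>G\<^esub>))"

definition mat_proj :: "('g, 'b) monoid_scheme \<Rightarrow> nat \<Rightarrow> ('g gmat \<Rightarrow> 'f::field) \<Rightarrow> (nat \<Rightarrow> nat \<times> 'g) \<Rightarrow> 'f" where
  "mat_proj G n = ma_ext (\<lambda>\<gamma>. if full_mat n \<gamma> then basis_elt (mat_mon G \<gamma>) else (\<lambda>_. 0))"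

lemma Gbar_simps [simp]:
  "carrier (Gbar G n) = Gbar_set G n" "\<gamma> \<otimes>\<^bsub>Gbar G n\<^esub> \<delta> = gmat_mult G n \<gamma> \<delta>"
  "\<one>\<^bsub>Gbar G n\<^esub> = diag_mat n (\<lambda>_. \<one>\<^bsub>G\<^esub>)"
  by (simp_all add: Gbar_def)

lemma Gbar_entry: "\<gamma> \<in> Gbar_set G n \<Longrightarrow> \<gamma> i j = Some a \<Longrightarrow> i \<in> {1..n} \<and> j \<in> {1..n} \<and> a \<in> carrier G"
  unfolding Gbar_set_def by blast

lemma Gbar_row: "\<gamma> \<in> Gbar_set G n \<Longrightarrow> \<gamma> i j = Some a \<Longrightarrow> \<gamma> i j' = Some a' \<Longrightarrow> j = j'"
  unfolding Gbar_set_def by blast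

lemma Gbar_col: "\<gamma> \<in> Gbar_set G n \<Longrightarrow> \<gamma> i j = Some a \<Longrightarrow> \<gamma> i' j = Some a' \<Longrightarrow> i = i'"
  unfolding Gbar_set_def by blast

lemma Gbar_setI:
  assumes "\<And>i j a. \<gamma> i j = Some a \<Longrightarrow> i \<in> {1..n} \<and> j \<in> {1..n} \<and> a \<in> carrier G"
    and "\<And>i j j' a a'. \<gamma> i j = Some a \<Longrightarrow> \<gamma> i j' = Some a' \<Longrightarrow> j = j'"
    and "\<And>i i' j a a'. \<gamma> i j = Some a \<Longrightarrow> \<gamma> i' j = Some a' \<Longrightarrow> i = i'"
  shows "\<gamma> \<in> Gbar_set G n"
  unfolding Gbar_set_def using assms by blast

lemma gmat_eqI: "(\<And>i j c. \<gamma> i j = Some c \<longleftrightarrow> \<delta> i j = Some c) \<Longrightarrow> \<gamma> = (\<delta> :: 'g gmat)"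
  by (intro ext) (metis not_Some_eq)

lemma zmult_eq_Some: "zmult G x y = Some c \<longleftrightarrow> (\<exists>a b. x = Some a \<and> y = Some b \<and> c = a \<otimes>\<^bsub>G\<^esub> b)"
  by (cases x; cases y) auto

text \<open>Row i of \<gamma> has at most one entry, so the sum has at most one nonzero term. Matrix
  products become composites of relations, and with \<open>gmat_eqI\<close> identities are checked
  on \<open>Some\<close> values only.\<close>

lemma gmat_mult_eq_Some:
  assumes "\<gamma> \<in> Gbar_set G n"
  shows "gmat_mult G n \<gamma> \<delta> i j = Some c \<longleftrightarrow>
    (\<exists>k a b. \<gamma> i k = Some a \<and> \<delta> k j = Some b \<and> c = a \<otimes>\<^bsub>G\<^esub> b)"
proof -
  let ?f = "\<lambda>k. zmult G (\<gamma> i k) (\<delta> k j)"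
  have "foldr zadd (map ?f [1..<Suc n]) None = Some c \<longleftrightarrow> (\<exists>k \<in> set [1..<Suc n]. ?f k = Some c)"
  proof (rule foldr_zadd_unique)
    fix k k' assume "?f k \<noteq> None" "?f k' \<noteq> None"
    then show "k = k'" using Gbar_row[OF assms] by (auto simp: zmult_eq_Some)
  qed simp
  also have "\<dots> \<longleftrightarrow> (\<exists>k. ?f k = Some c)"
    using Gbar_entry[OF assms] by (fastforce simp: zmult_eq_Some)
  finally show ?thesis by (simp add: gmat_mult_def zmult_eq_Some del: upt_Suc)
qed

lemma mat_mon_eqI:
  assumes "\<gamma> \<in> Gbar_set G n" "\<gamma> i j = Some a"
  shows "mat_mon G \<gamma> j = (i, a)"
proof -
  have "(THE x. \<gamma> (fst x) j = Some (snd x)) = (i, a)"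
  proof (rule the_equality)
    fix x assume x: "\<gamma> (fst x) j = Some (snd x)"
    then have "fst x = i" by (rule Gbar_col[OF assms(1) _ assms(2)])
    then show "x = (i, a)" using x assms(2) by (simp add: prod_eq_iff)
  qed (simp add: assms(2))
  moreover have "\<exists>i. \<gamma> i j \<noteq> None" using assms(2) by blast
  ultimately show ?thesis unfolding mat_mon_def by (simp only: if_True)
qed

lemma mat_mon_outside:
  assumes "\<gamma> \<in> Gbar_set G n" "j \<notin> {1..n}"
  shows "mat_mon G \<gamma> j = (j, \<one>\<^bsub>G\<^esub>)"
proof -
  have "\<gamma> i j = None" for i using Gbar_entry[OF assms(1), of i j] assms(2) by (cases "\<gamma> i j") blast+
  then show ?thesis by (simp add: mat_mon_def)
qed

lemma full_matE:
  assumes "full_mat n \<gamma>" "j \<in> {1..n}"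
  obtains i a where "\<gamma> i j = Some a"
  using assms unfolding full_mat_def by blast

text \<open>Pigeonhole: the map from columns to rows is injective on \<open>{1..n}\<close>, hence
  onto.\<close>

lemma full_mat_row:
  assumes "\<gamma> \<in> Gbar_set G n" "full_mat n \<gamma>" "i \<in> {1..n}"
  obtains j a where "\<gamma> i j = Some a"
proof -
  have e: "\<exists>i a. \<gamma> i j = Some a" if "j \<in> {1..n}" for j using full_matE[OF assms(2) that] by blast
  then obtain r where r: "\<And>j. j \<in> {1..n} \<Longrightarrow> \<exists>a. \<gamma> (r j) j = Some a" by metis
  have "inj_on r {1..n}" using r Gbar_row[OF assms(1)] by (intro inj_onI) metis
  moreover have "r ` {1..n} \<subseteq> {1..n}" using r Gbar_entry[OF assms(1)] by blast
  ultimately have "r ` {1..n} = {1..n}" by (intro endo_inj_surj) auto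
  then obtain j where "j \<in> {1..n}" "r j = i" using assms(3) by (metis imageE)
  then show ?thesis using that r by blast
qed

lemma mat_mon_inject:
  assumes "\<gamma> \<in> Gbar_set G n" "\<delta> \<in> Gbar_set G n" "full_mat n \<gamma>" "full_mat n \<delta>" "mat_mon G \<gamma> = mat_mon G \<delta>"
  shows "\<gamma> = \<delta>"
proof (rule gmat_eqI)
  fix i j c
  have "\<delta> i j = Some c" if \<gamma>: "\<gamma> i j = Some c" "\<gamma> \<in> Gbar_set G n" "\<delta> \<in> Gbar_set G n" "full_mat n \<delta>"
    "mat_mon G \<gamma> = mat_mon G \<delta>" for \<gamma> \<delta>
  proof -
    have "j \<in> {1..n}" using Gbar_entry[OF \<gamma>(2,1)] by blast
    then obtain i' c' where d: "\<delta> i' j = Some c'" using full_matE[OF \<gamma>(4)] by blast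
    then show ?thesis using mat_mon_eqI[OF \<gamma>(3) d] mat_mon_eqI[OF \<gamma>(2,1)] \<gamma>(5) by simp
  qed
  then show "\<gamma> i j = Some c \<longleftrightarrow> \<delta> i j = Some c" using assms by metis
qed

section \<open>The projection of matrix algebras that kills the singular matrices\<close>

context finite_group begin

lemma gmat_mult_closed:
  assumes "\<gamma> \<in> Gbar_set G n" "\<delta> \<in> Gbar_set G n"
  shows "gmat_mult G n \<gamma> \<delta> \<in> Gbar_set G n"
proof (rule Gbar_setI)
  fix i j a assume "gmat_mult G n \<gamma> \<delta> i j = Some a"
  then show "i \<in> {1..n} \<and> j \<in> {1..n} \<and> a \<in> carrier G"
    using Gbar_entry[OF assms(1)] Gbar_entry[OF assms(2)] by (auto simp: gmat_mult_eq_Some[OF assms(1)])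
next
  fix i j j' a a' assume "gmat_mult G n \<gamma> \<delta> i j = Some a" "gmat_mult G n \<gamma> \<delta> i j' = Some a'"
  then show "j = j'" using Gbar_row[OF assms(1)] Gbar_row[OF assms(2)]
    unfolding gmat_mult_eq_Some[OF assms(1)] by metis
next
  fix i i' j a a' assume "gmat_mult G n \<gamma> \<delta> i j = Some a" "gmat_mult G n \<gamma> \<delta> i' j = Some a'"
  then show "i = i'" using Gbar_col[OF assms(1)] Gbar_col[OF assms(2)]
    unfolding gmat_mult_eq_Some[OF assms(1)] by metis
qed

lemma diag_mat_eq_Some: "diag_mat n g i j = Some c \<longleftrightarrow> i \<in> {1..n} \<and> i = j \<and> c = g i"
  by (auto simp: diag_mat_def)

lemma diag_mat_closed: "(\<And>i. i \<in> {1..n} \<Longrightarrow> g i \<in> carrier G) \<Longrightarrow> diag_mat n g \<in> Gbar_set G n"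
  by (rule Gbar_setI) (auto simp: diag_mat_eq_Some)

lemma Gbar_monoid: "monoid (Gbar G n)"
proof (rule monoidI)
  show one: "\<one>\<^bsub>Gbar G n\<^esub> \<in> carrier (Gbar G n)" by (simp add: diag_mat_closed)
  fix \<gamma> assume "\<gamma> \<in> carrier (Gbar G n)"
  then have \<gamma>: "\<gamma> \<in> Gbar_set G n" by simp
  have one': "diag_mat n (\<lambda>_. \<one>) \<in> Gbar_set G n" using one by simp
  show "\<one>\<^bsub>Gbar G n\<^esub> \<otimes>\<^bsub>Gbar G n\<^esub> \<gamma> = \<gamma>"
    using Gbar_entry[OF \<gamma>] unfolding Gbar_simps
    by (intro gmat_eqI) (fastforce simp: gmat_mult_eq_Some[OF one'] diag_mat_eq_Some)
  show "\<gamma> \<otimes>\<^bsub>Gbar G n\<^esub> \<one>\<^bsub>Gbar G n\<^esub> = \<gamma>"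
    using Gbar_entry[OF \<gamma>] unfolding Gbar_simps
    by (intro gmat_eqI) (fastforce simp: gmat_mult_eq_Some[OF \<gamma>] diag_mat_eq_Some)
  fix \<delta> \<epsilon> assume "\<delta> \<in> carrier (Gbar G n)" "\<epsilon> \<in> carrier (Gbar G n)"
  then have \<delta>: "\<delta> \<in> Gbar_set G n" and \<epsilon>: "\<epsilon> \<in> Gbar_set G n" by simp_all
  show "\<gamma> \<otimes>\<^bsub>Gbar G n\<^esub> \<delta> \<in> carrier (Gbar G n)" using gmat_mult_closed[OF \<gamma> \<delta>] by simp
  show "\<gamma> \<otimes>\<^bsub>Gbar G n\<^esub> \<delta> \<otimes>\<^bsub>Gbar G n\<^esub> \<epsilon> = \<gamma> \<otimes>\<^bsub>Gbar G n\<^esub> (\<delta> \<otimes>\<^bsub>Gbar G n\<^esub> \<epsilon>)"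
    unfolding Gbar_simps
  proof (rule gmat_eqI)
    fix i j c
    have "gmat_mult G n (gmat_mult G n \<gamma> \<delta>) \<epsilon> i j = Some c \<longleftrightarrow>
      (\<exists>k l a b d. \<gamma> i k = Some a \<and> \<delta> k l = Some b \<and> \<epsilon> l j = Some d \<and> c = a \<otimes> b \<otimes> d)"
      unfolding gmat_mult_eq_Some[OF gmat_mult_closed[OF \<gamma> \<delta>]] gmat_mult_eq_Some[OF \<gamma>] by blast
    also have "\<dots> \<longleftrightarrow>
      (\<exists>k l a b d. \<gamma> i k = Some a \<and> \<delta> k l = Some b \<and> \<epsilon> l j = Some d \<and> c = a \<otimes> (b \<otimes> d))"
      using Gbar_entry[OF \<gamma>] Gbar_entry[OF \<delta>] Gbar_entry[OF \<epsilon>] m_assoc by metis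
    also have "\<dots> \<longleftrightarrow> gmat_mult G n \<gamma> (gmat_mult G n \<delta> \<epsilon>) i j = Some c"
      unfolding gmat_mult_eq_Some[OF \<gamma>] gmat_mult_eq_Some[OF \<delta>] by blast
    finally show "gmat_mult G n (gmat_mult G n \<gamma> \<delta>) \<epsilon> i j = Some c \<longleftrightarrow>
      gmat_mult G n \<gamma> (gmat_mult G n \<delta> \<epsilon>) i j = Some c" .
  qed
qed

lemma FGbar_ring: "ring (FGbar G n :: ('f::field, _) module)"
  by (rule ma_ring[OF Gbar_monoid])

text \<open>The singular matrices form an ideal whose complement is closed under products, and this
  makes \<open>mat_proj\<close> multiplicative. For the left factor, column k of \<gamma> is reached
  through an entry of \<delta> in row k, which \<open>full_mat_row\<close> provides.\<close>

lemma full_mat_mult: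
  assumes \<gamma>: "\<gamma> \<in> Gbar_set G n" and \<delta>: "\<delta> \<in> Gbar_set G n"
  shows "full_mat n (gmat_mult G n \<gamma> \<delta>) \<longleftrightarrow> full_mat n \<gamma> \<and> full_mat n \<delta>"
proof
  assume f: "full_mat n (gmat_mult G n \<gamma> \<delta>)"
  have d: "full_mat n \<delta>"
    unfolding full_mat_def
  proof
    fix j assume "j \<in> {1..n}"
    then obtain i c where "gmat_mult G n \<gamma> \<delta> i j = Some c" using full_matE[OF f] by blast
    then show "\<exists>i. \<delta> i j \<noteq> None" unfolding gmat_mult_eq_Some[OF \<gamma>] by blast
  qed
  moreover have "full_mat n \<gamma>"
    unfolding full_mat_def
  proof
    fix k assume "k \<in> {1..n}"
    then obtain j b where j: "\<delta> k j = Some b" using full_mat_row[OF \<delta> d] by blast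
    then have "j \<in> {1..n}" using Gbar_entry[OF \<delta>] by blast
    then obtain i c where "gmat_mult G n \<gamma> \<delta> i j = Some c" using full_matE[OF f] by blast
    then obtain k' a b' where k': "\<gamma> i k' = Some a" "\<delta> k' j = Some b'"
      unfolding gmat_mult_eq_Some[OF \<gamma>] by blast
    have "k' = k" using Gbar_col[OF \<delta> k'(2) j] .
    then show "\<exists>i. \<gamma> i k \<noteq> None" using k'(1) by blast
  qed
  ultimately show "full_mat n \<gamma> \<and> full_mat n \<delta>" by blast
next
  assume f: "full_mat n \<gamma> \<and> full_mat n \<delta>"
  show "full_mat n (gmat_mult G n \<gamma> \<delta>)"
    unfolding full_mat_def
  proof
    fix j assume "j \<in> {1..n}"
    then obtain k b where k: "\<delta> k j = Some b" using full_matE[OF conjunct2[OF f]] by blast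
    then have "k \<in> {1..n}" using Gbar_entry[OF \<delta>] by blast
    then obtain i a where "\<gamma> i k = Some a" using full_matE[OF conjunct1[OF f]] by blast
    then have "gmat_mult G n \<gamma> \<delta> i j = Some (a \<otimes> b)" unfolding gmat_mult_eq_Some[OF \<gamma>] using k by blast
    then show "\<exists>i. gmat_mult G n \<gamma> \<delta> i j \<noteq> None" by blast
  qed
qed

lemma mat_mon_mult:
  assumes \<gamma>: "\<gamma> \<in> Gbar_set G n" and \<delta>: "\<delta> \<in> Gbar_set G n" and f: "full_mat n \<gamma>" "full_mat n \<delta>"
  shows "mat_mon G (gmat_mult G n \<gamma> \<delta>) = mat_mon G \<gamma> \<cdot> mat_mon G \<delta>"
proof
  fix j
  show "mat_mon G (gmat_mult G n \<gamma> \<delta>) j = (mat_mon G \<gamma> \<cdot> mat_mon G \<delta>) j"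
  proof (cases "j \<in> {1..n}")
    case True
    then obtain k b where k: "\<delta> k j = Some b" using full_matE[OF f(2)] by blast
    then have "k \<in> {1..n}" using Gbar_entry[OF \<delta>] by blast
    then obtain i a where i: "\<gamma> i k = Some a" using full_matE[OF f(1)] by blast
    have "gmat_mult G n \<gamma> \<delta> i j = Some (a \<otimes> b)" unfolding gmat_mult_eq_Some[OF \<gamma>] using k i by blast
    then show ?thesis
      using mat_mon_eqI[OF gmat_mult_closed[OF \<gamma> \<delta>]] mat_mon_eqI[OF \<gamma> i] mat_mon_eqI[OF \<delta> k]
      by (simp add: monomial_mult)
  next
    case False
    then show ?thesis
      using mat_mon_outside[OF gmat_mult_closed[OF \<gamma> \<delta>] False] mat_mon_outside[OF \<gamma> False] mat_mon_outside[OF \<delta> False]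
      by (simp add: monomial_mult)
  qed
qed

lemma mat_mon_closed:
  assumes "\<gamma> \<in> Gbar_set G n"
  shows "mat_mon G \<gamma> \<in> carrier (monomial G)"
  unfolding monomial_carrier
proof
  fix j
  show "snd (mat_mon G \<gamma> j) \<in> carrier G"
  proof (cases "\<exists>i a. \<gamma> i j = Some a")
    case True
    then obtain i a where ia: "\<gamma> i j = Some a" by blast
    show ?thesis using mat_mon_eqI[OF assms ia] Gbar_entry[OF assms ia] by simp
  next
    case False
    then show ?thesis by (simp add: mat_mon_def)
  qed
qed

lemma mat_proj_basis:
  "mat_proj G n (basis_elt \<gamma>) = (if full_mat n \<gamma> then basis_elt (mat_mon G \<gamma>) else (\<lambda>_. 0 :: 'f::field))"
  by (simp add: mat_proj_def)

lemma mat_mon_diag: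
  assumes "\<And>i. i \<in> {1..n} \<Longrightarrow> g i \<in> carrier G"
  shows "full_mat n (diag_mat n g)" "mat_mon G (diag_mat n g) = mon_diag G n g"
proof -
  have e: "diag_mat n g j j = Some (g j)" if "j \<in> {1..n}" for j using that by (simp add: diag_mat_eq_Some)
  then show "full_mat n (diag_mat n g)" unfolding full_mat_def by blast
  show "mat_mon G (diag_mat n g) = mon_diag G n g"
    using mat_mon_eqI[OF diag_mat_closed[OF assms] e] mat_mon_outside[OF diag_mat_closed[OF assms]]
    unfolding mon_diag_def by fastforce
qed

lemma mat_mon_perm:
  assumes "a \<in> {1..n}" "b \<in> {1..n}"
  shows "perm_mat G n (transpose a b) \<in> Gbar_set G n" "full_mat n (perm_mat G n (transpose a b))"
    "mat_mon G (perm_mat G n (transpose a b)) = mon_perm G (transpose a b)"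
proof -
  have e: "perm_mat G n (transpose a b) i j = Some c \<longleftrightarrow> i \<in> {1..n} \<and> j \<in> {1..n} \<and> transpose a b j = i \<and> c = \<one>"
    for i j c by (auto simp: perm_mat_def)
  have t: "transpose a b j \<in> {1..n} \<longleftrightarrow> j \<in> {1..n}" for j using assms by (auto simp: transpose_def)
  show cl: "perm_mat G n (transpose a b) \<in> Gbar_set G n"
    by (rule Gbar_setI) (auto simp: e transpose_eq_iff)
  have f: "perm_mat G n (transpose a b) (transpose a b j) j = Some \<one>" if "j \<in> {1..n}" for j
    using that t by (simp add: e)
  then show "full_mat n (perm_mat G n (transpose a b))" unfolding full_mat_def by blast
  show "mat_mon G (perm_mat G n (transpose a b)) = mon_perm G (transpose a b)"
  proof
    fix j
    show "mat_mon G (perm_mat G n (transpose a b)) j = mon_perm G (transpose a b) j"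
    proof (cases "j \<in> {1..n}")
      case True
      then show ?thesis using mat_mon_eqI[OF cl f[OF True]] by (simp add: mon_perm_def)
    next
      case False
      then have "transpose a b j = j" using assms by (auto simp: transpose_def)
      then show ?thesis using mat_mon_outside[OF cl False] by (simp add: mon_perm_def)
    qed
  qed
qed

lemma eps_mat_eq_Some: "eps_mat G n l i j = Some c \<longleftrightarrow> i \<in> {1..n} \<and> i = j \<and> i \<noteq> l \<and> c = \<one>"
  by (auto simp: eps_mat_def)

lemma eps_mat_closed: "eps_mat G n l \<in> Gbar_set G n"
  by (rule Gbar_setI) (auto simp: eps_mat_eq_Some)

lemma eps_mat_not_full: "l \<in> {1..n} \<Longrightarrow> \<not> full_mat n (eps_mat G n l)"
  unfolding full_mat_def using eps_mat_eq_Some by (metis not_None_eq)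

lemma mat_proj_hom: "ring_hom_ring (FGbar G n :: ('f::field, _) module) (mon_alg G) (mat_proj G n)"
proof (rule ring_hom_ringI)
  let ?\<phi> = "\<lambda>\<gamma>. if full_mat n \<gamma> then basis_elt (mat_mon G \<gamma>) else (\<lambda>_. 0 :: 'f)"
  interpret B: ring "mon_alg G :: ('f, _) module" by (rule mon_alg_ring)
  have z: "(\<lambda>_. 0 :: 'f) \<in> carrier (mon_alg G)" using B.zero_closed unfolding ma_zero .
  have c: "?\<phi> \<gamma> \<in> carrier (mon_alg G)" if "\<gamma> \<in> carrier (Gbar G n)" for \<gamma>
  proof -
    have "basis_elt (mat_mon G \<gamma>) \<in> carrier (mon_alg G :: ('f, _) module)"
      using that by (intro basis_closed mat_mon_closed) simp
    then show ?thesis using z by simp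
  qed
  show "ring (FGbar G n :: ('f, _) module)" by (rule FGbar_ring)
  show "ring (mon_alg G :: ('f, _) module)" by (rule mon_alg_ring)
  fix a :: "_ \<Rightarrow> 'f" assume a: "a \<in> carrier (FGbar G n)"
  show "mat_proj G n a \<in> carrier (mon_alg G)"
    unfolding mat_proj_def using a c by (rule ma_ext_closed)
  fix b :: "_ \<Rightarrow> 'f" assume b: "b \<in> carrier (FGbar G n)"
  have hom: "?\<phi> (\<gamma> \<otimes>\<^bsub>Gbar G n\<^esub> \<delta>) = ?\<phi> \<gamma> \<star> ?\<phi> \<delta>"
    if "\<gamma> \<in> carrier (Gbar G n)" "\<delta> \<in> carrier (Gbar G n)" for \<gamma> \<delta>
  proof -
    have g: "\<gamma> \<in> Gbar_set G n" "\<delta> \<in> Gbar_set G n" using that by simp_all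
    have zl: "(\<lambda>_. 0) \<star> x = (\<lambda>_. 0 :: 'f)" and zr: "x \<star> (\<lambda>_. 0) = (\<lambda>_. 0 :: 'f)"
      if "x \<in> carrier (mon_alg G)" for x
      using B.l_null[OF that] B.r_null[OF that] unfolding ma_zero by simp_all
    show ?thesis
      using full_mat_mult[OF g] mat_mon_mult[OF g] zl[OF c[OF that(2)]] zr[OF c[OF that(1)]]
      by (cases "full_mat n \<gamma>"; cases "full_mat n \<delta>") (simp_all add: ma_mult_basis)
  qed
  show "mat_proj G n (a \<otimes>\<^bsub>FGbar G n\<^esub> b) = mat_proj G n a \<star> mat_proj G n b"
    unfolding mat_proj_def
  proof (rule ma_ext_mult[OF a b])
    fix \<gamma> \<delta> assume "\<gamma> \<in> carrier (Gbar G n)" "\<delta> \<in> carrier (Gbar G n)"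
    then show "?\<phi> (\<gamma> \<otimes>\<^bsub>Gbar G n\<^esub> \<delta>) = ?\<phi> \<gamma> \<star> ?\<phi> \<delta>"
      by (rule hom)
  qed (rule c)
  show "mat_proj G n (a \<oplus>\<^bsub>FGbar G n\<^esub> b) = mat_proj G n a \<oplus>\<^bsub>mon_alg G\<^esub> mat_proj G n b"
    unfolding mat_proj_def by (rule ma_ext_add[OF ma_carrierD[OF a] ma_carrierD[OF b]])
next
  have "mon_diag G n (\<lambda>_. \<one>) = \<one>\<^bsub>monomial G\<^esub>" by (auto simp: mon_diag_def monomial_one)
  then show "mat_proj G n \<one>\<^bsub>FGbar G n\<^esub> = (\<one>\<^bsub>mon_alg G\<^esub> :: _ \<Rightarrow> 'f)"
    unfolding ma_one Gbar_simps mat_proj_basis using mat_mon_diag[of n "\<lambda>_. \<one>"] by simp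
qed

lemma mon_swap_factor:
  assumes "k \<in> {1..n}" "i \<in> {1..n}" "k \<noteq> i" "h \<in> carrier G"
  shows "mon_diag G n (at_pos G n k h) \<cdot> mon_diag G n (at_pos G n i (inv h)) \<cdot>
    mon_perm G (transpose k i) = mon_swap G k i h"
  using assms by (auto simp: monomial_mult mon_diag_def at_pos_def mon_perm_def mon_swap_def transpose_def)

text \<open>The matrices \<epsilon>_k and \<epsilon>_i are singular, so both factors 1 - \<epsilon>
  become 1. What is left, t_{ki} (k i), is the sum over h of the swaps of k and i.\<close>

lemma mat_proj_u:
  assumes k: "k \<in> {1..n}"
  shows "mat_proj G n (u_elt G n k) = (jm G n k :: _ \<Rightarrow> 'f::field)" "(u_elt G n k :: _ \<Rightarrow> 'f) \<in> carrier (FGbar G n)"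
proof -
  let ?A = "FGbar G n :: ('f, _) module" and ?B = "mon_alg G :: ('f, _) module"
  interpret h: ring_hom_ring ?A ?B "mat_proj G n" by (rule mat_proj_hom)
  let ?d = "\<lambda>k h. basis_elt (diag_mat n (at_pos G n k h)) :: _ \<Rightarrow> 'f"
  let ?D = "\<lambda>k h. basis_elt (mon_diag G n (at_pos G n k h)) :: _ \<Rightarrow> 'f"
  let ?e = "\<lambda>i. \<one>\<^bsub>?A\<^esub> \<ominus>\<^bsub>?A\<^esub> basis_elt (eps_mat G n i)"
  let ?p = "\<lambda>i. basis_elt (perm_mat G n (transpose k i)) :: _ \<Rightarrow> 'f"
  let ?P = "\<lambda>i. basis_elt (mon_perm G (transpose k i)) :: _ \<Rightarrow> 'f"
  let ?t = "\<lambda>i. t_elt ?A (\<lambda>g. basis_elt (diag_mat n g)) G n k i"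
  let ?T = "\<lambda>i. (\<Oplus>\<^bsub>?B\<^esub>h\<in>carrier G. ?D k h \<otimes>\<^bsub>?B\<^esub> ?D i (inv h))"
  have at: "\<And>j. j \<in> {1..n} \<Longrightarrow> at_pos G n k h j \<in> carrier G" if "h \<in> carrier G" for k h
    using at_pos_closed[OF group_axioms that, of n k] by (auto simp: Gpow_carrier)
  have dc: "?d k h \<in> carrier ?A" and dp: "mat_proj G n (?d k h) = ?D k h" and Dc: "?D k h \<in> carrier ?B"
    if "h \<in> carrier G" for k h
    using diag_mat_closed[OF at[OF that]] mat_mon_diag[OF at[OF that]] at_pos_closed[OF group_axioms that]
    by (auto simp: mat_proj_basis intro!: basis_closed mon_diag_closed)
  have ec: "?e i \<in> carrier ?A" for i
    by (intro h.R.minus_closed h.R.one_closed basis_closed) (simp add: eps_mat_closed)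
  have ep: "mat_proj G n (?e i) = \<one>\<^bsub>?B\<^esub>" if "i \<in> {1..n}" for i
  proof -
    have b: "basis_elt (eps_mat G n i) \<in> carrier ?A" by (intro basis_closed) (simp add: eps_mat_closed)
    have "mat_proj G n (basis_elt (eps_mat G n i)) = \<zero>\<^bsub>?B\<^esub>"
      unfolding mat_proj_basis ma_zero using eps_mat_not_full[OF that] by simp
    then show ?thesis
      unfolding a_minus_def h.hom_add[OF h.R.one_closed h.R.a_inv_closed[OF b]] h.hom_a_inv[OF b] h.hom_one
      by simp
  qed
  have pc: "?p i \<in> carrier ?A" and pp: "mat_proj G n (?p i) = ?P i" and Pc: "?P i \<in> carrier ?B"
    if "i \<in> {1..n}" for i
    using mat_mon_perm[OF k that] by (auto simp: mat_proj_basis intro!: basis_closed mon_perm_closed)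
  have tc: "?t i \<in> carrier ?A" for i
    unfolding t_elt_def using dc by (intro h.R.finsum_closed) auto
  have tp: "mat_proj G n (?t i) = ?T i" for i
  proof -
    have "mat_proj G n (?t i) = (\<Oplus>\<^bsub>?B\<^esub>h\<in>carrier G. mat_proj G n (?d k h \<otimes>\<^bsub>?A\<^esub> ?d i (inv h)))"
      unfolding t_elt_def using dc by (intro h.hom_finsum_add finite_G) auto
    also have "\<dots> = ?T i"
      using dc dp Dc by (intro h.S.finsum_cong') auto
    finally show ?thesis .
  qed
  have Tc: "?T i \<in> carrier ?B" for i using Dc by (intro h.S.finsum_closed) auto
  have TP: "?T i \<otimes>\<^bsub>?B\<^esub> ?P i = (\<lambda>\<gamma>. \<Sum>h\<in>carrier G. basis_elt (mon_swap G k i h) \<gamma>)" if i: "i \<in> {k+1..n}" for i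
  proof -
    have i': "i \<in> {1..n}" "k \<noteq> i" using i by auto
    have "?T i \<otimes>\<^bsub>?B\<^esub> ?P i = (\<Oplus>\<^bsub>?B\<^esub>h\<in>carrier G. ?D k h \<otimes>\<^bsub>?B\<^esub> ?D i (inv h) \<otimes>\<^bsub>?B\<^esub> ?P i)"
      using Dc Pc[OF i'(1)] by (intro h.S.finsum_ldistr finite_G) auto
    also have "\<dots> = (\<Oplus>\<^bsub>?B\<^esub>h\<in>carrier G. basis_elt (mon_swap G k i h))"
      using mon_swap_factor[OF k i'] mon_swap_closed
      by (intro h.S.finsum_cong') (auto simp: ma_mult_basis intro!: basis_closed)
    also have "\<dots> = (\<lambda>\<gamma>. \<Sum>h\<in>carrier G. basis_elt (mon_swap G k i h) \<gamma>)"
      using mon_swap_closed by (intro ma_finsum finite_G basis_closed) auto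
    finally show ?thesis .
  qed
  have xc: "?t i \<otimes>\<^bsub>?A\<^esub> ?p i \<otimes>\<^bsub>?A\<^esub> ?e k \<otimes>\<^bsub>?A\<^esub> ?e i \<in> carrier ?A" if "i \<in> {k+1..n}" for i
    using that tc pc ec by (intro h.R.m_closed) auto
  have xp: "mat_proj G n (?t i \<otimes>\<^bsub>?A\<^esub> ?p i \<otimes>\<^bsub>?A\<^esub> ?e k \<otimes>\<^bsub>?A\<^esub> ?e i)
      = (\<lambda>\<gamma>. \<Sum>h\<in>carrier G. basis_elt (mon_swap G k i h) \<gamma>)" if i: "i \<in> {k+1..n}" for i
  proof -
    have i': "i \<in> {1..n}" using i by auto
    note c1 = h.R.m_closed[OF tc[of i] pc[OF i']]
    note c2 = h.R.m_closed[OF c1 ec[of k]]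
    note cTP = h.S.m_closed[OF Tc[of i] Pc[OF i']]
    have "mat_proj G n (?t i \<otimes>\<^bsub>?A\<^esub> ?p i \<otimes>\<^bsub>?A\<^esub> ?e k \<otimes>\<^bsub>?A\<^esub> ?e i) = ?T i \<otimes>\<^bsub>?B\<^esub> ?P i \<otimes>\<^bsub>?B\<^esub> \<one>\<^bsub>?B\<^esub> \<otimes>\<^bsub>?B\<^esub> \<one>\<^bsub>?B\<^esub>"
      unfolding h.hom_mult[OF c2 ec[of i]] h.hom_mult[OF c1 ec[of k]] h.hom_mult[OF tc[of i] pc[OF i']]
        tp pp[OF i'] ep[OF k] ep[OF i'] ..
    also have "\<dots> = ?T i \<otimes>\<^bsub>?B\<^esub> ?P i" unfolding h.S.r_one[OF cTP] h.S.r_one[OF cTP] ..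
    finally show ?thesis unfolding TP[OF i] .
  qed
  show "(u_elt G n k :: _ \<Rightarrow> 'f) \<in> carrier ?A"
    unfolding u_elt_def Let_def using xc by (intro h.R.finsum_closed) blast
  have "mat_proj G n (u_elt G n k) = (\<Oplus>\<^bsub>?B\<^esub>i\<in>{k+1..n}. mat_proj G n (?t i \<otimes>\<^bsub>?A\<^esub> ?p i \<otimes>\<^bsub>?A\<^esub> ?e k \<otimes>\<^bsub>?A\<^esub> ?e i))"
    unfolding u_elt_def Let_def using xc by (intro h.hom_finsum_add) auto
  also have "\<dots> = (\<lambda>\<gamma>. \<Sum>i\<in>{k+1..n}. mat_proj G n (?t i \<otimes>\<^bsub>?A\<^esub> ?p i \<otimes>\<^bsub>?A\<^esub> ?e k \<otimes>\<^bsub>?A\<^esub> ?e i) \<gamma>)"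
    using xc by (intro ma_finsum h.hom_closed) auto
  also have "\<dots> = jm G n k"
    unfolding jm_def using xp by (intro ext sum.cong refl) simp
  finally show "mat_proj G n (u_elt G n k) = (jm G n k :: _ \<Rightarrow> 'f)" .
qed

end

section \<open>Embedding of smaller matrices\<close>

text \<open>Makes the lemmas on \<open>ma_ext\<close> available for
  \<open>const_seq\<close>.\<close>

lemma lin_ext_eq_ma_ext:
  assumes "finite (supp \<alpha>)"
  shows "lin_ext \<phi> \<alpha> = (ma_ext (\<lambda>x. basis_elt (\<phi> x)) \<alpha> :: _ \<Rightarrow> 'f::field)"
proof
  fix y
  have "lin_ext \<phi> \<alpha> y = (\<Sum>x\<in>supp \<alpha>. if \<phi> x = y then \<alpha> x else 0)"
    unfolding lin_ext_def using assms by (simp add: sum.inter_filter)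
  also have "\<dots> = ma_ext (\<lambda>x. basis_elt (\<phi> x)) \<alpha> y"
    unfolding ma_ext_def pairing_def by (intro sum.cong) (auto simp: basis_apply)
  finally show "lin_ext \<phi> \<alpha> y = (ma_ext (\<lambda>x. basis_elt (\<phi> x)) \<alpha> :: _ \<Rightarrow> 'f) y" .
qed

context finite_group begin

lemma emb_mat_eq_Some:
  assumes "\<gamma> \<in> Gbar_set G m" "m \<le> n"
  shows "emb_mat G m n \<gamma> i j = Some c \<longleftrightarrow> \<gamma> i j = Some c \<or> (i \<in> {m<..n} \<and> i = j \<and> c = \<one>)"
  using Gbar_entry[OF assms(1), of i j] by (auto simp: emb_mat_def)

lemma emb_mat_closed:
  assumes "\<gamma> \<in> Gbar_set G m" "m \<le> n"
  shows "emb_mat G m n \<gamma> \<in> Gbar_set G n"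
proof (rule Gbar_setI)
  fix i j a assume "emb_mat G m n \<gamma> i j = Some a"
  then show "i \<in> {1..n} \<and> j \<in> {1..n} \<and> a \<in> carrier G"
    unfolding emb_mat_eq_Some[OF assms] using Gbar_entry[OF assms(1), of i j a] assms(2) by auto
next
  fix i j j' a a' assume "emb_mat G m n \<gamma> i j = Some a" "emb_mat G m n \<gamma> i j' = Some a'"
  then show "j = j'" unfolding emb_mat_eq_Some[OF assms]
    using Gbar_row[OF assms(1), of i j a j' a'] Gbar_entry[OF assms(1), of i j a] Gbar_entry[OF assms(1), of i j' a']
    by auto
next
  fix i i' j a a' assume "emb_mat G m n \<gamma> i j = Some a" "emb_mat G m n \<gamma> i' j = Some a'"
  then show "i = i'" unfolding emb_mat_eq_Some[OF assms]
    using Gbar_col[OF assms(1), of i j a i' a'] Gbar_entry[OF assms(1), of i j a] Gbar_entry[OF assms(1), of i' j a']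
    by auto
qed

lemma emb_mat_mult:
  assumes \<gamma>: "\<gamma> \<in> Gbar_set G m" and \<delta>: "\<delta> \<in> Gbar_set G m" and mn: "m \<le> n"
  shows "emb_mat G m n (gmat_mult G m \<gamma> \<delta>) = gmat_mult G n (emb_mat G m n \<gamma>) (emb_mat G m n \<delta>)"
proof (rule gmat_eqI)
  fix i j c
  have out: "\<gamma> i k \<noteq> Some a" "\<delta> k j \<noteq> Some a" if "k \<in> {m<..n}" for k a
    using Gbar_entry[OF \<gamma>, of i k a] Gbar_entry[OF \<delta>, of k j a] that by auto
  show "emb_mat G m n (gmat_mult G m \<gamma> \<delta>) i j = Some c \<longleftrightarrow>
    gmat_mult G n (emb_mat G m n \<gamma>) (emb_mat G m n \<delta>) i j = Some c" (is "?l \<longleftrightarrow> ?r")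
  proof
    assume ?l
    then consider k a b where "\<gamma> i k = Some a" "\<delta> k j = Some b" "c = a \<otimes> b" | "i \<in> {m<..n}" "i = j" "c = \<one>"
      unfolding emb_mat_eq_Some[OF gmat_mult_closed[OF \<gamma> \<delta>] mn] gmat_mult_eq_Some[OF \<gamma>] by blast
    then show ?r
    proof cases
      case 1
      then show ?thesis unfolding gmat_mult_eq_Some[OF emb_mat_closed[OF \<gamma> mn]]
        emb_mat_eq_Some[OF \<gamma> mn] emb_mat_eq_Some[OF \<delta> mn] by blast
    next
      case 2
      then have "emb_mat G m n \<gamma> i i = Some \<one>" "emb_mat G m n \<delta> i j = Some \<one>" "c = \<one> \<otimes> \<one>"
        unfolding emb_mat_eq_Some[OF \<gamma> mn] emb_mat_eq_Some[OF \<delta> mn] by simp_all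
      then show ?thesis unfolding gmat_mult_eq_Some[OF emb_mat_closed[OF \<gamma> mn]] by blast
    qed
  next
    assume ?r
    then obtain k a b where k: "emb_mat G m n \<gamma> i k = Some a" "emb_mat G m n \<delta> k j = Some b" "c = a \<otimes> b"
      unfolding gmat_mult_eq_Some[OF emb_mat_closed[OF \<gamma> mn]] by blast
    show ?l
    proof (cases "k \<in> {m<..n}")
      case True
      then have "i = k \<and> k = j \<and> a = \<one> \<and> b = \<one>"
        using k(1,2) out(1)[OF True, of a] out(2)[OF True, of b]
        unfolding emb_mat_eq_Some[OF \<gamma> mn] emb_mat_eq_Some[OF \<delta> mn] by simp
      then show ?thesis using True k(3) unfolding emb_mat_eq_Some[OF gmat_mult_closed[OF \<gamma> \<delta>] mn] by simp
    next
      case False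
      then have "\<gamma> i k = Some a" "\<delta> k j = Some b"
        using k(1,2) unfolding emb_mat_eq_Some[OF \<gamma> mn] emb_mat_eq_Some[OF \<delta> mn] by auto
      then show ?thesis
        unfolding emb_mat_eq_Some[OF gmat_mult_closed[OF \<gamma> \<delta>] mn] gmat_mult_eq_Some[OF \<gamma>] using k(3) by blast
    qed
  qed
qed

lemma emb_mat_one:
  assumes "m \<le> n"
  shows "emb_mat G m n (diag_mat m (\<lambda>_. \<one>)) = diag_mat n (\<lambda>_. \<one>)"
  using assms by (intro ext) (auto simp: emb_mat_def diag_mat_def)

text \<open>The unit block added by the embedding agrees with the default of \<open>mat_mon\<close>.
  Hence a constant sequence has the same projection at every level.\<close>

lemma emb_mat_mon:
  assumes \<gamma>: "\<gamma> \<in> Gbar_set G m" and mn: "m \<le> n"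
  shows "full_mat n (emb_mat G m n \<gamma>) \<longleftrightarrow> full_mat m \<gamma>"
    and "mat_mon G (emb_mat G m n \<gamma>) = mat_mon G \<gamma>"
proof -
  show "full_mat n (emb_mat G m n \<gamma>) \<longleftrightarrow> full_mat m \<gamma>"
  proof
    assume f: "full_mat n (emb_mat G m n \<gamma>)"
    show "full_mat m \<gamma>" unfolding full_mat_def
    proof
      fix j assume j: "j \<in> {1..m}"
      then have "j \<in> {1..n}" using mn by simp
      then obtain i a where "emb_mat G m n \<gamma> i j = Some a" using full_matE[OF f] by blast
      then have "\<gamma> i j = Some a" unfolding emb_mat_eq_Some[OF \<gamma> mn] using j by auto
      then show "\<exists>i. \<gamma> i j \<noteq> None" by blast
    qed
  next
    assume f: "full_mat m \<gamma>"
    show "full_mat n (emb_mat G m n \<gamma>)" unfolding full_mat_def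
    proof
      fix j assume j: "j \<in> {1..n}"
      show "\<exists>i. emb_mat G m n \<gamma> i j \<noteq> None"
      proof (cases "j \<le> m")
        case True
        then obtain i a where "\<gamma> i j = Some a" using full_matE[OF f, of j] j by auto
        then have "emb_mat G m n \<gamma> i j = Some a" unfolding emb_mat_eq_Some[OF \<gamma> mn] by simp
        then show ?thesis by blast
      next
        case False
        then have "emb_mat G m n \<gamma> j j = Some \<one>" unfolding emb_mat_eq_Some[OF \<gamma> mn] using j by simp
        then show ?thesis by blast
      qed
    qed
  qed
  show "mat_mon G (emb_mat G m n \<gamma>) = mat_mon G \<gamma>"
  proof
    fix j
    consider i a where "\<gamma> i j = Some a" | "\<And>i. \<gamma> i j = None" "j \<in> {m<..n}" | "\<And>i. \<gamma> i j = None" "j \<notin> {m<..n}"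
      by (metis option.exhaust)
    then show "mat_mon G (emb_mat G m n \<gamma>) j = mat_mon G \<gamma> j"
    proof cases
      case (1 i a)
      then have "emb_mat G m n \<gamma> i j = Some a" unfolding emb_mat_eq_Some[OF \<gamma> mn] by simp
      then show ?thesis using mat_mon_eqI[OF \<gamma> 1] mat_mon_eqI[OF emb_mat_closed[OF \<gamma> mn]] by simp
    next
      case 2
      then have "emb_mat G m n \<gamma> j j = Some \<one>" unfolding emb_mat_eq_Some[OF \<gamma> mn] by simp
      then have "mat_mon G (emb_mat G m n \<gamma>) j = (j, \<one>)" by (rule mat_mon_eqI[OF emb_mat_closed[OF \<gamma> mn]])
      then show ?thesis using 2(1) by (simp add: mat_mon_def)
    next
      case 3
      have "emb_mat G m n \<gamma> i j \<noteq> Some c" for i c unfolding emb_mat_eq_Some[OF \<gamma> mn] using 3 by auto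
      then have "emb_mat G m n \<gamma> i j = None" for i by (cases "emb_mat G m n \<gamma> i j") simp_all
      then show ?thesis using 3(1) by (simp add: mat_mon_def)
    qed
  qed
qed

text \<open>A nonsingular matrix is a diagonal matrix times a permutation matrix, and the
  permutation is a product of adjacent transpositions.\<close>

lemma mat_mon_group_word:
  assumes \<gamma>: "\<gamma> \<in> Gbar_set G m" and f: "full_mat m \<gamma>"
  shows "\<exists>v \<in> lists (group_gens G m). mon_word G m v = mat_mon G \<gamma>"
proof -
  define \<sigma> where "\<sigma> j = fst (mat_mon G \<gamma> j)" for j
  \<comment> \<open>The diagonal factor stands on the left and is indexed by rows: its entry at i is
    the value in the column that \<sigma> takes to i.\<close>
  define g where "g = (\<lambda>i\<in>{1..m}. snd (mat_mon G \<gamma> (inv_into UNIV \<sigma> i)))"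
  have out: "mat_mon G \<gamma> j = (j, \<one>)" if "j \<notin> {1..m}" for j using mat_mon_outside[OF \<gamma> that] .
  have ins: "\<gamma> (\<sigma> j) j = Some (snd (mat_mon G \<gamma> j)) \<and> \<sigma> j \<in> {1..m}" if j: "j \<in> {1..m}" for j
  proof -
    obtain i a where ia: "\<gamma> i j = Some a" using full_matE[OF f j] by blast
    then show ?thesis using mat_mon_eqI[OF \<gamma> ia] Gbar_entry[OF \<gamma> ia] by (simp add: \<sigma>_def)
  qed
  have fixd: "\<sigma> j = j" if "j \<notin> {1..m}" for j using out[OF that] by (simp add: \<sigma>_def)
  have "inj \<sigma>"
  proof (rule injI)
    fix x y assume e: "\<sigma> x = \<sigma> y"
    show "x = y"
    proof (cases "x \<in> {1..m}")
      case True
      then have "y \<in> {1..m}" using ins[OF True] fixd[of y] e by metis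
      then show ?thesis using ins[OF True] ins[of y] e Gbar_row[OF \<gamma>] by metis
    next
      case False
      then have "y \<notin> {1..m}" using ins[of y] fixd[OF False] e by metis
      then show ?thesis using fixd False e by metis
    qed
  qed
  moreover have "\<exists>j. \<sigma> j = i" for i
  proof (cases "i \<in> {1..m}")
    case True
    then obtain j a where "\<gamma> i j = Some a" using full_mat_row[OF \<gamma> f] by blast
    then show ?thesis using mat_mon_eqI[OF \<gamma>] by (intro exI[of _ j]) (simp add: \<sigma>_def)
  next
    case False
    then show ?thesis using fixd by blast
  qed
  ultimately have bij: "bij \<sigma>" unfolding bij_def surj_def by metis
  obtain js where js: "js \<in> lists {1..<m}" "adj_perm js = \<sigma>" using adj_perm_surj[OF bij fixd] by blast
  have sc: "snd (mat_mon G \<gamma> j) \<in> carrier G" for j using mat_mon_closed[OF \<gamma>] unfolding monomial_carrier by blast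
  have g: "g \<in> carrier (Gpow G m)" unfolding Gpow_carrier g_def using sc by auto
  have "mon_word G m (GenG g # map GenS js) j = mat_mon G \<gamma> j" for j
  proof -
    have inv: "inv_into UNIV \<sigma> (\<sigma> j) = j" using bij by (simp add: bij_is_inj)
    have "mon_word G m (GenG g # map GenS js) j = (\<sigma> j, (if \<sigma> j \<in> {1..m} then g (\<sigma> j) else \<one>) \<otimes> \<one>)"
      unfolding mon_word_GenG mon_word_map_GenS js(2) by (simp add: monomial_mult mon_diag_def mon_perm_def)
    also have "\<dots> = mat_mon G \<gamma> j"
    proof (cases "j \<in> {1..m}")
      case True
      then show ?thesis using ins[OF True] inv sc[of j] by (simp add: g_def prod_eq_iff \<sigma>_def[symmetric])
    next
      case False
      then show ?thesis using out[OF False] fixd[OF False] by auto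
    qed
    finally show ?thesis .
  qed
  then have "mon_word G m (GenG g # map GenS js) = mat_mon G \<gamma>" by (rule ext)
  moreover have "GenG g # map GenS js \<in> lists (group_gens G m)"
    using g js(1) by (auto simp: group_gens_def)
  ultimately show ?thesis by blast
qed

section \<open>The epimorphism\<close>

text \<open>The graph of the epimorphism before passing to cosets: a noncommutative polynomial a
  stands for \<alpha> if both have the same image at every level. It is a relation because \<alpha>
  determines a only modulo the ideal.\<close>

definition hecke_rel :: "nat \<Rightarrow> ('g, 'f::field) gseq \<Rightarrow> ('g wgen list \<Rightarrow> 'f) \<Rightarrow> bool" where
  "hecke_rel m \<alpha> a \<longleftrightarrow> a \<in> carrier (free_alg (wgens G m)) \<and>
     (\<forall>n \<ge> m. \<alpha> n \<in> carrier (FGbar G n) \<and> mat_proj G n (\<alpha> n) = ma_ext (jm_word G m n) a)"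

lemma const_seq_closed:
  assumes "\<beta> \<in> carrier (FGbar G m)" "m \<le> n"
  shows "(const_seq G m \<beta> n :: _ \<Rightarrow> 'f::field) \<in> carrier (FGbar G n)"
proof -
  have "(ma_ext (\<lambda>\<gamma>. basis_elt (emb_mat G m n \<gamma>)) \<beta> :: _ \<Rightarrow> 'f) \<in> carrier (FGbar G n)"
    by (rule ma_ext_closed[OF assms(1)]) (simp add: basis_closed emb_mat_closed assms(2))
  then show ?thesis using assms(2) by (simp add: const_seq_def lin_ext_eq_ma_ext[OF ma_carrierD[OF assms(1)]])
qed

lemma const_seq_basis: "const_seq G m (basis_elt \<gamma> :: _ \<Rightarrow> 'f::field) = (\<lambda>n\<in>{m..}. basis_elt (emb_mat G m n \<gamma>))"
  by (simp add: const_seq_def lin_ext_eq_ma_ext)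

lemma const_seq_add:
  assumes "\<beta> \<in> carrier (FGbar G m)" "\<beta>' \<in> carrier (FGbar G m)"
  shows "const_seq G m (\<beta> \<oplus>\<^bsub>FGbar G m\<^esub> \<beta>') = const_seq G m \<beta> \<oplus>\<^bsub>Zbar G m\<^esub> (const_seq G m \<beta>' :: ('g, 'f::field) gseq)"
proof
  fix n
  note f = ma_carrierD[OF assms(1)] ma_carrierD[OF assms(2)] ma_carrierD[OF ma_add_closed[OF assms]]
  show "const_seq G m (\<beta> \<oplus>\<^bsub>FGbar G m\<^esub> \<beta>') n = (const_seq G m \<beta> \<oplus>\<^bsub>Zbar G m\<^esub> const_seq G m \<beta>') n"
    unfolding const_seq_def Zbar_def lin_ext_eq_ma_ext[OF f(1)] lin_ext_eq_ma_ext[OF f(2)] lin_ext_eq_ma_ext[OF f(3)]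
    by (simp add: ma_ext_add[OF f(1,2), where N = "Gbar G n"])
qed

lemma const_seq_smult:
  assumes "\<beta> \<in> carrier (FGbar G m)"
  shows "const_seq G m (c \<odot>\<^bsub>FGbar G m\<^esub> \<beta>) = c \<odot>\<^bsub>Zbar G m\<^esub> (const_seq G m \<beta> :: ('g, 'f::field) gseq)"
proof
  fix n
  note f = ma_carrierD[OF assms(1)] ma_carrierD[OF ma_smult_closed[OF assms]]
  show "const_seq G m (c \<odot>\<^bsub>FGbar G m\<^esub> \<beta>) n = (c \<odot>\<^bsub>Zbar G m\<^esub> const_seq G m \<beta>) n"
    unfolding const_seq_def Zbar_def lin_ext_eq_ma_ext[OF f(1)] lin_ext_eq_ma_ext[OF f(2)]
    by (simp add: ma_ext_smult[OF f(1), where N = "Gbar G n"])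
qed

lemma const_seq_basis_mult:
  assumes "\<gamma> \<in> Gbar_set G m" "\<delta> \<in> Gbar_set G m"
  shows "const_seq G m (basis_elt (gmat_mult G m \<gamma> \<delta>)) =
    const_seq G m (basis_elt \<gamma>) \<otimes>\<^bsub>Zbar G m\<^esub> (const_seq G m (basis_elt \<delta>) :: ('g, 'f::field) gseq)"
  using emb_mat_mult[OF assms] unfolding const_seq_basis
  by (intro ext) (simp add: Zbar_def ma_mult_basis)

lemma const_seq_basis_one: "const_seq G m (basis_elt (diag_mat m (\<lambda>_. \<one>))) = (\<one>\<^bsub>Zbar G m\<^esub> :: ('g, 'f::field) gseq)"
  unfolding const_seq_basis using emb_mat_one by (intro ext) (simp add: Zbar_def ma_one)

text \<open>Neither \<open>gen_subalg\<close> nor \<open>alg_hom\<close> mentions zero, so the zero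
  sequence is handled as a scalar multiple.\<close>

lemma const_seq_zero: "const_seq G m (\<lambda>_. 0) = 0 \<odot>\<^bsub>Zbar G m\<^esub> (const_seq G m \<beta> :: ('g, 'f::field) gseq)"
  if "\<beta> \<in> carrier (FGbar G m)"
  using const_seq_smult[OF that, of 0] by (simp add: ma_smult)

context
  fixes m :: nat
begin

abbreviation "wA \<equiv> free_alg (wgens G m)"

lemma hecke_relI:
  assumes "a \<in> carrier wA" "\<And>n. n \<ge> m \<Longrightarrow> \<alpha> n \<in> carrier (FGbar G n)"
    "\<And>n. n \<ge> m \<Longrightarrow> mat_proj G n (\<alpha> n) = ma_ext (jm_word G m n) a"
  shows "hecke_rel m \<alpha> a"
  unfolding hecke_rel_def using assms by blast

lemma hecke_rel_add:
  assumes "hecke_rel m \<alpha> a" "hecke_rel m \<beta> (b :: _ \<Rightarrow> 'f::field)"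
  shows "hecke_rel m (\<alpha> \<oplus>\<^bsub>Zbar G m\<^esub> \<beta>) (a \<oplus>\<^bsub>wA\<^esub> b)"
proof (rule hecke_relI)
  interpret A: ring "wA :: ('f, _) module" by (rule free_alg_ring)
  have ab: "a \<in> carrier wA" "b \<in> carrier wA" using assms unfolding hecke_rel_def by blast+
  show "a \<oplus>\<^bsub>wA\<^esub> b \<in> carrier wA" using ab by (rule A.a_closed)
  fix n assume n: "m \<le> n"
  interpret h: ring_hom_ring "FGbar G n :: ('f, _) module" "mon_alg G" "mat_proj G n" by (rule mat_proj_hom)
  interpret e: ring_hom_ring "wA :: ('f, _) module" "mon_alg G" "ma_ext (jm_word G m n)" by (rule jm_eval_hom(1)[OF n])
  have c: "\<alpha> n \<in> carrier (FGbar G n)" "\<beta> n \<in> carrier (FGbar G n)"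
    and p: "mat_proj G n (\<alpha> n) = ma_ext (jm_word G m n) a" "mat_proj G n (\<beta> n) = ma_ext (jm_word G m n) b"
    using assms n unfolding hecke_rel_def by blast+
  have s: "(\<alpha> \<oplus>\<^bsub>Zbar G m\<^esub> \<beta>) n = \<alpha> n \<oplus>\<^bsub>FGbar G n\<^esub> \<beta> n" using n by (simp add: Zbar_def)
  show "(\<alpha> \<oplus>\<^bsub>Zbar G m\<^esub> \<beta>) n \<in> carrier (FGbar G n)" unfolding s by (rule h.R.a_closed[OF c])
  show "mat_proj G n ((\<alpha> \<oplus>\<^bsub>Zbar G m\<^esub> \<beta>) n) = ma_ext (jm_word G m n) (a \<oplus>\<^bsub>wA\<^esub> b)"
    unfolding s h.hom_add[OF c] e.hom_add[OF ab] p ..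
qed

lemma hecke_rel_mult:
  assumes "hecke_rel m \<alpha> a" "hecke_rel m \<beta> (b :: _ \<Rightarrow> 'f::field)"
  shows "hecke_rel m (\<alpha> \<otimes>\<^bsub>Zbar G m\<^esub> \<beta>) (a \<otimes>\<^bsub>wA\<^esub> b)"
proof (rule hecke_relI)
  interpret A: ring "wA :: ('f, _) module" by (rule free_alg_ring)
  have ab: "a \<in> carrier wA" "b \<in> carrier wA" using assms unfolding hecke_rel_def by blast+
  show "a \<otimes>\<^bsub>wA\<^esub> b \<in> carrier wA" using ab by (rule A.m_closed)
  fix n assume n: "m \<le> n"
  interpret h: ring_hom_ring "FGbar G n :: ('f, _) module" "mon_alg G" "mat_proj G n" by (rule mat_proj_hom)
  interpret e: ring_hom_ring "wA :: ('f, _) module" "mon_alg G" "ma_ext (jm_word G m n)" by (rule jm_eval_hom(1)[OF n])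
  have c: "\<alpha> n \<in> carrier (FGbar G n)" "\<beta> n \<in> carrier (FGbar G n)"
    and p: "mat_proj G n (\<alpha> n) = ma_ext (jm_word G m n) a" "mat_proj G n (\<beta> n) = ma_ext (jm_word G m n) b"
    using assms n unfolding hecke_rel_def by blast+
  have s: "(\<alpha> \<otimes>\<^bsub>Zbar G m\<^esub> \<beta>) n = \<alpha> n \<otimes>\<^bsub>FGbar G n\<^esub> \<beta> n" using n by (simp add: Zbar_def)
  show "(\<alpha> \<otimes>\<^bsub>Zbar G m\<^esub> \<beta>) n \<in> carrier (FGbar G n)" unfolding s by (rule h.R.m_closed[OF c])
  show "mat_proj G n ((\<alpha> \<otimes>\<^bsub>Zbar G m\<^esub> \<beta>) n) = ma_ext (jm_word G m n) (a \<otimes>\<^bsub>wA\<^esub> b)"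
    unfolding s h.hom_mult[OF c] e.hom_mult[OF ab] p ..
qed

lemma hecke_rel_smult:
  assumes "hecke_rel m \<alpha> (a :: _ \<Rightarrow> 'f::field)"
  shows "hecke_rel m (c \<odot>\<^bsub>Zbar G m\<^esub> \<alpha>) (c \<odot>\<^bsub>wA\<^esub> a)"
proof (rule hecke_relI)
  have a: "a \<in> carrier wA" using assms unfolding hecke_rel_def by blast
  show "c \<odot>\<^bsub>wA\<^esub> a \<in> carrier wA" using a by (rule ma_smult_closed)
  fix n assume n: "m \<le> n"
  have c: "\<alpha> n \<in> carrier (FGbar G n)" and p: "mat_proj G n (\<alpha> n) = ma_ext (jm_word G m n) a"
    using assms n unfolding hecke_rel_def by blast+
  have s: "(c \<odot>\<^bsub>Zbar G m\<^esub> \<alpha>) n = c \<odot>\<^bsub>FGbar G n\<^esub> \<alpha> n" using n by (simp add: Zbar_def)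
  show "(c \<odot>\<^bsub>Zbar G m\<^esub> \<alpha>) n \<in> carrier (FGbar G n)" unfolding s by (rule ma_smult_closed[OF c])
  have "mat_proj G n (c \<odot>\<^bsub>FGbar G n\<^esub> \<alpha> n) = c \<odot>\<^bsub>mon_alg G\<^esub> mat_proj G n (\<alpha> n)"
    unfolding mat_proj_def by (rule ma_ext_smult[OF ma_carrierD[OF c]])
  then show "mat_proj G n ((c \<odot>\<^bsub>Zbar G m\<^esub> \<alpha>) n) = ma_ext (jm_word G m n) (c \<odot>\<^bsub>wA\<^esub> a)"
    unfolding s p by (simp add: p ma_ext_smult[OF ma_carrierD[OF a], where N = "monomial G"])
qed

text \<open>Both images are the basis element at the matrix of v, at every level.\<close>

lemma hecke_rel_group_word:
  assumes v: "v \<in> lists (group_gens G m)" and \<gamma>: "\<gamma> \<in> Gbar_set G m" "full_mat m \<gamma>" "mat_mon G \<gamma> = mon_word G m v"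
  shows "hecke_rel m (const_seq G m (basis_elt \<gamma>)) (basis_elt v :: _ \<Rightarrow> 'f::field)"
proof (rule hecke_relI)
  have "group_gens G m \<subseteq> wgens G m" by (auto simp: group_gens_def wgens_def)
  then have "v \<in> lists (wgens G m)" using v lists_mono by blast
  then show "(basis_elt v :: _ \<Rightarrow> 'f) \<in> carrier wA" by (intro basis_closed) simp
  fix n assume n: "m \<le> n"
  show "(const_seq G m (basis_elt \<gamma>) n :: _ \<Rightarrow> 'f) \<in> carrier (FGbar G n)"
    using \<gamma>(1) n by (intro const_seq_closed basis_closed) simp_all
  have 1: "mat_proj G n (const_seq G m (basis_elt \<gamma>) n) = (basis_elt (mon_word G m v) :: _ \<Rightarrow> 'f)"
    unfolding const_seq_basis using n \<gamma> emb_mat_mon[OF \<gamma>(1) n] by (simp add: mat_proj_basis)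
  have 2: "ma_ext (jm_word G m n) (basis_elt v) = (basis_elt (mon_word G m v) :: _ \<Rightarrow> 'f)"
    using jm_word_mixed[OF n v, of "[]"] by (simp add: jm_prod_def)
  show "mat_proj G n (const_seq G m (basis_elt \<gamma>) n) = ma_ext (jm_word G m n) (basis_elt v :: _ \<Rightarrow> 'f)"
    unfolding 1 2 ..
qed

lemma hecke_rel_not_full:
  assumes \<gamma>: "\<gamma> \<in> Gbar_set G m" "\<not> full_mat m \<gamma>"
  shows "hecke_rel m (const_seq G m (basis_elt \<gamma>)) (\<zero>\<^bsub>wA\<^esub> :: _ \<Rightarrow> 'f::field)"
proof (rule hecke_relI)
  interpret A: ring "wA :: ('f, _) module" by (rule free_alg_ring)
  show "(\<zero>\<^bsub>wA\<^esub> :: _ \<Rightarrow> 'f) \<in> carrier wA" by (rule A.zero_closed)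
  fix n assume n: "m \<le> n"
  interpret e: ring_hom_ring "wA :: ('f, _) module" "mon_alg G" "ma_ext (jm_word G m n)" by (rule jm_eval_hom(1)[OF n])
  show "(const_seq G m (basis_elt \<gamma>) n :: _ \<Rightarrow> 'f) \<in> carrier (FGbar G n)"
    using \<gamma>(1) n by (intro const_seq_closed basis_closed) simp_all
  have "mat_proj G n (const_seq G m (basis_elt \<gamma>) n) = (\<zero>\<^bsub>mon_alg G\<^esub> :: _ \<Rightarrow> 'f)"
    unfolding const_seq_basis ma_zero using n \<gamma> emb_mat_mon[OF \<gamma>(1) n] by (simp add: mat_proj_basis)
  then show "mat_proj G n (const_seq G m (basis_elt \<gamma>) n) = ma_ext (jm_word G m n) (\<zero>\<^bsub>wA\<^esub> :: _ \<Rightarrow> 'f)"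
    unfolding e.hom_zero .
qed

lemma hecke_rel_u:
  assumes l: "l \<in> {1..m}"
  shows "hecke_rel m (u_seq G m l) (letter (GenX l) :: _ \<Rightarrow> 'f::field)"
proof (rule hecke_relI)
  show "(letter (GenX l) :: _ \<Rightarrow> 'f) \<in> carrier wA" using l by (intro letter_closed) (simp del: One_nat_def)
  fix n assume n: "m \<le> n"
  have l': "l \<in> {1..n}" using l n by simp
  have u: "u_seq G m l n = (u_elt G n l :: _ \<Rightarrow> 'f)" using n by (simp add: u_seq_def)
  show "(u_seq G m l n :: _ \<Rightarrow> 'f) \<in> carrier (FGbar G n)" unfolding u by (rule mat_proj_u(2)[OF l'])
  interpret B: ring "mon_alg G :: ('f, _) module" by (rule mon_alg_ring)
  have "jm_word G m n [GenX l] = (jm_prod G n [l] \<one>\<^bsub>monomial G\<^esub> :: _ \<Rightarrow> 'f)"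
    using jm_word_mixed[OF n, of "[]" "[l]"] by simp
  also have "\<dots> = jm G n l \<star> \<one>\<^bsub>mon_alg G\<^esub>" by (simp add: jm_prod_def ma_one)
  also have "\<dots> = jm G n l" by (rule B.r_one[OF jm_closed])
  finally show "mat_proj G n (u_seq G m l n) = ma_ext (jm_word G m n) (letter (GenX l) :: _ \<Rightarrow> 'f)"
    unfolding u mat_proj_u(1)[OF l'] ma_ext_basis by simp
qed

lemma hecke_rel_generators:
  "g \<in> carrier (Gpow G m) \<Longrightarrow> hecke_rel m (Hbar_g G m g) (letter (GenG g) :: _ \<Rightarrow> 'f::field)"
  "i \<in> {1..<m} \<Longrightarrow> hecke_rel m (Hbar_s G m i) (letter (GenS i) :: _ \<Rightarrow> 'f::field)"
  "l \<in> {1..m} \<Longrightarrow> hecke_rel m (Hbar_eps G m l) (\<zero>\<^bsub>wA\<^esub> :: _ \<Rightarrow> 'f::field)"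
proof -
  show "hecke_rel m (Hbar_g G m g) (letter (GenG g) :: _ \<Rightarrow> 'f)" if g: "g \<in> carrier (Gpow G m)"
  proof -
    have gi: "\<And>i. i \<in> {1..m} \<Longrightarrow> g i \<in> carrier G" using g by (auto simp: Gpow_carrier)
    have "mon_word G m [GenG g] = mon_diag G m g"
      unfolding mon_word_GenG mon_word_Nil by (rule M.r_one[OF mon_diag_closed[OF g]])
    moreover have "[GenG g] \<in> lists (group_gens G m)" using g by (simp add: group_gens_def)
    ultimately show ?thesis unfolding Hbar_g_def
      using diag_mat_closed[OF gi] mat_mon_diag[OF gi] by (intro hecke_rel_group_word) simp_all
  qed
  show "hecke_rel m (Hbar_s G m i) (letter (GenS i) :: _ \<Rightarrow> 'f)" if i: "i \<in> {1..<m}"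
  proof -
    have ii: "i \<in> {1..m}" "i + 1 \<in> {1..m}" using i by auto
    have "mon_word G m [GenS i] = mon_perm G (transpose i (i+1))"
      unfolding mon_word_GenS mon_word_Nil by (rule M.r_one[OF mon_perm_closed])
    moreover have "[GenS i] \<in> lists (group_gens G m)" using i by (simp add: group_gens_def)
    ultimately show ?thesis unfolding Hbar_s_def
      using mat_mon_perm[OF ii] by (intro hecke_rel_group_word) simp_all
  qed
  show "hecke_rel m (Hbar_eps G m l) (\<zero>\<^bsub>wA\<^esub> :: _ \<Rightarrow> 'f)" if "l \<in> {1..m}"
    unfolding Hbar_eps_def by (rule hecke_rel_not_full[OF eps_mat_closed eps_mat_not_full[OF that]])
qed

end

end

lemma Hbar_simps:
  "carrier (Hbar G m :: ('f::field, _) module)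
    = gen_subalg (Zbar G m) (const_seq G m ` carrier (FGbar G m) \<union> u_seq G m ` {1..m})"
  "x \<otimes>\<^bsub>Hbar G m\<^esub> y = x \<otimes>\<^bsub>Zbar G m\<^esub> y" "x \<oplus>\<^bsub>Hbar G m\<^esub> y = x \<oplus>\<^bsub>Zbar G m\<^esub> y"
  "\<one>\<^bsub>Hbar G m\<^esub> = \<one>\<^bsub>Zbar G m\<^esub>" "c \<odot>\<^bsub>Hbar G m\<^esub> x = c \<odot>\<^bsub>Zbar G m\<^esub> x"
  by (simp_all add: Hbar_def)

lemma Hbar_closed:
  "\<one>\<^bsub>Zbar G m\<^esub> \<in> carrier (Hbar G m :: ('f::field, ('g, 'f) gseq) module)"
  "x \<in> carrier (Hbar G m) \<Longrightarrow> y \<in> carrier (Hbar G m) \<Longrightarrow> x \<otimes>\<^bsub>Zbar G m\<^esub> y \<in> carrier (Hbar G m)"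
  "x \<in> carrier (Hbar G m) \<Longrightarrow> y \<in> carrier (Hbar G m) \<Longrightarrow> x \<oplus>\<^bsub>Zbar G m\<^esub> y \<in> carrier (Hbar G m)"
  "x \<in> carrier (Hbar G m) \<Longrightarrow> c \<odot>\<^bsub>Zbar G m\<^esub> x \<in> carrier (Hbar G m)"
  "\<beta> \<in> carrier (FGbar G m) \<Longrightarrow> const_seq G m \<beta> \<in> carrier (Hbar G m)"
  "l \<in> {1..m} \<Longrightarrow> u_seq G m l \<in> carrier (Hbar G m)"
  unfolding Hbar_simps by (blast intro: gen_subalg.intros)+

lemma wreath_Hecke_simps:
  "carrier (wreath_Hecke G m) = carrier (free_alg (wgens G m) Quot wreath_Hecke_ideal G m)"
  "x \<otimes>\<^bsub>wreath_Hecke G m\<^esub> y = x \<otimes>\<^bsub>free_alg (wgens G m) Quot wreath_Hecke_ideal G m\<^esub> y"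
  "x \<oplus>\<^bsub>wreath_Hecke G m\<^esub> y = x \<oplus>\<^bsub>free_alg (wgens G m) Quot wreath_Hecke_ideal G m\<^esub> y"
  "\<one>\<^bsub>wreath_Hecke G m\<^esub> = \<one>\<^bsub>free_alg (wgens G m) Quot wreath_Hecke_ideal G m\<^esub>"
  "\<zero>\<^bsub>wreath_Hecke G m\<^esub> = (wreath_Hecke_ideal G m :: ('g wgen list \<Rightarrow> 'f::field) set)"
  by (simp_all add: wreath_Hecke_def quot_alg_def FactRing_def)

lemma alg_homD:
  assumes "\<Phi> \<in> alg_hom A B"
  shows "x \<in> carrier A \<Longrightarrow> y \<in> carrier A \<Longrightarrow> \<Phi> (x \<otimes>\<^bsub>A\<^esub> y) = \<Phi> x \<otimes>\<^bsub>B\<^esub> \<Phi> y"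
    "x \<in> carrier A \<Longrightarrow> y \<in> carrier A \<Longrightarrow> \<Phi> (x \<oplus>\<^bsub>A\<^esub> y) = \<Phi> x \<oplus>\<^bsub>B\<^esub> \<Phi> y"
    "\<Phi> \<one>\<^bsub>A\<^esub> = \<one>\<^bsub>B\<^esub>" "x \<in> carrier A \<Longrightarrow> \<Phi> (c \<odot>\<^bsub>A\<^esub> x) = c \<odot>\<^bsub>B\<^esub> \<Phi> x"
  using assms by (auto simp: alg_hom_def ring_hom_def)

section \<open>Generation of the algebra, and agreement of homomorphisms on generators\<close>

context finite_group begin

text \<open>If column j is zero, then so is some row i. Putting 1 at (i, j) gives a matrix \<delta>
  with fewer zero columns, and \<gamma> = \<delta> \<epsilon>_j. So every matrix is a nonsingular
  one times a product of \<epsilon>_l.\<close>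

lemma gmat_singular_induct:
  assumes \<gamma>: "\<gamma> \<in> Gbar_set G m"
    and full: "\<And>\<gamma>. \<gamma> \<in> Gbar_set G m \<Longrightarrow> full_mat m \<gamma> \<Longrightarrow> P \<gamma>"
    and eps: "\<And>\<gamma> l. \<gamma> \<in> Gbar_set G m \<Longrightarrow> l \<in> {1..m} \<Longrightarrow> P \<gamma> \<Longrightarrow> P (gmat_mult G m \<gamma> (eps_mat G m l))"
  shows "P \<gamma>"
  using \<gamma>
proof (induction "card {j \<in> {1..m}. \<forall>i. \<gamma> i j = None}" arbitrary: \<gamma> rule: less_induct)
  case (less \<gamma>)
  show ?case
  proof (cases "full_mat m \<gamma>")
    case True
    then show ?thesis using full less.prems by blast
  next
    case False
    then obtain j where j: "j \<in> {1..m}" "\<And>i. \<gamma> i j = None" unfolding full_mat_def by blast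
    \<comment> \<open>Without a zero row, choosing a column with an entry for each row gives an
      injection of \<open>{1..m}\<close> into itself, hence a surjection, and it would hit the zero
      column j.\<close>
    obtain i where i: "i \<in> {1..m}" "\<And>j. \<gamma> i j = None"
    proof (rule ccontr)
      assume "\<not> thesis"
      then have "\<forall>i \<in> {1..m}. \<exists>j a. \<gamma> i j = Some a" using that by (metis option.exhaust)
      then obtain c where c: "\<And>i. i \<in> {1..m} \<Longrightarrow> \<exists>a. \<gamma> i (c i) = Some a" by metis
      have "inj_on c {1..m}" 
      proof (rule inj_onI)
        fix x y assume "x \<in> {1..m}" "y \<in> {1..m}" "c x = c y"
        then show "x = y" using c[of x] c[of y] Gbar_col[OF less.prems] by metis
      qed
      moreover have "c ` {1..m} \<subseteq> {1..m}"
      proof (rule image_subsetI)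
        fix x assume "x \<in> {1..m}"
        then show "c x \<in> {1..m}" using c[of x] Gbar_entry[OF less.prems] by blast
      qed
      ultimately have "c ` {1..m} = {1..m}" by (intro endo_inj_surj) auto
      then obtain x where "x \<in> {1..m}" "c x = j" using j(1) by (metis imageE)
      then show False using c[of x] j(2)[of x] by auto
    qed
    define \<delta> where "\<delta> = (\<lambda>a b. if a = i \<and> b = j then Some \<one> else \<gamma> a b)"
    have e: "\<delta> a b = Some c \<longleftrightarrow> a = i \<and> b = j \<and> c = \<one> \<or> \<gamma> a b = Some c" for a b c
      using i(2)[of j] by (auto simp: \<delta>_def)
    have \<delta>: "\<delta> \<in> Gbar_set G m"
    proof (rule Gbar_setI)
      fix a b c assume "\<delta> a b = Some c"
      then show "a \<in> {1..m} \<and> b \<in> {1..m} \<and> c \<in> carrier G"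
        unfolding e using i(1) j(1) Gbar_entry[OF less.prems, of a b c] by auto
    next
      fix a b b' c c' assume "\<delta> a b = Some c" "\<delta> a b' = Some c'"
      then show "b = b'" unfolding e using i(2)[of b] i(2)[of b'] Gbar_row[OF less.prems, of a b c b' c'] by auto
    next
      fix a a' b c c' assume "\<delta> a b = Some c" "\<delta> a' b = Some c'"
      then show "a = a'" unfolding e using j(2)[of a] j(2)[of a'] Gbar_col[OF less.prems, of a b c a' c'] by auto
    qed
    have "\<gamma> = gmat_mult G m \<delta> (eps_mat G m j)"
    proof (rule gmat_eqI)
      fix a b c
      show "\<gamma> a b = Some c \<longleftrightarrow> gmat_mult G m \<delta> (eps_mat G m j) a b = Some c"
      proof
        assume ab: "\<gamma> a b = Some c"
        then have "b \<noteq> j" using j(2)[of a] by auto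
        moreover have "b \<in> {1..m}" "c \<in> carrier G" using Gbar_entry[OF less.prems ab] by blast+
        ultimately have "\<delta> a b = Some c" "eps_mat G m j b b = Some \<one>" "c = c \<otimes> \<one>"
          using ab by (simp_all add: e eps_mat_eq_Some)
        then show "gmat_mult G m \<delta> (eps_mat G m j) a b = Some c" unfolding gmat_mult_eq_Some[OF \<delta>] by blast
      next
        assume "gmat_mult G m \<delta> (eps_mat G m j) a b = Some c"
        then obtain k x y where k: "\<delta> a k = Some x" "eps_mat G m j k b = Some y" "c = x \<otimes> y"
          unfolding gmat_mult_eq_Some[OF \<delta>] by blast
        then have "k = b" "b \<noteq> j" "y = \<one>" unfolding eps_mat_eq_Some by simp_all
        then show "\<gamma> a b = Some c" using k(1,3) Gbar_entry[OF \<delta> k(1)] by (simp add: e)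
      qed
    qed
    moreover have "card {k \<in> {1..m}. \<forall>i. \<delta> i k = None} < card {k \<in> {1..m}. \<forall>i. \<gamma> i k = None}"
    proof (rule psubset_card_mono)
      have "{k \<in> {1..m}. \<forall>i. \<delta> i k = None} \<subseteq> {k \<in> {1..m}. \<forall>i. \<gamma> i k = None} - {j}"
      proof (intro subsetI DiffI)
        fix k assume k: "k \<in> {k \<in> {1..m}. \<forall>i. \<delta> i k = None}"
        then have n: "\<delta> a k = None" for a by blast
        have "\<gamma> a k = None" for a using n[of a] by (simp add: \<delta>_def split: if_splits)
        then show "k \<in> {k \<in> {1..m}. \<forall>i. \<gamma> i k = None}" using k by blast
        show "k \<notin> {j}" using n[of i] by (auto simp: \<delta>_def)
      qed
      moreover have "j \<in> {k \<in> {1..m}. \<forall>i. \<gamma> i k = None}" using j by blast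
      ultimately show "{k \<in> {1..m}. \<forall>i. \<delta> i k = None} \<subset> {k \<in> {1..m}. \<forall>i. \<gamma> i k = None}" by blast
    qed simp
    ultimately show ?thesis using less.hyps[OF _ \<delta>] eps[OF \<delta> j(1)] by metis
  qed
qed

context
  fixes m :: nat
begin

lemma const_basis_closed:
  "\<gamma> \<in> Gbar_set G m \<Longrightarrow> const_seq G m (basis_elt \<gamma>) \<in> carrier (Hbar G m :: ('f::field, _) module)"
  by (rule Hbar_closed(5)) (simp add: basis_closed)

text \<open>The elements on which agreement is assumed generate: nonsingular matrices are products
  of diagonal ones and adjacent transpositions, singular ones arise by multiplying with
  \<epsilon>_l, and linearity and the closure rules of \<open>gen_subalg\<close> do the rest. This
  is the uniqueness half.\<close>

lemma alg_hom_Hbar_eqI: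
  fixes \<Phi> \<Psi> :: "('g, 'f::field) gseq \<Rightarrow> 'c"
  assumes \<Phi>: "\<Phi> \<in> alg_hom (Hbar G m) B" and \<Psi>: "\<Psi> \<in> alg_hom (Hbar G m) B"
    and g: "\<And>g. g \<in> carrier (Gpow G m) \<Longrightarrow> \<Phi> (Hbar_g G m g) = \<Psi> (Hbar_g G m g)"
    and s: "\<And>k. k \<in> {1..<m} \<Longrightarrow> \<Phi> (Hbar_s G m k) = \<Psi> (Hbar_s G m k)"
    and u: "\<And>l. l \<in> {1..m} \<Longrightarrow> \<Phi> (u_seq G m l) = \<Psi> (u_seq G m l)"
    and eps: "\<And>l. l \<in> {1..m} \<Longrightarrow> \<Phi> (Hbar_eps G m l) = \<Psi> (Hbar_eps G m l)"
    and \<alpha>: "\<alpha> \<in> carrier (Hbar G m)"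
  shows "\<Phi> \<alpha> = \<Psi> \<alpha>"
proof -
  let ?c = "\<lambda>\<gamma>. const_seq G m (basis_elt \<gamma>) :: ('g, 'f) gseq"
  have hmult: "\<Phi> (x \<otimes>\<^bsub>Zbar G m\<^esub> y) = \<Psi> (x \<otimes>\<^bsub>Zbar G m\<^esub> y)"
    if "x \<in> carrier (Hbar G m)" "y \<in> carrier (Hbar G m)" "\<Phi> x = \<Psi> x" "\<Phi> y = \<Psi> y" for x y
    using alg_homD(1)[OF \<Phi> that(1,2)] alg_homD(1)[OF \<Psi> that(1,2)] that(3,4) by (simp add: Hbar_simps)
  have hadd: "\<Phi> (x \<oplus>\<^bsub>Zbar G m\<^esub> y) = \<Psi> (x \<oplus>\<^bsub>Zbar G m\<^esub> y)"
    if "x \<in> carrier (Hbar G m)" "y \<in> carrier (Hbar G m)" "\<Phi> x = \<Psi> x" "\<Phi> y = \<Psi> y" for x y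
    using alg_homD(2)[OF \<Phi> that(1,2)] alg_homD(2)[OF \<Psi> that(1,2)] that(3,4) by (simp add: Hbar_simps)
  have hsmult: "\<Phi> (c \<odot>\<^bsub>Zbar G m\<^esub> x) = \<Psi> (c \<odot>\<^bsub>Zbar G m\<^esub> x)"
    if "x \<in> carrier (Hbar G m)" "\<Phi> x = \<Psi> x" for c x
    using alg_homD(4)[OF \<Phi> that(1)] alg_homD(4)[OF \<Psi> that(1)] that(2) by (simp add: Hbar_simps)
  have hone: "\<Phi> \<one>\<^bsub>Zbar G m\<^esub> = \<Psi> \<one>\<^bsub>Zbar G m\<^esub>"
    using alg_homD(3)[OF \<Phi>] alg_homD(3)[OF \<Psi>] by (simp add: Hbar_simps)
  have cmult: "\<Phi> (?c (gmat_mult G m \<gamma> \<delta>)) = \<Psi> (?c (gmat_mult G m \<gamma> \<delta>))"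
    if "\<gamma> \<in> Gbar_set G m" "\<delta> \<in> Gbar_set G m" "\<Phi> (?c \<gamma>) = \<Psi> (?c \<gamma>)" "\<Phi> (?c \<delta>) = \<Psi> (?c \<delta>)" for \<gamma> \<delta>
    unfolding const_seq_basis_mult[OF that(1,2)]
    by (rule hmult[OF const_basis_closed[OF that(1)] const_basis_closed[OF that(2)] that(3,4)])
  \<comment> \<open>Agreement is obtained for some matrix with the monomial map of v;
    \<open>mat_mon_inject\<close> later identifies it with the given one.\<close>
  have words: "\<exists>\<gamma> \<in> Gbar_set G m. full_mat m \<gamma> \<and> mat_mon G \<gamma> = mon_word G m v \<and> \<Phi> (?c \<gamma>) = \<Psi> (?c \<gamma>)"
    if "v \<in> lists (group_gens G m)" for v
    using that
  proof (induction v)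
    case Nil
    have "mon_diag G m (\<lambda>_. \<one>) = \<one>\<^bsub>monomial G\<^esub>" by (auto simp: mon_diag_def monomial_one)
    then show ?case
      using diag_mat_closed[of m "\<lambda>_. \<one>"] mat_mon_diag[of m "\<lambda>_. \<one>"] hone const_seq_basis_one[where 'f = 'f, of m]
      by (intro bexI[of _ "diag_mat m (\<lambda>_. \<one>)"]) simp_all
  next
    case (Cons a v)
    then obtain \<delta> where \<delta>: "\<delta> \<in> Gbar_set G m" "full_mat m \<delta>" "mat_mon G \<delta> = mon_word G m v" "\<Phi> (?c \<delta>) = \<Psi> (?c \<delta>)"
      by blast
    have step: ?case if "\<gamma> \<in> Gbar_set G m" "full_mat m \<gamma>" "\<Phi> (?c \<gamma>) = \<Psi> (?c \<gamma>)"
      "mon_word G m (a # v) = mat_mon G \<gamma> \<cdot> mon_word G m v" for \<gamma>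
      using that \<delta> gmat_mult_closed[OF that(1) \<delta>(1)] full_mat_mult[OF that(1) \<delta>(1)]
        mat_mon_mult[OF that(1) \<delta>(1) that(2) \<delta>(2)] cmult[OF that(1) \<delta>(1) that(3) \<delta>(4)]
      by (intro bexI[of _ "gmat_mult G m \<gamma> \<delta>"]) simp_all
    from Cons.hyps(1) consider h where "h \<in> carrier (Gpow G m)" "a = GenG h" | k where "k \<in> {1..<m}" "a = GenS k"
      by (auto simp: group_gens_def)
    then show ?case
    proof cases
      case (1 h)
      then have h: "\<And>i. i \<in> {1..m} \<Longrightarrow> h i \<in> carrier G" by (auto simp: Gpow_carrier)
      show ?thesis using g[OF 1(1)] mat_mon_diag[OF h] unfolding Hbar_g_def
        by (intro step[of "diag_mat m h"] diag_mat_closed h) (simp_all add: 1(2) mon_word_GenG)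
    next
      case (2 k)
      then have k: "k \<in> {1..m}" "k + 1 \<in> {1..m}" by auto
      show ?thesis using s[OF 2(1)] mat_mon_perm[OF k] unfolding Hbar_s_def
        by (intro step[of "perm_mat G m (transpose k (k+1))"]) (simp_all only: 2(2) mon_word_GenS)
    qed
  qed
  have basis: "\<Phi> (?c \<gamma>) = \<Psi> (?c \<gamma>)" if "\<gamma> \<in> Gbar_set G m" for \<gamma>
    using that
  proof (rule gmat_singular_induct)
    fix \<gamma> assume \<gamma>: "\<gamma> \<in> Gbar_set G m" "full_mat m \<gamma>"
    obtain v where v: "v \<in> lists (group_gens G m)" "mon_word G m v = mat_mon G \<gamma>"
      using mat_mon_group_word[OF \<gamma>] by blast
    obtain \<delta> where \<delta>: "\<delta> \<in> Gbar_set G m" "full_mat m \<delta>" "mat_mon G \<delta> = mon_word G m v" "\<Phi> (?c \<delta>) = \<Psi> (?c \<delta>)"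
      using words[OF v(1)] by blast
    have "\<gamma> = \<delta>" using mat_mon_inject[OF \<gamma>(1) \<delta>(1) \<gamma>(2) \<delta>(2)] \<delta>(3) v(2) by simp
    then show "\<Phi> (?c \<gamma>) = \<Psi> (?c \<gamma>)" using \<delta>(4) by simp
  next
    fix \<gamma> l assume "\<gamma> \<in> Gbar_set G m" "l \<in> {1..m}" "\<Phi> (?c \<gamma>) = \<Psi> (?c \<gamma>)"
    then show "\<Phi> (?c (gmat_mult G m \<gamma> (eps_mat G m l))) = \<Psi> (?c (gmat_mult G m \<gamma> (eps_mat G m l)))"
      using eps unfolding Hbar_eps_def by (intro cmult eps_mat_closed)
  qed
  have const: "\<Phi> (const_seq G m \<beta>) = \<Psi> (const_seq G m \<beta>)" if "\<beta> \<in> carrier (FGbar G m)" for \<beta>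
    using that
  proof (rule ma_span[where P = "\<lambda>\<beta>. \<Phi> (const_seq G m \<beta>) = \<Psi> (const_seq G m \<beta>)"])
    have o: "diag_mat m (\<lambda>_. \<one>) \<in> Gbar_set G m" by (rule diag_mat_closed) simp
    then have ob: "(basis_elt (diag_mat m (\<lambda>_. \<one>)) :: _ \<Rightarrow> 'f) \<in> carrier (FGbar G m)" by (simp add: basis_closed)
    show "\<Phi> (const_seq G m (\<lambda>x. 0)) = \<Psi> (const_seq G m (\<lambda>x. 0))"
      unfolding const_seq_zero[OF ob] by (rule hsmult[OF const_basis_closed[OF o] basis[OF o]])
  next
    fix \<beta> \<beta>' :: "'g gmat \<Rightarrow> 'f"
    assume b: "\<beta> \<in> carrier (FGbar G m)" "\<beta>' \<in> carrier (FGbar G m)"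
      "\<Phi> (const_seq G m \<beta>) = \<Psi> (const_seq G m \<beta>)" "\<Phi> (const_seq G m \<beta>') = \<Psi> (const_seq G m \<beta>')"
    show "\<Phi> (const_seq G m (\<beta> \<oplus>\<^bsub>FGbar G m\<^esub> \<beta>')) = \<Psi> (const_seq G m (\<beta> \<oplus>\<^bsub>FGbar G m\<^esub> \<beta>'))"
      unfolding const_seq_add[OF b(1,2)] by (rule hadd[OF Hbar_closed(5)[OF b(1)] Hbar_closed(5)[OF b(2)] b(3,4)])
  next
    fix c :: 'f and \<gamma> assume "\<gamma> \<in> carrier (Gbar G m)"
    then have \<gamma>: "\<gamma> \<in> Gbar_set G m" by simp
    then have b: "(basis_elt \<gamma> :: _ \<Rightarrow> 'f) \<in> carrier (FGbar G m)" by (simp add: basis_closed)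
    show "\<Phi> (const_seq G m (c \<odot>\<^bsub>FGbar G m\<^esub> basis_elt \<gamma>)) = \<Psi> (const_seq G m (c \<odot>\<^bsub>FGbar G m\<^esub> basis_elt \<gamma>))"
      unfolding const_seq_smult[OF b] by (rule hsmult[OF const_basis_closed[OF \<gamma>] basis[OF \<gamma>]])
  qed
  from \<alpha> show ?thesis
    unfolding Hbar_simps
  proof (induction rule: gen_subalg.induct)
    case (gen x)
    then show ?case
    proof (elim UnE imageE)
      fix \<beta> :: "'g gmat \<Rightarrow> 'f" assume "x = const_seq G m \<beta>" "\<beta> \<in> carrier (FGbar G m)"
      then show "\<Phi> x = \<Psi> x" using const by simp
    next
      fix l assume "x = u_seq G m l" "l \<in> {1..m}"
      then show "\<Phi> x = \<Psi> x" using u by simp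
    qed
  next
    case (add x y)
    show ?case by (rule hadd[unfolded Hbar_simps, OF add.hyps add.IH])
  next
    case (mult x y)
    show ?case by (rule hmult[unfolded Hbar_simps, OF mult.hyps mult.IH])
  next
    case (smult x c)
    show ?case by (rule hsmult[unfolded Hbar_simps, OF smult.hyps smult.IH])
  qed (rule hone)
qed

section \<open>Totality of the correspondence and the map it induces\<close>

lemma hecke_rel_one: "hecke_rel m \<one>\<^bsub>Zbar G m\<^esub> (\<one>\<^bsub>wA m\<^esub> :: _ \<Rightarrow> 'f::field)"
proof -
  have o: "diag_mat m (\<lambda>_. \<one>) \<in> Gbar_set G m" by (rule diag_mat_closed) simp
  have "mon_diag G m (\<lambda>_. \<one>) = mon_word G m []" by (auto simp: mon_diag_def monomial_one)
  then have "hecke_rel m (const_seq G m (basis_elt (diag_mat m (\<lambda>_. \<one>)))) (basis_elt [] :: _ \<Rightarrow> 'f)"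
    using mat_mon_diag[of m "\<lambda>_. \<one>"] o by (intro hecke_rel_group_word) simp_all
  then show ?thesis unfolding const_seq_basis_one ma_one free_monoid_simps .
qed

lemma hecke_rel_const:
  fixes \<beta> :: "'g gmat \<Rightarrow> 'f::field"
  assumes "\<beta> \<in> carrier (FGbar G m)"
  shows "\<exists>a. hecke_rel m (const_seq G m \<beta>) a"
  using assms
proof (rule ma_span[where P = "\<lambda>\<beta>. \<exists>a. hecke_rel m (const_seq G m \<beta>) a"])
  have "(basis_elt (diag_mat m (\<lambda>_. \<one>)) :: _ \<Rightarrow> 'f) \<in> carrier (FGbar G m)"
    by (rule basis_closed) (simp add: diag_mat_closed)
  then show "\<exists>a. hecke_rel m (const_seq G m (\<lambda>x. 0 :: 'f)) a"
    using hecke_rel_smult[OF hecke_rel_one] const_seq_zero const_seq_basis_one by metis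
next
  fix \<beta> \<beta>' :: "'g gmat \<Rightarrow> 'f"
  assume b: "\<beta> \<in> carrier (FGbar G m)" "\<beta>' \<in> carrier (FGbar G m)"
    "\<exists>a. hecke_rel m (const_seq G m \<beta>) a" "\<exists>a. hecke_rel m (const_seq G m \<beta>') a"
  then show "\<exists>a. hecke_rel m (const_seq G m (\<beta> \<oplus>\<^bsub>FGbar G m\<^esub> \<beta>')) a"
    unfolding const_seq_add[OF b(1,2)] using hecke_rel_add by blast
next
  fix c :: 'f and \<gamma> assume "\<gamma> \<in> carrier (Gbar G m)"
  then have \<gamma>: "\<gamma> \<in> Gbar_set G m" by simp
  then have b: "(basis_elt \<gamma> :: _ \<Rightarrow> 'f) \<in> carrier (FGbar G m)" by (simp add: basis_closed)
  have "\<exists>a. hecke_rel m (const_seq G m (basis_elt \<gamma> :: _ \<Rightarrow> 'f)) a"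
  proof (cases "full_mat m \<gamma>")
    case True
    then obtain v where "v \<in> lists (group_gens G m)" "mon_word G m v = mat_mon G \<gamma>"
      using mat_mon_group_word[OF \<gamma>] by blast
    then show ?thesis using hecke_rel_group_word[OF _ \<gamma> True] by metis
  next
    case False
    then show ?thesis using hecke_rel_not_full[OF \<gamma>] by blast
  qed
  then show "\<exists>a. hecke_rel m (const_seq G m (c \<odot>\<^bsub>FGbar G m\<^esub> basis_elt \<gamma>)) a"
    unfolding const_seq_smult[OF b] using hecke_rel_smult by blast
qed

text \<open>Every generator has a partner and the correspondence respects the algebra operations, so
  the map will be defined on the whole carrier.\<close>

lemma hecke_rel_left_total:
  assumes "\<alpha> \<in> carrier (Hbar G m)"
  shows "\<exists>a. hecke_rel m \<alpha> (a :: _ \<Rightarrow> 'f::field)"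
  using assms unfolding Hbar_simps
proof (induction rule: gen_subalg.induct)
  case (gen x)
  then show ?case using hecke_rel_const hecke_rel_u by blast
next
  case one
  then show ?case using hecke_rel_one by blast
next
  case (add x y)
  then show ?case using hecke_rel_add by blast
next
  case (mult x y)
  then show ?case using hecke_rel_mult by blast
next
  case (smult x c)
  then show ?case using hecke_rel_smult by blast
qed

lemma Hbar_generators_closed:
  "g \<in> carrier (Gpow G m) \<Longrightarrow> Hbar_g G m g \<in> carrier (Hbar G m :: ('f::field, _) module)"
  "k \<in> {1..<m} \<Longrightarrow> Hbar_s G m k \<in> carrier (Hbar G m :: ('f::field, _) module)"
  "Hbar_eps G m l \<in> carrier (Hbar G m :: ('f::field, _) module)"
proof -
  show "Hbar_g G m g \<in> carrier (Hbar G m :: ('f, _) module)" if "g \<in> carrier (Gpow G m)"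
    unfolding Hbar_g_def using that by (intro const_basis_closed diag_mat_closed) (auto simp: Gpow_carrier)
  show "Hbar_s G m k \<in> carrier (Hbar G m :: ('f, _) module)" if "k \<in> {1..<m}"
    unfolding Hbar_s_def using that by (intro const_basis_closed mat_mon_perm(1)) auto
  show "Hbar_eps G m l \<in> carrier (Hbar G m :: ('f, _) module)"
    unfolding Hbar_eps_def by (intro const_basis_closed eps_mat_closed)
qed

text \<open>The source of surjectivity: every letter is the partner of an element of
  \<open>Hbar G m\<close>, and the algebra operations carry this over to all polynomials.\<close>

lemma hecke_rel_right_total:
  fixes a :: "'g wgen list \<Rightarrow> 'f::field"
  assumes "a \<in> carrier (wA m)"
  shows "\<exists>\<alpha> \<in> carrier (Hbar G m). hecke_rel m \<alpha> a"
  using assms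
proof (rule ma_span[where P = "\<lambda>a. \<exists>\<alpha> \<in> carrier (Hbar G m). hecke_rel m \<alpha> a"])
  have "(0 \<odot>\<^bsub>wA m\<^esub> \<one>\<^bsub>wA m\<^esub> :: _ \<Rightarrow> 'f) = (\<lambda>x. 0)" by (simp add: ma_smult)
  then show "\<exists>\<alpha> \<in> carrier (Hbar G m). hecke_rel m \<alpha> (\<lambda>x. 0 :: 'f)"
    using hecke_rel_smult[OF hecke_rel_one, of 0] Hbar_closed(4)[OF Hbar_closed(1)] by metis
next
  fix a b :: "'g wgen list \<Rightarrow> 'f"
  assume "\<exists>\<alpha> \<in> carrier (Hbar G m). hecke_rel m \<alpha> a" "\<exists>\<alpha> \<in> carrier (Hbar G m). hecke_rel m \<alpha> b"
  then show "\<exists>\<alpha> \<in> carrier (Hbar G m). hecke_rel m \<alpha> (a \<oplus>\<^bsub>wA m\<^esub> b)"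
    using hecke_rel_add Hbar_closed(3) by blast
next
  fix c :: 'f and u :: "'g wgen list" assume "u \<in> carrier (free_monoid (wgens G m))"
  then have "u \<in> lists (wgens G m)" by simp
  then have "\<exists>\<alpha> \<in> carrier (Hbar G m). hecke_rel m \<alpha> (basis_elt u :: _ \<Rightarrow> 'f)"
  proof (induction u)
    case Nil
    show ?case using hecke_rel_one Hbar_closed(1) unfolding ma_one free_monoid_simps by blast
  next
    case (Cons x u)
    have "\<exists>\<alpha> \<in> carrier (Hbar G m). hecke_rel m \<alpha> (letter x :: _ \<Rightarrow> 'f)"
      using Cons.hyps(1) hecke_rel_generators(1,2) hecke_rel_u Hbar_generators_closed(1,2) Hbar_closed(6)
      by (cases x) (simp_all only: wgens_iff, blast+)
    moreover have "(basis_elt (x # u) :: _ \<Rightarrow> 'f) = letter x \<otimes>\<^bsub>wA m\<^esub> basis_elt u" by (simp add: ma_mult_basis)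
    ultimately show ?case using Cons.IH hecke_rel_mult Hbar_closed(2) by metis
  qed
  then show "\<exists>\<alpha> \<in> carrier (Hbar G m). hecke_rel m \<alpha> (c \<odot>\<^bsub>wA m\<^esub> basis_elt u)"
    using hecke_rel_smult Hbar_closed(4) by blast
qed

abbreviation "hecke_coset \<equiv> \<lambda>a. wreath_Hecke_ideal G m +>\<^bsub>wA m\<^esub> a"

text \<open>Well-definedness, and the one place where the joint injectivity
  \<open>hecke_ideal_iff\<close> enters: the difference of two partners of \<alpha> vanishes at
  every level.\<close>

lemma hecke_rel_coset_unique:
  fixes a b :: "'g wgen list \<Rightarrow> 'f::field"
  assumes "hecke_rel m \<alpha> a" "hecke_rel m \<alpha> b"
  shows "hecke_coset a = hecke_coset b"
proof -
  interpret A: ring "wA m :: ('f, _) module" by (rule free_alg_ring)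
  have ab: "a \<in> carrier (wA m)" "b \<in> carrier (wA m)" using assms unfolding hecke_rel_def by blast+
  have "ma_ext (jm_word G m n) (a \<ominus>\<^bsub>wA m\<^esub> b) = (\<lambda>_. 0)" if n: "m \<le> n" for n
  proof -
    interpret e: ring_hom_ring "wA m :: ('f, _) module" "mon_alg G" "ma_ext (jm_word G m n)" by (rule jm_eval_hom(1)[OF n])
    have "ma_ext (jm_word G m n) a = ma_ext (jm_word G m n) b"
      using assms n unfolding hecke_rel_def by metis
    then show ?thesis using e.hom_minus_eq_zero[OF ab] unfolding ma_zero by simp
  qed
  then have "a \<ominus>\<^bsub>wA m\<^esub> b \<in> wreath_Hecke_ideal G m"
    using hecke_ideal_iff[OF A.minus_closed[OF ab]] by blast
  then show ?thesis using A.quotient_eq_iff_same_a_r_cos[OF hecke_ideal ab] by simp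
qed

text \<open>The union in \<open>quot_alg\<close> runs over equal cosets: scaling is multiplication
  by c times the unit, which is well defined modulo the ideal.\<close>

lemma wreath_Hecke_smult:
  fixes a :: "'g wgen list \<Rightarrow> 'f::field"
  assumes a: "a \<in> carrier (wA m)"
  shows "c \<odot>\<^bsub>wreath_Hecke G m\<^esub> hecke_coset a = hecke_coset (c \<odot>\<^bsub>wA m\<^esub> a)"
proof -
  let ?A = "wA m :: ('f, _) module"
  interpret A: ring ?A by (rule free_alg_ring)
  interpret I: ideal "wreath_Hecke_ideal G m" ?A by (rule hecke_ideal)
  interpret q: ring_hom_ring ?A "?A Quot wreath_Hecke_ideal G m" "hecke_coset" by (rule I.rcos_ring_hom_ring)
  let ?c = "c \<odot>\<^bsub>?A\<^esub> \<one>\<^bsub>?A\<^esub>"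
  have cc: "?c \<in> carrier ?A" by (rule ma_smult_closed[OF A.one_closed])
  have s: "c \<odot>\<^bsub>?A\<^esub> x = ?c \<otimes>\<^bsub>?A\<^esub> x" if "x \<in> carrier ?A" for x
    unfolding ma_smult_mult_left[OF ma_carrierD[OF A.one_closed] ma_carrierD[OF that]] A.l_one[OF that] ..
  have sub: "hecke_coset a \<subseteq> carrier ?A" by (rule A.a_r_coset_subset_G[OF I.a_subset a])
  have "hecke_coset (c \<odot>\<^bsub>?A\<^esub> x) = hecke_coset (c \<odot>\<^bsub>?A\<^esub> a)" if x: "x \<in> hecke_coset a" for x
  proof -
    have xc: "x \<in> carrier ?A" using sub x by (rule subsetD)
    have "hecke_coset a = hecke_coset x" by (rule I.a_repr_independence'[OF x a])
    then show ?thesis unfolding s[OF xc] s[OF a] q.hom_mult[OF cc xc] q.hom_mult[OF cc a] by simp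
  qed
  moreover have "a \<in> hecke_coset a" by (rule I.a_rcos_self[OF a])
  ultimately have "(\<Union>x \<in> hecke_coset a. hecke_coset (c \<odot>\<^bsub>?A\<^esub> x)) = hecke_coset (c \<odot>\<^bsub>?A\<^esub> a)" by blast
  then show ?thesis unfolding wreath_Hecke_def quot_alg_def by simp
qed

text \<open>By \<open>hecke_rel_coset_unique\<close> the coset does not depend on the chosen
  partner. The restriction to the carrier makes the map extensional, which uniqueness among total
  functions requires.\<close>

definition hecke_epi :: "('g, 'f::field) gseq \<Rightarrow> ('g wgen list \<Rightarrow> 'f) set" where
  "hecke_epi = (\<lambda>\<alpha> \<in> carrier (Hbar G m). hecke_coset (SOME a. hecke_rel m \<alpha> a))"

lemma hecke_epi_eq:
  assumes "\<alpha> \<in> carrier (Hbar G m)" "hecke_rel m \<alpha> (a :: _ \<Rightarrow> 'f::field)"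
  shows "hecke_epi \<alpha> = hecke_coset a"
proof -
  have "hecke_rel m \<alpha> (SOME a. hecke_rel m \<alpha> a)" using someI[of "hecke_rel m \<alpha>", OF assms(2)] .
  then have "hecke_coset (SOME a. hecke_rel m \<alpha> a) = hecke_coset a" using assms(2) by (rule hecke_rel_coset_unique)
  then show ?thesis unfolding hecke_epi_def restrict_apply'[OF assms(1)] .
qed

lemma hecke_epi: "(hecke_epi :: ('g, 'f::field) gseq \<Rightarrow> _) \<in> alg_epi (Hbar G m) (wreath_Hecke G m)"
proof -
  let ?A = "wA m :: ('f, _) module"
  interpret A: ring ?A by (rule free_alg_ring)
  interpret I: ideal "wreath_Hecke_ideal G m" ?A by (rule hecke_ideal)
  interpret q: ring_hom_ring ?A "?A Quot wreath_Hecke_ideal G m" "hecke_coset" by (rule I.rcos_ring_hom_ring)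
  have carr: "a \<in> carrier ?A" if "hecke_rel m \<alpha> a" for \<alpha> a using that unfolding hecke_rel_def by blast
  have "(hecke_epi :: ('g, 'f) gseq \<Rightarrow> _) \<in> ring_hom (Hbar G m) (wreath_Hecke G m)"
  proof (rule ring_hom_memI)
    fix \<alpha> :: "('g, 'f) gseq" assume \<alpha>: "\<alpha> \<in> carrier (Hbar G m)"
    obtain a where a: "hecke_rel m \<alpha> a" using hecke_rel_left_total[OF \<alpha>] by blast
    show "hecke_epi \<alpha> \<in> carrier (wreath_Hecke G m)"
      unfolding hecke_epi_eq[OF \<alpha> a] wreath_Hecke_simps by (rule q.hom_closed[OF carr[OF a]])
    fix \<beta> :: "('g, 'f) gseq" assume \<beta>: "\<beta> \<in> carrier (Hbar G m)"
    obtain b where b: "hecke_rel m \<beta> b" using hecke_rel_left_total[OF \<beta>] by blast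
    show "hecke_epi (\<alpha> \<otimes>\<^bsub>Hbar G m\<^esub> \<beta>) = hecke_epi \<alpha> \<otimes>\<^bsub>wreath_Hecke G m\<^esub> hecke_epi \<beta>"
      unfolding Hbar_simps wreath_Hecke_simps hecke_epi_eq[OF \<alpha> a] hecke_epi_eq[OF \<beta> b]
        hecke_epi_eq[OF Hbar_closed(2)[OF \<alpha> \<beta>] hecke_rel_mult[OF a b]]
      by (rule q.hom_mult[OF carr[OF a] carr[OF b]])
    show "hecke_epi (\<alpha> \<oplus>\<^bsub>Hbar G m\<^esub> \<beta>) = hecke_epi \<alpha> \<oplus>\<^bsub>wreath_Hecke G m\<^esub> hecke_epi \<beta>"
      unfolding Hbar_simps wreath_Hecke_simps hecke_epi_eq[OF \<alpha> a] hecke_epi_eq[OF \<beta> b]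
        hecke_epi_eq[OF Hbar_closed(3)[OF \<alpha> \<beta>] hecke_rel_add[OF a b]]
      by (rule q.hom_add[OF carr[OF a] carr[OF b]])
  next
    show "(hecke_epi :: ('g, 'f) gseq \<Rightarrow> _) \<one>\<^bsub>Hbar G m\<^esub> = \<one>\<^bsub>wreath_Hecke G m\<^esub>"
      unfolding Hbar_simps wreath_Hecke_simps hecke_epi_eq[OF Hbar_closed(1) hecke_rel_one] by (rule q.hom_one)
  qed
  moreover have "hecke_epi (c \<odot>\<^bsub>Hbar G m\<^esub> \<alpha>) = c \<odot>\<^bsub>wreath_Hecke G m\<^esub> hecke_epi \<alpha>"
    if \<alpha>: "\<alpha> \<in> carrier (Hbar G m)" for c :: 'f and \<alpha> :: "('g, 'f) gseq"
  proof -
    obtain a where a: "hecke_rel m \<alpha> a" using hecke_rel_left_total[OF \<alpha>] by blast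
    show ?thesis
      unfolding Hbar_simps hecke_epi_eq[OF \<alpha> a] wreath_Hecke_smult[OF carr[OF a]]
      by (rule hecke_epi_eq[OF Hbar_closed(4)[OF \<alpha>] hecke_rel_smult[OF a]])
  qed
  ultimately have hom: "(hecke_epi :: ('g, 'f) gseq \<Rightarrow> _) \<in> alg_hom (Hbar G m) (wreath_Hecke G m)"
    unfolding alg_hom_def by blast
  have "carrier (wreath_Hecke G m) \<subseteq> (hecke_epi :: ('g, 'f) gseq \<Rightarrow> _) ` carrier (Hbar G m)"
  proof
    fix C :: "('g wgen list \<Rightarrow> 'f) set" assume "C \<in> carrier (wreath_Hecke G m)"
    then obtain a where a: "a \<in> carrier ?A" "C = hecke_coset a"
      unfolding wreath_Hecke_simps FactRing_def A_RCOSETS_def' by auto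
    obtain \<alpha> where \<alpha>: "\<alpha> \<in> carrier (Hbar G m)" "hecke_rel m \<alpha> a" using hecke_rel_right_total[OF a(1)] by blast
    show "C \<in> hecke_epi ` carrier (Hbar G m)" using hecke_epi_eq[OF \<alpha>] a(2) \<alpha>(1) by blast
  qed
  moreover have "(hecke_epi :: ('g, 'f) gseq \<Rightarrow> _) ` carrier (Hbar G m) \<subseteq> carrier (wreath_Hecke G m)"
    using hom unfolding alg_hom_def ring_hom_def by blast
  ultimately show ?thesis using hom unfolding alg_epi_def by blast
qed

end

end

theorem lemma5p2:
  fixes G :: "('g, 'b) monoid_scheme" and m :: nat
  assumes "group G" and "finite (carrier G)" and "m \<ge> 1"
  shows "\<exists>!\<Phi> :: ('g, 'f::field) gseq \<Rightarrow> ('g wgen list \<Rightarrow> 'f) set.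
           \<Phi> \<in> extensional (carrier (Hbar G m)) \<and>
           \<Phi> \<in> alg_epi (Hbar G m) (wreath_Hecke G m) \<and>
           (\<forall>g \<in> carrier (Gpow G m). \<Phi> (Hbar_g G m g) = wh_gen G m (GenG g)) \<and>
           (\<forall>k \<in> {1..<m}. \<Phi> (Hbar_s G m k) = wh_gen G m (GenS k)) \<and>
           (\<forall>l \<in> {1..m}. \<Phi> (u_seq G m l) = wh_gen G m (GenX l)) \<and>
           (\<forall>l \<in> {1..m}. \<Phi> (Hbar_eps G m l) = \<zero>\<^bsub>wreath_Hecke G m\<^esub>)"
proof -
  interpret finite_group G using assms(1,2) by (intro finite_group.intro finite_group_axioms.intro)
  let ?P = "\<lambda>\<Phi> :: ('g, 'f) gseq \<Rightarrow> ('g wgen list \<Rightarrow> 'f) set.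
           \<Phi> \<in> extensional (carrier (Hbar G m)) \<and>
           \<Phi> \<in> alg_epi (Hbar G m) (wreath_Hecke G m) \<and>
           (\<forall>g \<in> carrier (Gpow G m). \<Phi> (Hbar_g G m g) = wh_gen G m (GenG g)) \<and>
           (\<forall>k \<in> {1..<m}. \<Phi> (Hbar_s G m k) = wh_gen G m (GenS k)) \<and>
           (\<forall>l \<in> {1..m}. \<Phi> (u_seq G m l) = wh_gen G m (GenX l)) \<and>
           (\<forall>l \<in> {1..m}. \<Phi> (Hbar_eps G m l) = \<zero>\<^bsub>wreath_Hecke G m\<^esub>)"
  let ?\<Phi> = "hecke_epi m :: ('g, 'f) gseq \<Rightarrow> ('g wgen list \<Rightarrow> 'f) set"
  have ex: "?P ?\<Phi>"
  proof (intro conjI ballI)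
    show "?\<Phi> \<in> extensional (carrier (Hbar G m))" unfolding hecke_epi_def by (rule restrict_extensional)
    show "?\<Phi> \<in> alg_epi (Hbar G m) (wreath_Hecke G m)" by (rule hecke_epi)
    show "?\<Phi> (Hbar_g G m g) = wh_gen G m (GenG g)" if "g \<in> carrier (Gpow G m)" for g
      unfolding wh_gen_def by (rule hecke_epi_eq[OF Hbar_generators_closed(1)[OF that] hecke_rel_generators(1)[OF that]])
    show "?\<Phi> (Hbar_s G m k) = wh_gen G m (GenS k)" if "k \<in> {1..<m}" for k
      unfolding wh_gen_def by (rule hecke_epi_eq[OF Hbar_generators_closed(2)[OF that] hecke_rel_generators(2)[OF that]])
    show "?\<Phi> (u_seq G m l) = wh_gen G m (GenX l)" if "l \<in> {1..m}" for l
      unfolding wh_gen_def by (rule hecke_epi_eq[OF Hbar_closed(6)[OF that] hecke_rel_u[OF that]])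
    interpret A: ring "free_alg (wgens G m) :: ('f, 'g wgen list \<Rightarrow> 'f) module" by (rule free_alg_ring)
    interpret I: ideal "wreath_Hecke_ideal G m" "free_alg (wgens G m) :: ('f, 'g wgen list \<Rightarrow> 'f) module" by (rule hecke_ideal)
    \<comment> \<open>The partner of \<epsilon>_l is the zero polynomial; its coset is the ideal
      itself, which is the zero of the quotient.\<close>
    show "?\<Phi> (Hbar_eps G m l) = \<zero>\<^bsub>wreath_Hecke G m\<^esub>" if "l \<in> {1..m}" for l
      unfolding wreath_Hecke_simps hecke_epi_eq[OF Hbar_generators_closed(3) hecke_rel_generators(3)[OF that]]
      by (rule A.a_rcos_zero[OF hecke_ideal I.zero_closed])
  qed
  show ?thesis
  proof (rule ex1I[of ?P, OF ex])
    fix \<Psi> assume \<Psi>: "?P \<Psi>"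
    have hom: "\<Psi> \<in> alg_hom (Hbar G m) (wreath_Hecke G m)" "?\<Phi> \<in> alg_hom (Hbar G m) (wreath_Hecke G m)"
      using \<Psi> ex unfolding alg_epi_def by blast+
    show "\<Psi> = ?\<Phi>"
    proof (rule extensionalityI)
      show "\<Psi> \<in> extensional (carrier (Hbar G m))" "?\<Phi> \<in> extensional (carrier (Hbar G m))"
        using \<Psi> ex by blast+
      show "\<Psi> \<alpha> = ?\<Phi> \<alpha>" if "\<alpha> \<in> carrier (Hbar G m)" for \<alpha>
        by (rule alg_hom_Hbar_eqI[OF hom _ _ _ _ that]) (use \<Psi> ex in simp_all)
    qed
  qed
qed

end
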